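(* Let $A\in\mathbb{C}^{n\times n}$ be Hermitian with eigenvalues $\lambda_1\ge\cdots\ge\lambda_n$ and associated orthonormal eigenvectors $x_1,\dots,x_n$. Let $1\le p<n$, assume $\lambda_p>\lambda_{p+1}>\lambda_n$, and put $\mathcal{X}=\mathrm{span}\{x_1,\dots,x_p\}$. Let $\mathcal{Y}\subset\mathbb{C}^n$ be a $p$-dimensional subspace with $\angle(\mathcal{X},\mathcal{Y})<\pi/2$, and let $y_1,\dots,y_p$ be the basis of $\mathcal{Y}$ biorthogonal to $x_1,\dots,x_p$ (defined in the context). Let $k\ge1$ be an integer and $$\mathcal{K}=\mathcal{Y}+A\mathcal{Y}+\cdots+A^{k-1}\mathcal{Y}.$$ For $j\in\{1,\dots,p\}$ set $$\sigma_j=\left[T_{k-1}(1+2\gamma_j)\right]^{-1},\qquad \gamma_j=\frac{\lambda_j-\lambda_{p+1}}{\lambda_{p+1}-\lambda_n},$$ where $T_{k-1}$ is the Chebyshev polynomial of the first kind of degree $k-1$. (1) Let $\tau=\{i_1,\dots,i_t\}\subseteq\{1,\dots,p\}$ with $i_1<\cdots<i_t$, $\mathcal{X}_\tau=\mathrm{span}\{x_{i_1},\dots,x_{i_t}\}$ and $\mathcal{Y}_\tau=\mathrm{span}\{y_{i_1},\dots,y_{i_t}\}$. Then $$\tan\Theta(\mathcal{X}_\tau,\mathcal{K})\prec_w[\sigma_{i_t},\dots,\sigma_{i_1}]\,\tan\Theta(\mathcal{X}_\tau,\mathcal{Y}_\tau)\le[\sigma_{i_t},\dots,\sigma_{i_1}]\,\tan\Theta_t(\mathcal{X},\mathcal{Y}),$$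 where $\Theta_t(\mathcal{X},\mathcal{Y})$ is the tuple of the first $t$ components of $\Theta(\mathcal{X},\mathcal{Y})$. (2) Let $\psi_1\ge\cdots\ge\psi_p$ be the $p$ largest Ritz values of $A$ in $\mathcal{K}$, let $i\in\{1,\dots,p\}$, $\mathcal{X}_i=\mathrm{span}\{x_1,\dots,x_i\}$ and $\mathcal{Y}_i=\mathrm{span}\{y_1,\dots,y_i\}$. Then $$\left[\frac{\lambda_1-\psi_1}{\psi_1-\lambda_n},\,\dots,\,\frac{\lambda_i-\psi_i}{\psi_i-\lambda_n}\right]\prec_w[\sigma_i^2,\dots,\sigma_1^2]\,\tan^2\Theta(\mathcal{X}_i,\mathcal{Y}_i)\le[\sigma_i^2,\dots,\sigma_1^2]\,\tan^2\Theta_i(\mathcal{X},\mathcal{Y}),$$ where $\Theta_i(\mathcal{X},\mathcal{Y})$ is the tuple of the first $i$ components of $\Theta(\mathcal{X},\mathcal{Y})$. Products, squares and the inequality $\le$ between tuples are componentwise.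
   Context: Superscript $H$ denotes the conjugate transpose. The Ritz values of $A$ in a subspace $\mathcal{W}$ with orthonormal basis matrix $W$ are the eigenvalues of $W^HAW$. Principal angles: for subspaces $\mathcal{U},\mathcal{V}\subset\mathbb{C}^n$ with $\dim\mathcal{U}=s\le\dim\mathcal{V}$ and orthonormal basis matrices $U,V$, the cosines of the principal angles from $\mathcal{U}$ to $\mathcal{V}$ are the $s$ singular values of $V^HU$. Arranged as $\theta_1\ge\cdots\ge\theta_s$ in $[0,\pi/2]$, they form $\Theta(\mathcal{U},\mathcal{V})=[\theta_1,\dots,\theta_s]$, and $\tan\Theta(\mathcal{U},\mathcal{V})=[\tan\theta_1,\dots,\tan\theta_s]$. The largest one, $\theta_1$, is denoted $\angle(\mathcal{U},\mathcal{V})$. Biorthogonal basis: with $X=[x_1,\dots,x_p]$ and any orthonormal basis matrix $\widetilde{Y}\in\mathbb{C}^{n\times p}$ of $\mathcal{Y}$, the matrix $X^H\widetilde{Y}$ is invertible (because $\angle(\mathcal{X},\mathcal{Y})<\pi/2$), and $y_i=\widetilde{Y}c_i$ where $c_1,\dots,c_p$ are the columns of $(X^H\widetilde{Y})^{-1}$; thus $x_i^Hy_j=\delta_{ij}$ for $i,j\in\{1,\dots,p\}$. Majorization: for a real tuple $a=[a_1,\dots,a_d]$, $a^{\downarrow}$ is its rearrangement in decreasing (not strictly) order. For real tuples $a,b$ of length $d$, $a\prec_w b$ means $\sum_{i=1}^k a_i^{\downarrow}\le\sum_{i=1}^k b_i^{\downarrow}$ for all $k\in\{1,\dots,d\}$.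 *)

theory Defs
  imports
    Complex_Main
    "HOL-Computational_Algebra.Fundamental_Theorem_Algebra"
    "Jordan_Normal_Form.Spectral_Radius"
    "Jordan_Normal_Form.DL_Rank"
begin

abbreviation cvec_space :: "nat \<Rightarrow> (complex, complex vec) module" where
  "cvec_space n \<equiv> module_vec TYPE(complex) n"

abbreviation cspan :: "nat \<Rightarrow> complex vec set \<Rightarrow> complex vec set" where
  "cspan n \<equiv> LinearCombinations.module.span class_ring (cvec_space n)"

abbreviation csubspace :: "nat \<Rightarrow> complex vec set \<Rightarrow> bool" where
  "csubspace n W \<equiv> VectorSpace.subspace class_ring W (cvec_space n)"

abbreviation cdim :: "nat \<Rightarrow> complex vec set \<Rightarrow> nat" where
  "cdim n W \<equiv> vectorspace.dim class_ring ((cvec_space n)\<lparr>carrier := W\<rparr>)"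

definition hermitian :: "complex mat \<Rightarrow> bool" where
  "hermitian A \<longleftrightarrow> mat_adjoint A = A"

definition orthonormal_basis_mat :: "nat \<Rightarrow> complex vec set \<Rightarrow> complex mat \<Rightarrow> bool" where
  "orthonormal_basis_mat n S W \<longleftrightarrow>
     W \<in> carrier_mat n (dim_col W) \<and> mat_adjoint W * W = 1\<^sub>m (dim_col W) \<and> cspan n (set (cols W)) = S"

text \<open>An arbitrary orthonormal basis matrix of a subspace. It exists (\<open>orthonormal_basis_mat_exists\<close>),
  and nothing defined from it below depends on the choice (\<open>principal_angles_eq\<close>,
  \<open>ritz_values_eq\<close>, \<open>biorthogonal_basis_eq\<close>).\<close>

definition some_onb :: "nat \<Rightarrow> complex vec set \<Rightarrow> complex mat" where
  "some_onb n S = (SOME W. orthonormal_basis_mat n S W)"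

text \<open>The eigenvalues of a Hermitian matrix with algebraic multiplicity, in decreasing order.
  They are real, so \<open>Re\<close> loses nothing.\<close>

definition hermitian_eigenvalues :: "complex mat \<Rightarrow> real list" where
  "hermitian_eigenvalues M = rev (sorted_list_of_multiset (image_mset Re (proots (char_poly M))))"

definition singular_values :: "complex mat \<Rightarrow> real list" where
  "singular_values M =
     take (min (dim_row M) (dim_col M)) (map sqrt (hermitian_eigenvalues (mat_adjoint M * M)))"

definition ritz_values :: "nat \<Rightarrow> complex mat \<Rightarrow> complex vec set \<Rightarrow> real list" where
  "ritz_values n A S = (let W = some_onb n S in hermitian_eigenvalues (mat_adjoint W * A * W))"

text \<open>The principal angles from \<open>S\<close> to \<open>T\<close> in decreasing order (hence the reversal: the largest
  angle belongs to the smallest singular value). Meant for \<open>dim S \<le> dim T\<close>.\<close>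

definition principal_angles :: "nat \<Rightarrow> complex vec set \<Rightarrow> complex vec set \<Rightarrow> real list" where
  "principal_angles n S T =
     (let U = some_onb n S; V = some_onb n T
      in rev (map arccos (singular_values (mat_adjoint V * U))))"

definition max_angle :: "nat \<Rightarrow> complex vec set \<Rightarrow> complex vec set \<Rightarrow> real" where
  "max_angle n S T = hd (principal_angles n S T)"

text \<open>Vectors are indexed from 1, matrix columns from 0.\<close>

definition biorthogonal_basis ::
    "nat \<Rightarrow> nat \<Rightarrow> (nat \<Rightarrow> complex vec) \<Rightarrow> complex vec set \<Rightarrow> nat \<Rightarrow> complex vec" where
  "biorthogonal_basis n p x S i =
     (let X = mat_of_cols n (map x [1..<p+1]); Yt = some_onb n S;
          C = the (mat_inverse (mat_adjoint X * Yt))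
      in Yt *\<^sub>v col C (i - 1))"

definition block_krylov :: "nat \<Rightarrow> complex mat \<Rightarrow> complex vec set \<Rightarrow> nat \<Rightarrow> complex vec set" where
  "block_krylov n A S k =
     {finsum_vec TYPE(complex) n (\<lambda>j. (A ^\<^sub>m j) *\<^sub>v v j) {..<k} | v. \<forall>j<k. v j \<in> S}"

fun cheb_poly :: "nat \<Rightarrow> real poly" where
  "cheb_poly 0 = 1"
| "cheb_poly (Suc 0) = [:0, 1:]"
| "cheb_poly (Suc (Suc m)) = [:0, 2:] * cheb_poly (Suc m) - cheb_poly m"

definition weakly_majorized :: "real list \<Rightarrow> real list \<Rightarrow> bool" (infix \<open>\<prec>\<^sub>w\<close> 50) where
  "a \<prec>\<^sub>w b \<longleftrightarrow> length a = length b \<and>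
     (\<forall>k\<in>{1..length a}. sum_list (take k (rev (sort a))) \<le> sum_list (take k (rev (sort b))))"

abbreviation tuple_le :: "real list \<Rightarrow> real list \<Rightarrow> bool" (infix \<open>\<le>\<^sub>t\<close> 50) where
  "a \<le>\<^sub>t b \<equiv> list_all2 (\<le>) a b"

abbreviation tuple_times :: "real list \<Rightarrow> real list \<Rightarrow> real list" (infixl \<open>*\<^sub>t\<close> 70) where
  "a *\<^sub>t b \<equiv> map2 (*) a b"

lemma cheb_poly_cos: "poly (cheb_poly m) (cos t) = cos (real m * t)"
proof (induction m rule: cheb_poly.induct)
  case (3 m)
  have "cos (real (Suc (Suc m)) * t) = cos (real (Suc m) * t + t)"
    and "cos (real m * t) = cos (real (Suc m) * t - t)"
    by (simp_all add: algebra_simps)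
  then have "cos (real (Suc (Suc m)) * t) = 2 * cos t * cos (real (Suc m) * t) - cos (real m * t)"
    by (simp add: cos_add cos_diff)
  with 3 show ?case by simp
qed simp_all

lemma dim_row_mat_adjoint [simp]: "dim_row (mat_adjoint (A :: complex mat)) = dim_col A"
  and dim_col_mat_adjoint [simp]: "dim_col (mat_adjoint (A :: complex mat)) = dim_row A"
  by (simp_all add: mat_adjoint_def)

lemma mat_adjoint_carrier [simp]:
  assumes "(A :: complex mat) \<in> carrier_mat nr nc"
  shows "mat_adjoint A \<in> carrier_mat nc nr"
  by (rule carrier_matI) (simp_all add: carrier_matD[OF assms])

lemma index_mat_adjoint [simp]:
  assumes "i < dim_col (A :: complex mat)" "j < dim_row A"
  shows "mat_adjoint A $$ (i, j) = cnj (A $$ (j, i))"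
  using assms unfolding mat_adjoint_def by (simp add: mat_of_rows_def)

lemma mat_adjoint_mult:
  assumes A: "(A :: complex mat) \<in> carrier_mat a b" and B: "B \<in> carrier_mat b c"
  shows "mat_adjoint (A * B) = mat_adjoint B * mat_adjoint A"
proof (rule eq_matI)
  have d: "dim_row A = a" "dim_col A = b" "dim_row B = b" "dim_col B = c"
    using A B by auto
  fix i j
  assume "i < dim_row (mat_adjoint B * mat_adjoint A)" "j < dim_col (mat_adjoint B * mat_adjoint A)"
  then have ij: "i < c" "j < a" by (simp_all add: d)
  have "mat_adjoint (A * B) $$ (i, j) = (\<Sum>l = 0..<b. cnj (A $$ (j, l) * B $$ (l, i)))"
    using ij by (simp add: d scalar_prod_def)
  also have "\<dots> = (\<Sum>l = 0..<b. mat_adjoint B $$ (i, l) * mat_adjoint A $$ (l, j))"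
    by (rule sum.cong) (use ij in \<open>simp_all add: d\<close>)
  also have "\<dots> = (mat_adjoint B * mat_adjoint A) $$ (i, j)"
    using ij by (simp add: d scalar_prod_def)
  finally show "mat_adjoint (A * B) $$ (i, j) = (mat_adjoint B * mat_adjoint A) $$ (i, j)" .
qed (use A B in simp_all)

lemma mat_adjoint_adjoint [simp]: "mat_adjoint (mat_adjoint (A :: complex mat)) = A"
  by (intro eq_matI) auto

lemma mat_left_right_inverse_dim:
  fixes A :: "complex mat"
  assumes A: "A \<in> carrier_mat a b" and B: "B \<in> carrier_mat b a"
    and "A * B = 1\<^sub>m a" and "B * A = 1\<^sub>m b"
  shows "a = b"
proof -
  have "(\<Sum>i<a. (A * B) $$ (i, i)) = (\<Sum>i<a. \<Sum>j<b. A $$ (i, j) * B $$ (j, i))"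
    using A B by (auto simp: scalar_prod_def atLeast0LessThan intro!: sum.cong)
  also have "\<dots> = (\<Sum>j<b. \<Sum>i<a. B $$ (j, i) * A $$ (i, j))"
    by (subst sum.swap) (simp add: mult.commute)
  also have "\<dots> = (\<Sum>j<b. (B * A) $$ (j, j))"
    using A B by (auto simp: scalar_prod_def atLeast0LessThan intro!: sum.cong)
  finally have "(of_nat a :: complex) = of_nat b"
    using assms(3,4) by simp
  then show ?thesis by simp
qed

lemma cspan_cols_factor:
  assumes W: "W \<in> carrier_mat n r" and W': "W' \<in> carrier_mat n s"
    and sub: "cspan n (set (cols W')) \<subseteq> cspan n (set (cols W))"
  shows "\<exists>Z \<in> carrier_mat r s. W' = W * Z"
proof -
  interpret vec_space "TYPE(complex)" n .
  have *: "\<exists>z \<in> carrier_vec r. W *\<^sub>v z = col W' j" if j: "j < s" for j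
  proof -
    have "col W' j \<in> set (cols W')"
      using j W' by (auto simp: cols_def)
    moreover have "set (cols W') \<subseteq> carrier_vec n"
      using W' cols_dim by blast
    ultimately have "col W' j \<in> span (set (cols W'))"
      using in_own_span by auto
    then have "col W' j \<in> col_space W"
      using sub unfolding col_space_def by auto
    then show ?thesis
      using col_space_eq[OF W] W by auto
  qed
  then obtain z where z: "\<And>j. j < s \<Longrightarrow> z j \<in> carrier_vec r \<and> W *\<^sub>v z j = col W' j"
    by metis
  define Z where "Z = mat_of_cols r (map z [0..<s])"
  have Z: "Z \<in> carrier_mat r s"
    unfolding Z_def by (metis mat_of_cols_carrier(1) length_map length_upt minus_nat.diff_0)
  have "W' = W * Z"
  proof (rule mat_col_eqI)
    fix j assume "j < dim_col (W * Z)"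
    then have j: "j < s" using Z by simp
    have "col Z j = z j"
      unfolding Z_def using j z by (subst col_mat_of_cols) auto
    then show "col W' j = col (W * Z) j"
      using col_mult2[OF W Z j] z[OF j] by simp
  qed (use W W' Z in auto)
  with Z show ?thesis by blast
qed

lemma orthonormal_basis_mat_unique:
  assumes "orthonormal_basis_mat n S W" and "orthonormal_basis_mat n S W'"
    and r: "W \<in> carrier_mat n r"
  obtains Q where "Q \<in> carrier_mat r r" "mat_adjoint Q * Q = 1\<^sub>m r"
    "Q * mat_adjoint Q = 1\<^sub>m r" "W' = W * Q"
proof -
  let ?r = "dim_col W" and ?s = "dim_col W'"
  from assms have W: "W \<in> carrier_mat n ?r" "mat_adjoint W * W = 1\<^sub>m ?r"
    and W': "W' \<in> carrier_mat n ?s" "mat_adjoint W' * W' = 1\<^sub>m ?s"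
    and eq: "cspan n (set (cols W)) = cspan n (set (cols W'))"
    unfolding orthonormal_basis_mat_def by auto
  obtain Z where Z: "Z \<in> carrier_mat ?r ?s" "W' = W * Z"
    using cspan_cols_factor[OF W(1) W'(1)] eq by auto
  obtain Z' where Z': "Z' \<in> carrier_mat ?s ?r" "W = W' * Z'"
    using cspan_cols_factor[OF W'(1) W(1)] eq by auto
  have aW: "mat_adjoint W \<in> carrier_mat ?r n" and aW': "mat_adjoint W' \<in> carrier_mat ?s n"
    using mat_adjoint_carrier[OF W(1)] mat_adjoint_carrier[OF W'(1)] by blast+
  have 1: "mat_adjoint W * W' = Z"
    by (metis Z(1,2) W(2) aW W(1) assoc_mult_mat left_mult_one_mat)
  have 2: "mat_adjoint W' * W = Z'"
    by (metis Z'(1,2) W'(2) aW' W'(1) assoc_mult_mat left_mult_one_mat)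
  have 3: "Z' = mat_adjoint Z"
    by (metis mat_adjoint_mult[OF aW W'(1)] mat_adjoint_adjoint 1 2)
  have 4: "Z * Z' = 1\<^sub>m ?r"
    by (metis assoc_mult_mat[OF aW W'(1) Z'(1)] 1 Z'(2) W(2))
  have 5: "Z' * Z = 1\<^sub>m ?s"
    by (metis assoc_mult_mat[OF aW' W(1) Z(1)] 2 Z(2) W'(2))
  have "?r = ?s"
    by (rule mat_left_right_inverse_dim[OF Z(1) Z'(1) 4 5])
  moreover have "?r = r" using r by simp
  ultimately show ?thesis
    by (metis that[of Z] Z 3 4 5)
qed

lemma csubspace_basis_exists:
  assumes "csubspace n S"
  obtains B where "finite B" "B \<subseteq> S" "cspan n B = S"
    "\<not> LinearCombinations.module.lin_dep class_ring (cvec_space n) B" "card B = cdim n S"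
proof -
  interpret vec_space "TYPE(complex)" n .
  have sub: "submodule class_ring S V"
    using assms unfolding VectorSpace.subspace_def by (elim conjE)
  have SC: "S \<subseteq> carrier_vec n"
    using sub unfolding submodule_def by simp
  have vs: "vectorspace class_ring (vs S)"
    by (rule subspace_is_vs[OF assms])
  have "\<exists>B. finite B \<and> maximal B (\<lambda>B. B \<subseteq> S \<and> lin_indpt B)"
  proof (rule maximal_exists[where N = dim and B = "{}"])
    show "{} \<subseteq> S \<and> lin_indpt {}"
      by (auto simp: lin_dep_def)
    show "finite A \<and> card A \<le> dim" if "A \<subseteq> S \<and> lin_indpt A" for A
    proof -
      have A: "A \<subseteq> carrier_vec n" "lin_indpt A"
        using subset_trans[OF conjunct1[OF that] SC] conjunct2[OF that] by simp_all
      show ?thesis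
        by (intro conjI li_le_dim[OF fin_dim A])
    qed
  qed
  then obtain B where B: "finite B" "maximal B (\<lambda>B. B \<subseteq> S \<and> lin_indpt B)"
    by (elim exE conjE)
  have "maximal B (\<lambda>B. B \<subseteq> carrier (vs S) \<and> \<not> LinearCombinations.module.lin_dep class_ring (vs S) B)"
    using B(2) span_li_not_depend(2)[OF _ sub] unfolding maximal_def carrier_vs_is_self by metis
  then have basis: "vectorspace.basis class_ring (vs S) B"
    by (rule vectorspace.max_li_is_basis[OF vs])
  have BS: "B \<subseteq> S" and ind: "lin_indpt B"
    using conjunct1[OF B(2)[unfolded maximal_def]] by simp_all
  have "span B = S"
    using basis span_li_not_depend(1)[OF BS sub] by (simp add: vectorspace.basis_def[OF vs])
  moreover have "cdim n S = card B"
    using vectorspace.dim_basis[OF vs B(1) basis] .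
  ultimately show thesis
    using that[OF B(1) BS _ ind] by simp
qed

lemma orthonormal_basis_mat_exists:
  assumes "csubspace n S"
  shows "\<exists>W. orthonormal_basis_mat n S W \<and> dim_col W = cdim n S"
proof -
  interpret cof_vec_space n "TYPE(complex)" .
  obtain B where B: "finite B" "B \<subseteq> S" "span B = S" "lin_indpt B" "card B = cdim n S"
    using csubspace_basis_exists[OF assms] .
  have SC: "S \<subseteq> carrier_vec n"
    using assms unfolding VectorSpace.subspace_def submodule_def by simp
  obtain bs where bs: "set bs = B" "distinct bs"
    using B(1) finite_distinct_list by blast
  define us where "us = gram_schmidt n bs"
  have bsC: "set bs \<subseteq> carrier_vec n" using bs B SC by blast
  have bsi: "lin_indpt (set bs)" using bs B by simp
  note gs = gram_schmidt_result[OF bsC bs(2) bsi us_def]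
  have len: "length us = cdim n S"
    using gs(4) bs B(5) distinct_card by fastforce
  have usC: "set us \<subseteq> carrier_vec n" and spus: "span (set us) = S"
    using gs(1,3) bs(1) B(3) by auto
  define c where "c u = complex_of_real (1 / sqrt (Re (u \<bullet>c u)))" for u :: "complex vec"
  define ws where "ws = map (\<lambda>u. c u \<cdot>\<^sub>v u) us"
  have wsC: "set ws \<subseteq> carrier_vec n"
    using usC by (auto simp: ws_def)
  have pos: "u \<bullet>c u = complex_of_real (Re (u \<bullet>c u))" "Re (u \<bullet>c u) > 0" if u: "u \<in> set us" for u
  proof -
    obtain i where i: "i < length us" "us ! i = u"
      using u by (auto simp: in_set_conv_nth)
    have ne: "u \<bullet>c u \<noteq> 0"
      using corthogonalD[OF gs(2) i(1) i(1)] i(2) by simp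
    have eq: "u \<bullet>c u = complex_of_real (\<Sum>j<dim_vec u. (cmod (u $ j))\<^sup>2)"
      by (simp add: scalar_prod_def complex_norm_square atLeast0LessThan del: of_real_power)
    then show "u \<bullet>c u = complex_of_real (Re (u \<bullet>c u))"
      by simp
    have "Re (u \<bullet>c u) \<ge> 0"
      unfolding eq by (simp add: sum_nonneg)
    moreover have "Re (u \<bullet>c u) \<noteq> 0"
      using ne eq by (metis Re_complex_of_real of_real_0)
    ultimately show "Re (u \<bullet>c u) > 0"
      by simp
  qed
  have c0: "c u \<noteq> 0" if "u \<in> set us" for u
    using pos(2)[OF that] by (simp add: c_def)
  have "span (set ws) \<subseteq> span (set us)"
  proof (rule span_subsetI[OF usC], rule subsetI)
    fix w assume "w \<in> set ws"
    then obtain u where "u \<in> set us" "w = c u \<cdot>\<^sub>v u" by (auto simp: ws_def)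
    then show "w \<in> span (set us)"
      using smult_in_span[OF usC] in_own_span[of "set us"] usC by auto
  qed
  moreover have "span (set us) \<subseteq> span (set ws)"
  proof (rule span_subsetI[OF wsC], rule subsetI)
    fix u assume u: "u \<in> set us"
    then have "c u \<cdot>\<^sub>v u \<in> set ws"
      by (simp add: ws_def)
    then have "c u \<cdot>\<^sub>v u \<in> span (set ws)"
      by (rule subsetD[OF in_own_span[of "set ws", simplified, OF wsC]])
    then have "(1 / c u) \<cdot>\<^sub>v (c u \<cdot>\<^sub>v u) \<in> span (set ws)"
      by (rule smult_in_span[OF wsC])
    then show "u \<in> span (set ws)"
      using c0[OF u] by (simp add: smult_smult_assoc)
  qed
  ultimately have spws: "span (set ws) = S"
    using spus by simp
  have orth: "ws ! j \<bullet>c ws ! i = (if i = j then 1 else 0)" if ij: "i < length us" "j < length us" for i j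
  proof -
    let ?u = "us ! i" and ?v = "us ! j"
    have uv: "?u \<in> carrier_vec n" "?v \<in> carrier_vec n"
      using usC ij by auto
    have "ws ! j \<bullet>c ws ! i = c ?v * cnj (c ?u) * (?v \<bullet>c ?u)"
      using uv ij by (simp add: ws_def conjugate_smult_vec)
    also have "\<dots> = (if i = j then 1 else 0)"
    proof (cases "i = j")
      case True
      define a where "a = Re (?u \<bullet>c ?u)"
      have a: "?u \<bullet>c ?u = complex_of_real a" "a > 0"
        using pos[of ?u] ij by (auto simp: a_def)
      have "c ?u * cnj (c ?u) * (?u \<bullet>c ?u) = complex_of_real (1 / sqrt a * (1 / sqrt a) * a)"
        unfolding c_def a_def[symmetric] a(1) by (simp only: complex_cnj_complex_of_real of_real_mult Re_complex_of_real)
      also have "1 / sqrt a * (1 / sqrt a) * a = 1"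
        using a(2) by (simp add: field_simps)
      finally show ?thesis using True by simp
    next
      case False
      then show ?thesis
        using corthogonalD[OF gs(2) ij(2) ij(1)] by simp
    qed
    finally show ?thesis .
  qed
  define W where "W = mat_of_cols n ws"
  have lenws: "length ws = length us" by (simp add: ws_def)
  have W: "W \<in> carrier_mat n (length us)"
    unfolding W_def using mat_of_cols_carrier(1)[of n ws] lenws by simp
  have colW: "col W i = ws ! i" if "i < length us" for i
    unfolding W_def using that wsC lenws by (subst col_mat_of_cols) auto
  have "mat_adjoint W * W = 1\<^sub>m (length us)"
  proof (rule eq_matI)
    fix i j assume "i < dim_row (1\<^sub>m (length us) :: complex mat)" "j < dim_col (1\<^sub>m (length us) :: complex mat)"
    then have ij: "i < length us" "j < length us" by auto
    have "(mat_adjoint W * W) $$ (i, j) = row (mat_adjoint W) i \<bullet> col W j"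
      using ij W by simp
    also have "row (mat_adjoint W) i = conjugate (col W i)"
      using ij W by (intro eq_vecI) auto
    also have "conjugate (col W i) \<bullet> col W j = col W j \<bullet>c col W i"
      using W by (intro comm_scalar_prod[of _ n]) auto
    finally show "(mat_adjoint W * W) $$ (i, j) = 1\<^sub>m (length us) $$ (i, j)"
      using orth[OF ij] colW ij by simp
  qed (use W in auto)
  moreover have "cols W = ws"
    unfolding W_def using cols_mat_of_cols[OF wsC] .
  ultimately have "orthonormal_basis_mat n S W"
    unfolding orthonormal_basis_mat_def using W spws by simp
  then show ?thesis
    using W len by auto
qed

lemma orthonormal_basis_mat_some_onbI:
  "orthonormal_basis_mat n S W \<Longrightarrow> orthonormal_basis_mat n S (some_onb n S)"
  unfolding some_onb_def by (rule someI)

lemma orthonormal_basis_mat_some_onb: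
  assumes "csubspace n S"
  shows "orthonormal_basis_mat n S (some_onb n S)"
  using orthonormal_basis_mat_exists[OF assms] by (elim exE conjE) (rule orthonormal_basis_mat_some_onbI)

lemma hermitian_eigenvalues_conj:
  assumes M: "M \<in> carrier_mat r r" and Q: "Q \<in> carrier_mat r r"
    and "mat_adjoint Q * Q = 1\<^sub>m r" and "Q * mat_adjoint Q = 1\<^sub>m r"
  shows "hermitian_eigenvalues (mat_adjoint Q * M * Q) = hermitian_eigenvalues M"
proof -
  have "similar_mat (mat_adjoint Q * M * Q) M"
    by (rule similar_matI[of _ _ "mat_adjoint Q" Q r])
      (use assms(1-4) mat_adjoint_carrier[OF Q]
        mult_carrier_mat[OF mult_carrier_mat[OF mat_adjoint_carrier[OF Q] M] Q] in simp_all)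
  then show ?thesis
    unfolding hermitian_eigenvalues_def by (simp add: char_poly_similar)
qed

lemma singular_values_conj:
  assumes M: "M \<in> carrier_mat s r"
    and P: "P \<in> carrier_mat s s" "P * mat_adjoint P = 1\<^sub>m s"
    and Q: "Q \<in> carrier_mat r r" "mat_adjoint Q * Q = 1\<^sub>m r" "Q * mat_adjoint Q = 1\<^sub>m r"
  shows "singular_values (mat_adjoint P * M * Q) = singular_values M"
proof -
  note c = M P(1) Q(1)
  have aM: "mat_adjoint M \<in> carrier_mat r s" and aP: "mat_adjoint P \<in> carrier_mat s s"
    and aQ: "mat_adjoint Q \<in> carrier_mat r r"
    using c by auto
  define N where "N = mat_adjoint P * M"
  have N: "N \<in> carrier_mat s r" and aN: "mat_adjoint N \<in> carrier_mat r s"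
    using aP M by (auto simp: N_def)
  have NN: "mat_adjoint N * N = mat_adjoint M * M"
  proof -
    have "mat_adjoint N = mat_adjoint M * P"
      unfolding N_def using mat_adjoint_mult[OF aP M] by simp
    then have "mat_adjoint N * N = mat_adjoint M * (P * N)"
      using assoc_mult_mat[OF aM P(1) N] by simp
    also have "P * N = M"
      unfolding N_def using assoc_mult_mat[OF P(1) aP M] P(2) left_mult_one_mat[OF M] by simp
    finally show ?thesis .
  qed
  have "mat_adjoint (N * Q) * (N * Q) = mat_adjoint Q * mat_adjoint N * (N * Q)"
    using mat_adjoint_mult[OF N Q(1)] by simp
  also have "\<dots> = mat_adjoint Q * (mat_adjoint N * N) * Q"
    using assoc_mult_mat[OF aQ aN N] assoc_mult_mat[OF mult_carrier_mat[OF aQ aN] N Q(1)] by simp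
  finally have "hermitian_eigenvalues (mat_adjoint (N * Q) * (N * Q))
      = hermitian_eigenvalues (mat_adjoint M * M)"
    unfolding NN using hermitian_eigenvalues_conj[OF mult_carrier_mat[OF aM M] Q] by simp
  then show ?thesis
    unfolding singular_values_def N_def[symmetric] using c N by simp
qed

lemma principal_angles_eq:
  assumes U: "orthonormal_basis_mat n S U" and V: "orthonormal_basis_mat n T V"
  shows "principal_angles n S T = rev (map arccos (singular_values (mat_adjoint V * U)))"
proof -
  have U': "orthonormal_basis_mat n S (some_onb n S)" and V': "orthonormal_basis_mat n T (some_onb n T)"
    by (rule orthonormal_basis_mat_some_onbI[OF U]) (rule orthonormal_basis_mat_some_onbI[OF V])
  obtain r s where c: "U \<in> carrier_mat n r" "V \<in> carrier_mat n s"
    using U V unfolding orthonormal_basis_mat_def by (elim conjE)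
  obtain Q where Q: "Q \<in> carrier_mat r r" "mat_adjoint Q * Q = 1\<^sub>m r"
    "Q * mat_adjoint Q = 1\<^sub>m r" "some_onb n S = U * Q"
    using orthonormal_basis_mat_unique[OF U U' c(1)] .
  obtain P where P: "P \<in> carrier_mat s s"
    "P * mat_adjoint P = 1\<^sub>m s" "some_onb n T = V * P"
    using orthonormal_basis_mat_unique[OF V V' c(2)] .
  have aP: "mat_adjoint P \<in> carrier_mat s s" and aV: "mat_adjoint V \<in> carrier_mat s n"
    using P(1) c(2) by auto
  have VU: "mat_adjoint V * U \<in> carrier_mat s r" and UQ: "U * Q \<in> carrier_mat n r"
    using aV c(1) Q(1) by auto
  have "mat_adjoint (V * P) * (U * Q) = mat_adjoint P * (mat_adjoint V * (U * Q))"
    using mat_adjoint_mult[OF c(2) P(1)] assoc_mult_mat[OF aP aV UQ] by simp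
  also have "\<dots> = mat_adjoint P * (mat_adjoint V * U) * Q"
    using assoc_mult_mat[OF aV c(1) Q(1)] assoc_mult_mat[OF aP VU Q(1)] by simp
  finally show ?thesis
    unfolding principal_angles_def Let_def Q(4) P(3)
    using singular_values_conj[OF VU P(1,2) Q(1-3)] by simp
qed

lemma ritz_values_eq:
  assumes A: "A \<in> carrier_mat n n" and W: "orthonormal_basis_mat n S W"
  shows "ritz_values n A S = hermitian_eigenvalues (mat_adjoint W * A * W)"
proof -
  have W': "orthonormal_basis_mat n S (some_onb n S)"
    by (rule orthonormal_basis_mat_some_onbI[OF W])
  obtain r where c: "W \<in> carrier_mat n r"
    using W unfolding orthonormal_basis_mat_def by (elim conjE)
  obtain Q where Q: "Q \<in> carrier_mat r r" "mat_adjoint Q * Q = 1\<^sub>m r"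
    "Q * mat_adjoint Q = 1\<^sub>m r" "some_onb n S = W * Q"
    using orthonormal_basis_mat_unique[OF W W' c] .
  have aQ: "mat_adjoint Q \<in> carrier_mat r r" and aW: "mat_adjoint W \<in> carrier_mat r n"
    using Q(1) c by auto
  have WA: "mat_adjoint W * A \<in> carrier_mat r n" and WAW: "mat_adjoint W * A * W \<in> carrier_mat r r"
    using aW A c by auto
  have "mat_adjoint (W * Q) * A * (W * Q) = mat_adjoint Q * (mat_adjoint W * A) * (W * Q)"
    using mat_adjoint_mult[OF c Q(1)] assoc_mult_mat[OF aQ aW A] by simp
  also have "\<dots> = mat_adjoint Q * (mat_adjoint W * A * W) * Q"
    using assoc_mult_mat[OF mult_carrier_mat[OF aQ WA] c Q(1)] assoc_mult_mat[OF aQ WA c] by simp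
  finally show ?thesis
    unfolding ritz_values_def Let_def Q(4)
    using hermitian_eigenvalues_conj[OF WAW Q(1-3)] by simp
qed

lemma biorthogonal_basis_eq:
  assumes Yt: "orthonormal_basis_mat n S Yt" "Yt \<in> carrier_mat n p"
    and C: "C \<in> carrier_mat p p" "mat_adjoint (mat_of_cols n (map x [1..<p+1])) * Yt * C = 1\<^sub>m p"
    and i: "i \<in> {1..p}"
  shows "biorthogonal_basis n p x S i = Yt *\<^sub>v col C (i - 1)"
proof -
  define X where "X = mat_of_cols n (map x [1..<p+1])"
  have X: "X \<in> carrier_mat n p"
    unfolding X_def by (metis mat_of_cols_carrier(1) length_map length_upt diff_add_inverse2)
  have Y': "orthonormal_basis_mat n S (some_onb n S)"
    by (rule orthonormal_basis_mat_some_onbI[OF Yt(1)])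
  obtain Q where Q: "Q \<in> carrier_mat p p" "mat_adjoint Q * Q = 1\<^sub>m p"
    "Q * mat_adjoint Q = 1\<^sub>m p" "some_onb n S = Yt * Q"
    using orthonormal_basis_mat_unique[OF Yt(1) Y' Yt(2)] .
  have aQ: "mat_adjoint Q \<in> carrier_mat p p" and aX: "mat_adjoint X \<in> carrier_mat p n"
    using Q(1) X by auto
  define G where "G = mat_adjoint X * Yt"
  have G: "G \<in> carrier_mat p p" using aX Yt(2) by (simp add: G_def)
  have GC: "G * C = 1\<^sub>m p" using C(2) by (simp add: G_def X_def)
  have M: "mat_adjoint X * (Yt * Q) = G * Q"
    unfolding G_def using assoc_mult_mat[OF aX Yt(2) Q(1)] by simp
  have c2: "G * Q \<in> carrier_mat p p" "mat_adjoint Q * C \<in> carrier_mat p p"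
    using G Q(1) aQ C(1) by auto
  have QQC: "Q * (mat_adjoint Q * C) = C"
    using assoc_mult_mat[OF Q(1) aQ C(1)] Q(3) left_mult_one_mat[OF C(1)] by simp
  have inv: "(G * Q) * (mat_adjoint Q * C) = 1\<^sub>m p"
    using assoc_mult_mat[OF G Q(1) c2(2)] QQC GC by simp
  have inv': "(mat_adjoint Q * C) * (G * Q) = 1\<^sub>m p"
    using mat_mult_left_right_inverse[OF c2 inv] .
  have "G * Q \<in> Units (ring_mat TYPE(complex) p ())"
    using inv inv' c2 unfolding Units_def ring_mat_def by auto
  then obtain D where D: "mat_inverse (G * Q) = Some D"
    using mat_inverse(1)[OF c2(1), of "()"] by (cases "mat_inverse (G * Q)") auto
  from mat_inverse(2)[OF c2(1) D] have D': "(G * Q) * D = 1\<^sub>m p" "D * (G * Q) = 1\<^sub>m p" "D \<in> carrier_mat p p"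
    by auto
  have "D = D * ((G * Q) * (mat_adjoint Q * C))" using inv D' by simp
  also have "\<dots> = mat_adjoint Q * C"
    using assoc_mult_mat[OF D'(3) c2] D'(2) left_mult_one_mat[OF c2(2)] by simp
  finally have D_eq: "D = mat_adjoint Q * C" .
  have i': "i - 1 < p" using i by auto
  have "biorthogonal_basis n p x S i = (Yt * Q) *\<^sub>v col (mat_adjoint Q * C) (i - 1)"
    unfolding biorthogonal_basis_def Let_def X_def[symmetric] Q(4) M D D_eq by simp
  also have "\<dots> = col (Yt * Q * (mat_adjoint Q * C)) (i - 1)"
    using col_mult2[OF mult_carrier_mat[OF Yt(2) Q(1)] c2(2) i'] by simp
  also have "Yt * Q * (mat_adjoint Q * C) = Yt * C"
    using assoc_mult_mat[OF Yt(2) Q(1) c2(2)] QQC by simp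
  also have "col (Yt * C) (i - 1) = Yt *\<^sub>v col C (i - 1)"
    using col_mult2[OF Yt(2) C(1) i'] .
  finally show ?thesis .
qed

end

theory Submission
  imports Defs "HOL-Combinatorics.List_Permutation"
begin

text \<open>Both parts are statements about eigenvalues of small Gram matrices, and they rest on one
  inequality, the multiplicative version of Lidskii's theorem.

  Let \<open>U\<close> have the columns \<open>x\<^sub>j\<close> for \<open>j\<close> in the index set and let \<open>W\<close> satisfy
  \<open>U\<^sup>H W = 1\<close>. The eigenvalues of the Gram matrix \<open>R = W\<^sup>H W\<close> are at least \<open>1\<close>. The tangents of
  the angles from \<open>span U\<close> to \<open>span W\<close> are the numbers \<open>sqrt (r - 1)\<close> for these eigenvalues \<open>r\<close>
  (\<open>tan_principal_angles_dual\<close>), and a subspace containing \<open>span W\<close> makes no larger angles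
  (\<open>tan_principal_angles_le\<close>). A biorthogonal vector \<open>y\<^sub>j\<close> is \<open>x\<^sub>j\<close> plus a tail in the span of
  \<open>x\<^sub>l\<close>, \<open>l > p\<close>. So for \<open>W = [y\<^sub>j]\<close> the matrix \<open>P = R - 1\<close> is the Gram matrix of the tails
  and its eigenvalues are the squared tangents for \<open>X\<^sub>\<tau>\<close> and \<open>Y\<^sub>\<tau>\<close>. Dropping indices compresses
  \<open>P\<close> and lowers its eigenvalues (\<open>dual_gram_eigenvalue_mono\<close>), which gives the
  componentwise inequalities with \<open>\<Theta>(X, Y)\<close>.

  The Krylov space enters through the vectors \<open>w\<^sub>j = \<sigma>\<^sub>j f(A) y\<^sub>j\<close>, where \<open>f\<close> is the Chebyshev
  polynomial moved to the interval from \<open>\<lambda>\<^sub>n\<close> to \<open>\<lambda>\<^bsub>p+1\<^esub>\<close>. Since \<open>f(\<lambda>\<^sub>j) = 1 / \<sigma>\<^sub>j\<close>, the vector \<open>w\<^sub>j\<close> is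
  again \<open>x\<^sub>j\<close> plus a tail; the tail of \<open>y\<^sub>j\<close> is multiplied by \<open>\<sigma>\<^sub>j\<close> and by the numbers
  \<open>f(\<lambda>\<^sub>l)\<close>, \<open>l > p\<close>, of modulus at most \<open>1\<close>. With \<open>\<Sigma> = diag(\<sigma>\<^sub>j)\<close> the Gram matrix of the \<open>w\<^sub>j\<close> is
  therefore at most \<open>1 + \<Sigma> P \<Sigma>\<close> (\<open>filtered_gram_bound\<close>).

  It remains to separate \<open>\<Sigma>\<close> from \<open>P\<close>. The inequality \<open>multiplicative_lidskii\<close> bounds the product of
  the eigenvalues of \<open>\<Sigma> R \<Sigma>\<close> with indices in a set \<open>J\<close> by the product of the \<open>\<sigma>\<^sub>j\<^sup>2\<close>, \<open>j \<in> J\<close>, and of the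
  \<open>|J|\<close> largest eigenvalues of \<open>R\<close>. For initial segments \<open>J\<close> this is a log-majorization, and a
  log-majorization implies the inequality between partial sums (\<open>log_majorization_sum\<close>); applied to
  eigenvalues and to their square roots it yields \<open>scaled_eigenvalue_sums\<close> and with it the first part.

  For the Ritz values, put \<open>D = diag((\<lambda>\<^sub>j - \<lambda>\<^sub>n)\<^bsup>-1/2\<^esup>)\<close> and let \<open>R\<close> be the Gram matrix of the
  \<open>w\<^sub>j\<close>. By min-max, \<open>\<psi>\<^sub>j - \<lambda>\<^sub>n\<close> is at least \<open>1 / \<nu>\<close> for the matching eigenvalue \<open>\<nu>\<close> of \<open>D R D\<close>
  (\<open>ritz_value_bound\<close>), so the relative error of \<open>\<psi>\<^sub>j\<close> is at most \<open>(\<lambda>\<^sub>j - \<lambda>\<^sub>n) \<nu> - 1\<close>. These errors need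
  not be sorted; this is why Lidskii's inequality is needed for arbitrary \<open>J\<close>. It bounds their sums by
  those of \<open>r - 1\<close> over the largest eigenvalues \<open>r\<close> of \<open>R\<close>, and these are bounded as before
  (\<open>relative_ritz_error_sums\<close>).

  Columns are always taken in the order of decreasing index, because then the entries of both \<open>\<Sigma>\<close> and \<open>D\<close>
  decrease.\<close>

section \<open>Hermitian forms and the spectral theorem\<close>

definition nsq :: "complex vec \<Rightarrow> real" where
  "nsq v = (\<Sum>i<dim_vec v. (cmod (v $ i))\<^sup>2)"

text \<open>For Hermitian \<open>M\<close> the number \<open>v\<^sup>H M v\<close> is real; eigenvalues are compared through it.\<close>

definition hform :: "complex mat \<Rightarrow> complex vec \<Rightarrow> real" where
  "hform M v = Re ((M *\<^sub>v v) \<bullet>c v)"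

lemma inner_sum:
  "v \<in> carrier_vec n \<Longrightarrow> w \<in> carrier_vec n \<Longrightarrow> v \<bullet>c w = (\<Sum>i<n. v $ i * cnj (w $ i))"
  by (auto simp: scalar_prod_def atLeast0LessThan)

lemma inner_cnj:
  "v \<in> carrier_vec n \<Longrightarrow> w \<in> carrier_vec n \<Longrightarrow> cnj (v \<bullet>c w) = w \<bullet>c v"
  by (simp add: inner_sum mult.commute)

lemma inner_smult:
  assumes "v \<in> carrier_vec n" "w \<in> carrier_vec n"
  shows "(c \<cdot>\<^sub>v v) \<bullet>c w = c * (v \<bullet>c w)" "v \<bullet>c (c \<cdot>\<^sub>v w) = cnj c * (v \<bullet>c w)"
  using assms by (simp_all add: inner_sum[of _ n] sum_distrib_left algebra_simps)

lemma inner_self: "v \<bullet>c v = complex_of_real (nsq v)"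
  unfolding nsq_def
  by (simp add: scalar_prod_def complex_norm_square atLeast0LessThan del: of_real_power)

lemma nsq_nonneg [simp]: "nsq v \<ge> 0"
  by (simp add: nsq_def sum_nonneg)

lemma nsq_pos:
  assumes "v \<in> carrier_vec n" "v \<noteq> 0\<^sub>v n"
  shows "nsq v > 0"
proof -
  obtain i where "i < n" "v $ i \<noteq> 0"
    using assms by (metis eq_vecI carrier_vecD index_zero_vec)
  then have "(cmod (v $ i))\<^sup>2 > 0" "i < dim_vec v"
    using assms by auto
  then show ?thesis
    unfolding nsq_def by (intro sum_pos2[of _ i]) auto
qed

lemma nsq_zero [simp]: "nsq (0\<^sub>v n) = 0"
  by (simp add: nsq_def)

lemma nsq_smult: "nsq (c \<cdot>\<^sub>v v) = (cmod c)\<^sup>2 * nsq v"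
  by (simp add: nsq_def norm_mult power_mult_distrib sum_distrib_left)

lemma nsq_eq_hform_one: "v \<in> carrier_vec n \<Longrightarrow> hform (1\<^sub>m n) v = nsq v"
  by (simp add: hform_def inner_self)

lemma mat_vec_sum:
  assumes "A \<in> carrier_mat m n" "v \<in> carrier_vec n" "i < m"
  shows "(A *\<^sub>v v) $ i = (\<Sum>j<n. A $$ (i, j) * v $ j)"
  using assms by (auto simp: scalar_prod_def atLeast0LessThan)

lemma inner_adjoint:
  fixes A :: "complex mat"
  assumes A: "A \<in> carrier_mat m n" and v: "v \<in> carrier_vec n" and w: "w \<in> carrier_vec m"
  shows "(A *\<^sub>v v) \<bullet>c w = v \<bullet>c (mat_adjoint A *\<^sub>v w)"
proof -
  have "(A *\<^sub>v v) \<bullet>c w = (\<Sum>i<m. \<Sum>j<n. A $$ (i, j) * v $ j * cnj (w $ i))"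
    using assms mult_mat_vec_carrier[OF A v]
    by (simp add: inner_sum[of _ m] mat_vec_sum[of A m n v] sum_distrib_right del: index_mult_mat_vec)
  also have "\<dots> = (\<Sum>j<n. \<Sum>i<m. A $$ (i, j) * v $ j * cnj (w $ i))"
    by (rule sum.swap)
  also have "\<dots> = (\<Sum>j<n. v $ j * cnj ((mat_adjoint A *\<^sub>v w) $ j))"
    using A by (intro sum.cong refl)
      (simp add: mat_vec_sum[OF mat_adjoint_carrier[OF A] w] sum_distrib_left algebra_simps del: index_mult_mat_vec)
  also have "\<dots> = v \<bullet>c (mat_adjoint A *\<^sub>v w)"
    using mult_mat_vec_carrier[OF mat_adjoint_carrier[OF A] w] v by (simp add: inner_sum[of _ n])
  finally show ?thesis .
qed

lemma adjoint_mult_index: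
  fixes U V :: "complex mat"
  assumes "U \<in> carrier_mat n a" "V \<in> carrier_mat n b" "i < a" "j < b"
  shows "(mat_adjoint U * V) $$ (i, j) = col V j \<bullet>c col U i"
proof -
  have "(mat_adjoint U * V) $$ (i, j) = row (mat_adjoint U) i \<bullet> col V j"
    using assms by simp
  also have "row (mat_adjoint U) i = conjugate (col U i)"
    using assms by (intro eq_vecI) auto
  also have "conjugate (col U i) \<bullet> col V j = col V j \<bullet>c col U i"
    using assms by (intro comm_scalar_prod[of _ n]) auto
  finally show ?thesis .
qed

lemma adjoint_vec_index:
  fixes U :: "complex mat"
  assumes "U \<in> carrier_mat n a" "v \<in> carrier_vec n" "i < a"
  shows "(mat_adjoint U *\<^sub>v v) $ i = v \<bullet>c col U i"
proof -
  have "(mat_adjoint U *\<^sub>v v) $ i = row (mat_adjoint U) i \<bullet> v"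
    using assms by simp
  also have "row (mat_adjoint U) i = conjugate (col U i)"
    using assms by (intro eq_vecI) auto
  also have "conjugate (col U i) \<bullet> v = v \<bullet>c col U i"
    using assms by (intro comm_scalar_prod[of _ n]) auto
  finally show ?thesis .
qed

lemma mat_adjoint_one [simp]: "mat_adjoint (1\<^sub>m n :: complex mat) = 1\<^sub>m n"
  by (rule eq_matI) auto

lemma mat_adjoint_diag: "mat_adjoint (mat_diag n f :: complex mat) = mat_diag n (\<lambda>i. cnj (f i))"
  by (rule eq_matI) (auto simp: mat_diag_def)

lemma hform_congruence:
  assumes B: "B \<in> carrier_mat m r" and M: "M \<in> carrier_mat m m" and v: "v \<in> carrier_vec r"
  shows "hform (mat_adjoint B * M * B) v = hform M (B *\<^sub>v v)"
proof -
  have aB: "mat_adjoint B \<in> carrier_mat r m" using B by simp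
  have "(mat_adjoint B * M * B) *\<^sub>v v = mat_adjoint B *\<^sub>v (M *\<^sub>v (B *\<^sub>v v))"
    using assoc_mult_mat_vec[OF mult_carrier_mat[OF aB M] B v]
      assoc_mult_mat_vec[OF aB M mult_mat_vec_carrier[OF B v]] by simp
  then show ?thesis
    unfolding hform_def
    using inner_adjoint[OF mat_adjoint_carrier[OF B], of "M *\<^sub>v (B *\<^sub>v v)" v] assms by simp
qed

lemma hform_gram:
  assumes B: "B \<in> carrier_mat m r" and v: "v \<in> carrier_vec r"
  shows "hform (mat_adjoint B * B) v = nsq (B *\<^sub>v v)"
proof -
  have "hform (mat_adjoint B * 1\<^sub>m m * B) v = nsq (B *\<^sub>v v)"
    using hform_congruence[OF B _ v, of "1\<^sub>m m"] B v by (simp add: nsq_eq_hform_one)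
  then show ?thesis using B by simp
qed

lemma nsq_isometry:
  assumes B: "B \<in> carrier_mat m r" and "mat_adjoint B * B = 1\<^sub>m r" and v: "v \<in> carrier_vec r"
  shows "nsq (B *\<^sub>v v) = nsq v"
  using hform_gram[OF B v] assms nsq_eq_hform_one[OF v] by simp

lemma hermitian_congruence:
  assumes B: "B \<in> carrier_mat m r" and M: "M \<in> carrier_mat m m" "hermitian M"
  shows "hermitian (mat_adjoint B * M * B)"
proof -
  have aB: "mat_adjoint B \<in> carrier_mat r m" using B by simp
  show ?thesis
    unfolding hermitian_def mat_adjoint_mult[OF mult_carrier_mat[OF aB M(1)] B]
      mat_adjoint_mult[OF aB M(1)] mat_adjoint_adjoint M(2)[unfolded hermitian_def]
    by (rule assoc_mult_mat[OF aB M(1) B, symmetric])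
qed

lemma hermitian_gram:
  assumes B: "B \<in> carrier_mat m r"
  shows "hermitian (mat_adjoint B * B)"
  unfolding hermitian_def mat_adjoint_mult[OF mat_adjoint_carrier[OF B] B] by simp

lemma diag_vec_index:
  fixes v :: "complex vec"
  assumes v: "v \<in> carrier_vec n" and i: "i < n"
  shows "(mat_diag n f *\<^sub>v v) $ i = f i * v $ i"
proof -
  have "(mat_diag n f *\<^sub>v v) $ i = (\<Sum>j<n. if j = i then f i * v $ i else 0)"
    unfolding mat_vec_sum[OF mat_diag_dim v i]
    by (rule sum.cong) (use i in \<open>auto simp: mat_diag_def\<close>)
  then show ?thesis using i by simp
qed

lemma hform_diag:
  assumes v: "v \<in> carrier_vec n"
  shows "hform (mat_diag n (\<lambda>i. complex_of_real (d i))) v = (\<Sum>i<n. d i * (cmod (v $ i))\<^sup>2)"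
proof -
  have "(mat_diag n (\<lambda>i. complex_of_real (d i)) *\<^sub>v v) \<bullet>c v
      = (\<Sum>i<n. complex_of_real (d i * (cmod (v $ i))\<^sup>2))"
    unfolding inner_sum[OF mult_mat_vec_carrier[OF mat_diag_dim v] v]
    by (rule sum.cong)
      (simp_all only: lessThan_iff diag_vec_index[OF v] of_real_mult complex_norm_square mult.assoc)
  then show ?thesis unfolding hform_def by simp
qed

text \<open>Padding \<open>C\<close> with zero rows to a square matrix makes its determinant vanish.\<close>

lemma underdetermined_kernel:
  fixes C :: "complex mat"
  assumes C: "C \<in> carrier_mat c r" and "c < r"
  obtains v where "v \<in> carrier_vec r" "v \<noteq> 0\<^sub>v r" "C *\<^sub>v v = 0\<^sub>v c"
proof -
  define C' where "C' = mat\<^sub>r r r (\<lambda>i. if i = c then 0\<^sub>v r else if i < c then row C i else 0\<^sub>v r)"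
  have C': "C' \<in> carrier_mat r r" by (simp add: C'_def)
  have "det C' = 0"
    unfolding C'_def by (rule det_row_0[OF \<open>c < r\<close>]) (use C in auto)
  then obtain v where v: "v \<in> carrier_vec r" "v \<noteq> 0\<^sub>v r" "C' *\<^sub>v v = 0\<^sub>v r"
    using det_0_iff_vec_prod_zero_field[OF C'] by auto
  have "C *\<^sub>v v = 0\<^sub>v c"
  proof (rule eq_vecI)
    fix i assume i: "i < dim_vec (0\<^sub>v c :: complex vec)"
    then have "(C' *\<^sub>v v) $ i = (C *\<^sub>v v) $ i"
      using C C' \<open>c < r\<close> by (simp add: C'_def)
    then show "(C *\<^sub>v v) $ i = 0\<^sub>v c $ i"
      using v(3) i \<open>c < r\<close> by simp
  qed (use C in simp)
  with v that show thesis by blast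
qed

lemma cspan_cols_eq:
  fixes W :: "complex mat"
  assumes W: "W \<in> carrier_mat n r"
  shows "cspan n (set (cols W)) = {W *\<^sub>v v | v. v \<in> carrier_vec r}"
proof -
  interpret vec_space "TYPE(complex)" n .
  show ?thesis
    using col_space_eq[OF W] W mult_mat_vec_carrier[OF W] unfolding col_space_def by auto
qed

lemma csubspaceI:
  assumes "S \<subseteq> carrier_vec n" "0\<^sub>v n \<in> S"
    and "\<And>v w. v \<in> S \<Longrightarrow> w \<in> S \<Longrightarrow> v + w \<in> S"
    and "\<And>c v. v \<in> S \<Longrightarrow> c \<cdot>\<^sub>v v \<in> S"
  shows "csubspace n S"
proof -
  interpret vec_space "TYPE(complex)" n .
  show ?thesis
    unfolding subspace_def submodule_def
    using assms vec_vs vec_module by (auto simp: class_field_def)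
qed

text \<open>The vectors orthogonal to the eigenvectors found so far form an \<open>A\<close>-invariant subspace; the
  compression of \<open>A\<close> to it has an eigenvector, and by invariance this is an eigenvector of \<open>A\<close>.\<close>

lemma hermitian_eigenvectors_partial:
  assumes A: "A \<in> carrier_mat m m" and h: "hermitian A" and "k \<le> m"
  shows "\<exists>q d. (\<forall>i<k. q i \<in> carrier_vec m \<and> A *\<^sub>v q i = d i \<cdot>\<^sub>v q i)
    \<and> (\<forall>i<k. \<forall>j<k. q j \<bullet>c q i = (if i = j then 1 else 0))"
  using \<open>k \<le> m\<close>
proof (induction k)
  case 0
  show ?case by auto
next
  case (Suc k)
  then obtain q d where qd: "\<forall>i<k. q i \<in> carrier_vec m \<and> A *\<^sub>v q i = d i \<cdot>\<^sub>v q i"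
      "\<forall>i<k. \<forall>j<k. q j \<bullet>c q i = (if i = j then 1 else 0)"
    using Suc_leD[OF Suc.prems] by blast
  from qd have q: "\<And>i. i < k \<Longrightarrow> q i \<in> carrier_vec m"
      "\<And>i. i < k \<Longrightarrow> A *\<^sub>v q i = d i \<cdot>\<^sub>v q i"
      "\<And>i j. i < k \<Longrightarrow> j < k \<Longrightarrow> q j \<bullet>c q i = (if i = j then 1 else 0)"
    by blast+
  have adj: "(A *\<^sub>v v) \<bullet>c w = v \<bullet>c (A *\<^sub>v w)" if "v \<in> carrier_vec m" "w \<in> carrier_vec m" for v w
    using inner_adjoint[OF A that] h unfolding hermitian_def by simp
  define S where "S = {v \<in> carrier_vec m. \<forall>i<k. v \<bullet>c q i = 0}"
  have Sc: "S \<subseteq> carrier_vec m" by (auto simp: S_def)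
  have sub: "csubspace m S"
  proof (rule csubspaceI[OF Sc])
    show "0\<^sub>v m \<in> S" using q(1) by (simp add: S_def)
    show "v + w \<in> S" if "v \<in> S" "w \<in> S" for v w
      using that q(1) by (simp add: S_def add_scalar_prod_distrib[of v m w])
    show "c \<cdot>\<^sub>v v \<in> S" if "v \<in> S" for c v
      using that q(1) by (auto simp: S_def inner_smult[of _ m])
  qed
  obtain W where "orthonormal_basis_mat m S W"
    using orthonormal_basis_mat_exists[OF sub] by blast
  then obtain r where W: "W \<in> carrier_mat m r" "mat_adjoint W * W = 1\<^sub>m r"
      "cspan m (set (cols W)) = S"
    unfolding orthonormal_basis_mat_def by auto
  have SW: "S = {W *\<^sub>v v | v. v \<in> carrier_vec r}"
    using cspan_cols_eq[OF W(1)] W(3) by simp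
  have aW: "mat_adjoint W \<in> carrier_mat r m" using W by simp
  have proj: "W *\<^sub>v (mat_adjoint W *\<^sub>v s) = s" if "s \<in> S" for s
  proof -
    have "\<exists>v. s = W *\<^sub>v v \<and> v \<in> carrier_vec r" using that SW by simp
    then obtain v where v: "v \<in> carrier_vec r" "s = W *\<^sub>v v" by blast
    have "mat_adjoint W *\<^sub>v (W *\<^sub>v v) = v"
      using assoc_mult_mat_vec[OF aW W(1) v(1)] W(2) v(1) by simp
    then show ?thesis using v by simp
  qed
  define U where "U = mat k m (\<lambda>(i,j). cnj (q i $ j))"
  have U: "U \<in> carrier_mat k m" by (simp add: U_def)
  have Uv: "(U *\<^sub>v v) $ i = v \<bullet>c q i" if "v \<in> carrier_vec m" "i < k" for v i
    using that q(1)[of i] by (subst mat_vec_sum[OF U]) (auto simp: U_def inner_sum[of _ m] mult.commute)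
  obtain s where s: "s \<in> carrier_vec m" "s \<noteq> 0\<^sub>v m" "U *\<^sub>v s = 0\<^sub>v k"
    using underdetermined_kernel[OF U] Suc by auto
  have sS: "s \<in> S"
    unfolding S_def using s Uv[OF s(1)] by auto
  have "r > 0"
  proof (rule ccontr)
    assume "\<not> r > 0"
    then have "mat_adjoint W *\<^sub>v s = 0\<^sub>v r"
      using W(1) by (intro eq_vecI) auto
    then have "nsq (W *\<^sub>v (mat_adjoint W *\<^sub>v s)) = 0"
      using nsq_isometry[OF W(1,2), of "0\<^sub>v r"] by simp
    then show False using proj[OF sS] nsq_pos[OF s(1,2)] by simp
  qed
  define C where "C = mat_adjoint W * A * W"
  have C: "C \<in> carrier_mat r r"
    unfolding C_def by (rule mult_carrier_mat[OF mult_carrier_mat[OF aW A] W(1)])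
  obtain e where "e \<in> spectrum C" using spectrum_non_empty[OF C \<open>r > 0\<close>] by auto
  then obtain z where z: "z \<in> carrier_vec r" "z \<noteq> 0\<^sub>v r" "C *\<^sub>v z = e \<cdot>\<^sub>v z"
    using C unfolding spectrum_def eigenvalue_def eigenvector_def by auto
  define u where "u = W *\<^sub>v z"
  have u: "u \<in> carrier_vec m" "u \<in> S" using W z SW by (auto simp: u_def)
  have nu: "nsq u > 0" unfolding u_def nsq_isometry[OF W(1,2) z(1)] by (rule nsq_pos[OF z(1,2)])
  have AuS: "A *\<^sub>v u \<in> S"
    unfolding S_def
  proof (intro CollectI conjI allI impI)
    fix i assume i: "i < k"
    have "(A *\<^sub>v u) \<bullet>c q i = u \<bullet>c (d i \<cdot>\<^sub>v q i)"
      using adj[OF u(1) q(1)[OF i]] q(2)[OF i] by simp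
    also have "\<dots> = 0"
      using u q(1)[OF i] i by (simp add: S_def conjugate_smult_vec)
    finally show "(A *\<^sub>v u) \<bullet>c q i = 0" .
  qed (use A u in auto)
  have Az: "mat_adjoint W *\<^sub>v (A *\<^sub>v u) = e \<cdot>\<^sub>v z"
    unfolding u_def z(3)[symmetric] C_def
    using assoc_mult_mat_vec[OF mult_carrier_mat[OF aW A] W(1) z(1)]
      assoc_mult_mat_vec[OF aW A mult_mat_vec_carrier[OF W(1) z(1)]] by simp
  have Au: "A *\<^sub>v u = e \<cdot>\<^sub>v u"
    using proj[OF AuS] unfolding Az using W(1) z(1) by (simp add: u_def mult_mat_vec)
  define c where "c = complex_of_real (1 / sqrt (nsq u))"
  have ne: "complex_of_real (sqrt (nsq u)) * complex_of_real (sqrt (nsq u)) = complex_of_real (nsq u)"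
    using nu by (simp flip: of_real_mult)
  have cu: "(c \<cdot>\<^sub>v u) \<bullet>c (c \<cdot>\<^sub>v u) = 1"
  proof -
    have "(c \<cdot>\<^sub>v u) \<bullet>c (c \<cdot>\<^sub>v u) = complex_of_real ((cmod c)\<^sup>2 * nsq u)"
      by (simp add: inner_self nsq_smult)
    also have "(cmod c)\<^sup>2 * nsq u = 1"
      unfolding c_def norm_of_real using nu by (simp add: power_divide)
    finally show ?thesis by simp
  qed
  have cq: "(c \<cdot>\<^sub>v u) \<bullet>c q i = 0" "q i \<bullet>c (c \<cdot>\<^sub>v u) = 0" if "i < k" for i
  proof -
    show "(c \<cdot>\<^sub>v u) \<bullet>c q i = 0"
      using u q(1)[OF that] that by (simp add: S_def)
    then have "cnj ((c \<cdot>\<^sub>v u) \<bullet>c q i) = 0" by simp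
    then show "q i \<bullet>c (c \<cdot>\<^sub>v u) = 0"
      unfolding inner_cnj[OF smult_carrier_vec[THEN iffD2, OF u(1)] q(1)[OF that]] .
  qed
  show ?case
  proof (intro exI conjI allI impI)
    fix i assume "i < Suc k"
    then show "(q(k := c \<cdot>\<^sub>v u)) i \<in> carrier_vec m"
      using q(1) u by (cases "i = k") auto
    show "A *\<^sub>v (q(k := c \<cdot>\<^sub>v u)) i = (d(k := e)) i \<cdot>\<^sub>v (q(k := c \<cdot>\<^sub>v u)) i"
      using q(2) u Au \<open>i < Suc k\<close> A by (cases "i = k") (auto simp: mult_mat_vec smult_smult_assoc mult.commute)
    fix j assume "j < Suc k"
    then show "(q(k := c \<cdot>\<^sub>v u)) j \<bullet>c (q(k := c \<cdot>\<^sub>v u)) i = (if i = j then 1 else 0)"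
      using q(3) cu cq \<open>i < Suc k\<close> by (cases "i = k"; cases "j = k") auto
  qed
qed

lemma mat_of_cols_map:
  fixes q :: "'b \<Rightarrow> complex vec"
  shows "mat_of_cols n (map q is) \<in> carrier_mat n (length is)"
  by (metis mat_of_cols_carrier(1) length_map)

lemma col_mat_of_cols_map:
  fixes q :: "'b \<Rightarrow> complex vec"
  assumes "j < length is" "q (is ! j) \<in> carrier_vec n"
  shows "col (mat_of_cols n (map q is)) j = q (is ! j)"
  using assms by (subst col_mat_of_cols) auto

lemma mset_prod_list_proots:
  "proots (\<Prod>a\<leftarrow>as. [:- a, 1:]) = mset (as :: complex list)"
proof (induction as)
  case (Cons a as)
  have "(\<Prod>a\<leftarrow>as. [:- a, 1:]) \<noteq> (0 :: complex poly)"
    by (auto simp: prod_list_zero_iff)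
  then show ?case using Cons by (simp add: proots_mult del: mult_pCons_left)
qed simp

text \<open>The characteristic polynomial is invariant under similarity and splits over the diagonal.\<close>

lemma hermitian_eigenvalues_diag:
  assumes Q: "Q \<in> carrier_mat m m" "mat_adjoint Q * Q = 1\<^sub>m m" "Q * mat_adjoint Q = 1\<^sub>m m"
    and A: "A = Q * mat_diag m (\<lambda>i. complex_of_real (d i)) * mat_adjoint Q"
  shows "mset (hermitian_eigenvalues A) = mset (map d [0..<m])"
    and "sorted (rev (hermitian_eigenvalues A))" and "length (hermitian_eigenvalues A) = m"
proof -
  let ?D = "mat_diag m (\<lambda>i. complex_of_real (d i))"
  have aQ: "mat_adjoint Q \<in> carrier_mat m m" using Q(1) by simp
  have "similar_mat A ?D"
    by (rule similar_matI[of _ _ Q "mat_adjoint Q" m])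
      (use Q aQ mult_carrier_mat[OF mult_carrier_mat[OF Q(1) mat_diag_dim] aQ] in \<open>simp_all add: A\<close>)
  then have "char_poly A = char_poly ?D" by (rule char_poly_similar)
  also have "\<dots> = (\<Prod>a\<leftarrow>diag_mat ?D. [:- a, 1:])"
    by (rule char_poly_upper_triangular[OF mat_diag_dim]) (auto simp: mat_diag_def)
  also have "diag_mat ?D = map (\<lambda>i. complex_of_real (d i)) [0..<m]"
    by (auto simp: diag_mat_def mat_diag_def)
  finally have cp: "char_poly A = (\<Prod>a\<leftarrow>map (\<lambda>i. complex_of_real (d i)) [0..<m]. [:- a, 1:])" .
  have "image_mset Re (proots (char_poly A)) = mset (map d [0..<m])"
    unfolding cp mset_prod_list_proots by (simp add: multiset.map_comp comp_def)
  then have e: "hermitian_eigenvalues A = rev (sorted_list_of_multiset (mset (map d [0..<m])))"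
    unfolding hermitian_eigenvalues_def by simp
  show "mset (hermitian_eigenvalues A) = mset (map d [0..<m])"
    unfolding e by (metis mset_rev mset_sorted_list_of_multiset)
  then show "length (hermitian_eigenvalues A) = m"
    by (metis length_map length_upt minus_nat.diff_0 mset_eq_length)
  show "sorted (rev (hermitian_eigenvalues A))"
    unfolding e by (simp only: rev_rev_ident sorted_sorted_list_of_multiset)
qed

lemma hermitian_eigenvalues_unique:
  assumes Q: "Q \<in> carrier_mat m m" "mat_adjoint Q * Q = 1\<^sub>m m" "Q * mat_adjoint Q = 1\<^sub>m m"
    and A: "A = Q * mat_diag m (\<lambda>i. complex_of_real (d i)) * mat_adjoint Q"
    and d: "\<And>i j. i \<le> j \<Longrightarrow> j < m \<Longrightarrow> d j \<le> d i"
  shows "hermitian_eigenvalues A = map d [0..<m]"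
proof -
  have "sorted (rev (map d [0..<m]))"
    using d by (auto simp: sorted_iff_nth_mono rev_nth)
  moreover have "mset (rev (hermitian_eigenvalues A)) = mset (rev (map d [0..<m]))"
    using hermitian_eigenvalues_diag(1)[OF Q A] by simp
  ultimately have "rev (hermitian_eigenvalues A) = rev (map d [0..<m])"
    using hermitian_eigenvalues_diag(2)[OF Q A] by (metis properties_for_sort sort_key_id_if_sorted sorted_sort_id)
  then show ?thesis by simp
qed

proposition hermitian_diagonalisation:
  assumes A: "A \<in> carrier_mat m m" and h: "hermitian A"
  obtains Q where "Q \<in> carrier_mat m m" "mat_adjoint Q * Q = 1\<^sub>m m" "Q * mat_adjoint Q = 1\<^sub>m m"
    "A = Q * mat_diag m (\<lambda>i. complex_of_real (hermitian_eigenvalues A ! i)) * mat_adjoint Q"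
    "sorted (rev (hermitian_eigenvalues A))" "length (hermitian_eigenvalues A) = m"
proof -
  obtain q d where qd: "\<forall>i<m. q i \<in> carrier_vec m \<and> A *\<^sub>v q i = d i \<cdot>\<^sub>v q i"
      "\<forall>i<m. \<forall>j<m. q j \<bullet>c q i = (if i = j then 1 else 0)"
    using hermitian_eigenvectors_partial[OF A h order.refl] by blast
  have unitary: "\<exists>P. P \<in> carrier_mat m m \<and> mat_adjoint P * P = 1\<^sub>m m \<and> P * mat_adjoint P = 1\<^sub>m m
      \<and> A = P * mat_diag m (\<lambda>i. complex_of_real (Re (d (f i)))) * mat_adjoint P"
    if f: "bij_betw f {..<m} {..<m}" for f
  proof -
    define P where "P = mat_of_cols m (map (\<lambda>i. q (f i)) [0..<m])"
    have P: "P \<in> carrier_mat m m"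
      using mat_of_cols_map[of m "\<lambda>i. q (f i)" "[0..<m]"] by (simp add: P_def)
    have aP: "mat_adjoint P \<in> carrier_mat m m" using P by simp
    have fm: "f i < m" if "i < m" for i using f that by (auto simp: bij_betw_def)
    have col: "col P i = q (f i)" if "i < m" for i
      unfolding P_def using that qd(1) fm by (subst col_mat_of_cols_map) auto
    have 1: "mat_adjoint P * P = 1\<^sub>m m"
    proof (rule eq_matI)
      fix i j assume "i < dim_row (1\<^sub>m m :: complex mat)" "j < dim_col (1\<^sub>m m :: complex mat)"
      then have ij: "i < m" "j < m" by auto
      have "f i = f j \<longleftrightarrow> i = j" using f ij by (auto simp: bij_betw_def inj_on_def)
      then show "(mat_adjoint P * P) $$ (i, j) = 1\<^sub>m m $$ (i, j)"
        unfolding adjoint_mult_index[OF P P ij] using ij qd(2) col fm by simp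
    qed (use P in auto)
    have 2: "P * mat_adjoint P = 1\<^sub>m m"
      by (rule mat_mult_left_right_inverse[OF aP P 1])
    have re: "d (f i) = complex_of_real (Re (d (f i)))" if "i < m" for i
    proof -
      let ?q = "q (f i)"
      have qc: "?q \<in> carrier_vec m" and Aq: "A *\<^sub>v ?q = d (f i) \<cdot>\<^sub>v ?q" and qq: "?q \<bullet>c ?q = 1"
        using qd fm[OF that] by auto
      have "(A *\<^sub>v ?q) \<bullet>c ?q = ?q \<bullet>c (A *\<^sub>v ?q)"
        using inner_adjoint[OF A qc qc] h unfolding hermitian_def by simp
      then have "d (f i) = cnj (d (f i))"
        unfolding Aq inner_smult[OF qc qc] qq by simp
      then show ?thesis by (metis Reals_cnj_iff of_real_Re)
    qed
    let ?D = "mat_diag m (\<lambda>i. complex_of_real (Re (d (f i))))"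
    have "A * P = P * ?D"
    proof (rule mat_col_eqI)
      fix j assume "j < dim_col (P * ?D)"
      then have j: "j < m" by (simp add: mat_diag_def)
      have "col (A * P) j = d (f j) \<cdot>\<^sub>v q (f j)"
        using col_mult2[OF A P j] col[OF j] qd(1) fm[OF j] by simp
      also have "\<dots> = col (P * ?D) j"
      proof (rule eq_vecI)
        fix i assume "i < dim_vec (col (P * ?D) j)"
        then have i: "i < m" using P by simp
        have dq: "dim_vec (q (f j)) = m" using qd(1) fm[OF j] by (blast dest: carrier_vecD)
        have "P $$ (i, j) = q (f j) $ i" using col[OF j] P i j by (metis index_col carrier_matD)
        then show "(d (f j) \<cdot>\<^sub>v q (f j)) $ i = col (P * ?D) j $ i"
          using P i j re[OF j] dq by (simp add: mat_diag_mult_right[OF P] mult.commute)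
      qed (use qd(1) fm[OF j] P in auto)
      finally show "col (A * P) j = col (P * ?D) j" .
    qed (use A P in \<open>auto simp: mat_diag_def\<close>)
    then have "A * P * mat_adjoint P = P * ?D * mat_adjoint P" by simp
    then have "A = P * ?D * mat_adjoint P"
      using assoc_mult_mat[OF A P aP] 2 A by simp
    then show ?thesis using P 1 2 by blast
  qed
  \<comment> \<open>Any order of the eigenvectors yields the right multiset of eigenvalues; the permutation \<open>f\<close>
    then reorders the eigenvectors so that the diagonal is the sorted list.\<close>
  obtain P where P: "P \<in> carrier_mat m m" "mat_adjoint P * P = 1\<^sub>m m" "P * mat_adjoint P = 1\<^sub>m m"
      "A = P * mat_diag m (\<lambda>i. complex_of_real (Re (d (id i)))) * mat_adjoint P"
    using unitary[of id] bij_betw_id by blast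
  note e = hermitian_eigenvalues_diag[OF P]
  obtain f where f: "bij_betw f {..<m} {..<m}"
      "\<forall>i<m. hermitian_eigenvalues A ! i = map (\<lambda>i. Re (d (id i))) [0..<m] ! f i"
    using permutation_Ex_bij[OF e(1)] e(3) by auto
  obtain Q where Q: "Q \<in> carrier_mat m m" "mat_adjoint Q * Q = 1\<^sub>m m" "Q * mat_adjoint Q = 1\<^sub>m m"
      "A = Q * mat_diag m (\<lambda>i. complex_of_real (Re (d (f i)))) * mat_adjoint Q"
    using unitary[OF f(1)] by blast
  have "hermitian_eigenvalues A ! i = Re (d (f i))" if "i < m" for i
    using f that bij_betwE[OF f(1)] by auto
  then have "mat_diag m (\<lambda>i. complex_of_real (Re (d (f i))))
      = mat_diag m (\<lambda>i. complex_of_real (hermitian_eigenvalues A ! i))"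
    by (intro eq_matI) (auto simp: mat_diag_def)
  then show thesis using that[OF Q(1-3) _ e(2,3)] Q(4) by simp
qed

section \<open>Comparing eigenvalues\<close>

lemma underdetermined_functionals:
  fixes g :: "nat \<Rightarrow> complex vec"
  assumes "c < r" and g: "\<And>i. i < c \<Longrightarrow> g i \<in> carrier_vec r"
  obtains v where "v \<in> carrier_vec r" "v \<noteq> 0\<^sub>v r" "\<And>i. i < c \<Longrightarrow> g i \<bullet> v = 0"
proof -
  define C where "C = mat\<^sub>r c r g"
  have C: "C \<in> carrier_mat c r" by (simp add: C_def)
  obtain v where v: "v \<in> carrier_vec r" "v \<noteq> 0\<^sub>v r" "C *\<^sub>v v = 0\<^sub>v c"
    using underdetermined_kernel[OF C \<open>c < r\<close>] .
  have "g i \<bullet> v = 0" if "i < c" for i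
  proof -
    have "(C *\<^sub>v v) $ i = g i \<bullet> v"
      using that g[OF that] by (simp add: C_def)
    then show ?thesis using v(3) that by simp
  qed
  with v that show thesis by blast
qed

lemma hform_diagonalised:
  assumes Q: "Q \<in> carrier_mat m m" "Q * mat_adjoint Q = 1\<^sub>m m"
    and A: "A = Q * mat_diag m (\<lambda>i. complex_of_real (d i)) * mat_adjoint Q"
    and v: "v \<in> carrier_vec m"
  shows "hform A v = (\<Sum>i<m. d i * (cmod ((mat_adjoint Q *\<^sub>v v) $ i))\<^sup>2)"
    and "nsq v = (\<Sum>i<m. (cmod ((mat_adjoint Q *\<^sub>v v) $ i))\<^sup>2)"
proof -
  have aQ: "mat_adjoint Q \<in> carrier_mat m m" using Q(1) by simp
  have av: "mat_adjoint Q *\<^sub>v v \<in> carrier_vec m" using mult_mat_vec_carrier[OF aQ v] .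
  show "hform A v = (\<Sum>i<m. d i * (cmod ((mat_adjoint Q *\<^sub>v v) $ i))\<^sup>2)"
    using hform_congruence[OF aQ mat_diag_dim v, of "\<lambda>i. complex_of_real (d i)"]
    unfolding hform_diag[OF av] by (simp add: A)
  have "nsq (mat_adjoint Q *\<^sub>v v) = nsq v"
    by (rule nsq_isometry[OF aQ _ v]) (use Q in simp)
  then show "nsq v = (\<Sum>i<m. (cmod ((mat_adjoint Q *\<^sub>v v) $ i))\<^sup>2)"
    unfolding nsq_def[of "mat_adjoint Q *\<^sub>v v"] carrier_vecD[OF av] by simp
qed

lemma sorted_desc_nth:
  "sorted (rev (xs :: real list)) \<Longrightarrow> i \<le> j \<Longrightarrow> j < length xs \<Longrightarrow> xs ! j \<le> xs ! i"
  by (rule sorted_rev_nth_mono)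

text \<open>The Courant-Fischer argument in the form used throughout. Being orthogonal to the first \<open>l\<close>
  eigenvectors of \<open>M\<close> (after applying \<open>S\<close>) and to all but \<open>l + 1\<close> eigenvectors of \<open>N\<close> amounts to
  \<open>r - 1\<close> linear conditions on a vector of length \<open>r\<close>, so a nonzero \<open>v\<close> meets them all. The two
  versions keep the first, respectively the last, \<open>l + 1\<close> eigenvectors of \<open>N\<close>.\<close>

lemma eigen_test_vector:
  assumes M: "M \<in> carrier_mat m m" "hermitian M" and N: "N \<in> carrier_mat r r" "hermitian N"
    and S: "S \<in> carrier_mat m r" and l: "l < m" "l < r"
  shows eigen_test_vector_high: "\<exists>v \<in> carrier_vec r. v \<noteq> 0\<^sub>v r
      \<and> hermitian_eigenvalues N ! l * nsq v \<le> hform N v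
      \<and> hform M (S *\<^sub>v v) \<le> hermitian_eigenvalues M ! l * nsq (S *\<^sub>v v)"
    and eigen_test_vector_low: "\<exists>v \<in> carrier_vec r. v \<noteq> 0\<^sub>v r
      \<and> hform N v \<le> hermitian_eigenvalues N ! (r - 1 - l) * nsq v
      \<and> hform M (S *\<^sub>v v) \<le> hermitian_eigenvalues M ! l * nsq (S *\<^sub>v v)"
proof -
  obtain P where P: "P \<in> carrier_mat m m" "mat_adjoint P * P = 1\<^sub>m m" "P * mat_adjoint P = 1\<^sub>m m"
    "M = P * mat_diag m (\<lambda>i. complex_of_real (hermitian_eigenvalues M ! i)) * mat_adjoint P"
    and sM: "sorted (rev (hermitian_eigenvalues M))" "length (hermitian_eigenvalues M) = m"
    using hermitian_diagonalisation[OF M] .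
  obtain Q where Q: "Q \<in> carrier_mat r r" "mat_adjoint Q * Q = 1\<^sub>m r" "Q * mat_adjoint Q = 1\<^sub>m r"
    "N = Q * mat_diag r (\<lambda>i. complex_of_real (hermitian_eigenvalues N ! i)) * mat_adjoint Q"
    and sN: "sorted (rev (hermitian_eigenvalues N))" "length (hermitian_eigenvalues N) = r"
    using hermitian_diagonalisation[OF N] .
  let ?M = "\<lambda>i. hermitian_eigenvalues M ! i" and ?N = "\<lambda>i. hermitian_eigenvalues N ! i"
  have aP: "mat_adjoint P \<in> carrier_mat m m" and aQ: "mat_adjoint Q \<in> carrier_mat r r"
    using P Q by auto
  have PS: "mat_adjoint P * S \<in> carrier_mat m r" using aP S by simp
  have Mle: "hform M (S *\<^sub>v v) \<le> ?M l * nsq (S *\<^sub>v v)"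
    if v: "v \<in> carrier_vec r" and z: "\<And>i. i < l \<Longrightarrow> row (mat_adjoint P * S) i \<bullet> v = 0" for v
  proof -
    have Sv: "S *\<^sub>v v \<in> carrier_vec m" using mult_mat_vec_carrier[OF S v] .
    have "(mat_adjoint P *\<^sub>v (S *\<^sub>v v)) $ i = 0" if "i < l" for i
    proof -
      have "(mat_adjoint P *\<^sub>v (S *\<^sub>v v)) $ i = ((mat_adjoint P * S) *\<^sub>v v) $ i"
        using assoc_mult_mat_vec[OF aP S v] by simp
      also have "\<dots> = row (mat_adjoint P * S) i \<bullet> v"
        using PS that l by (intro index_mult_mat_vec) auto
      finally show ?thesis using z[OF that] by simp
    qed
    then have "?M i * (cmod ((mat_adjoint P *\<^sub>v (S *\<^sub>v v)) $ i))\<^sup>2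
        \<le> ?M l * (cmod ((mat_adjoint P *\<^sub>v (S *\<^sub>v v)) $ i))\<^sup>2" if "i < m" for i
      using sorted_desc_nth[OF sM(1), of l i] sM(2) that
      by (cases "i < l") (auto intro!: mult_right_mono)
    then show ?thesis
      unfolding hform_diagonalised[OF P(1,3,4) Sv] sum_distrib_left by (intro sum_mono) auto
  qed
  have row_Q: "row (mat_adjoint Q) i \<bullet> v = (mat_adjoint Q *\<^sub>v v) $ i" if "i < r" for i v
    using that Q(1) by simp
  have rows: "row (mat_adjoint P * S) i \<in> carrier_vec r" "row (mat_adjoint Q) i \<in> carrier_vec r" for i
    using S Q(1) by (auto intro!: carrier_vecI)
  show "\<exists>v \<in> carrier_vec r. v \<noteq> 0\<^sub>v r \<and> ?N l * nsq v \<le> hform N v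
      \<and> hform M (S *\<^sub>v v) \<le> ?M l * nsq (S *\<^sub>v v)"
  proof -
    define g where "g i = (if i < l then row (mat_adjoint P * S) i else row (mat_adjoint Q) (Suc i))" for i
    obtain v where v: "v \<in> carrier_vec r" "v \<noteq> 0\<^sub>v r" and gv: "\<And>i. i < r - 1 \<Longrightarrow> g i \<bullet> v = 0"
      by (rule underdetermined_functionals[of "r - 1" r g])
        (use rows l in \<open>auto simp: g_def\<close>)
    have "row (mat_adjoint P * S) i \<bullet> v = 0" if "i < l" for i
      using gv[of i] that l by (simp add: g_def)
    moreover have "?N l * nsq v \<le> hform N v"
    proof -
      have "(mat_adjoint Q *\<^sub>v v) $ i = 0" if "l < i" "i < r" for i
      proof -
        obtain i' where i': "i = Suc i'" using \<open>l < i\<close> by (cases i) auto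
        show ?thesis
          using gv[of i'] that l row_Q[of i v] unfolding i' g_def by simp
      qed
      then have "?N l * (cmod ((mat_adjoint Q *\<^sub>v v) $ i))\<^sup>2
          \<le> ?N i * (cmod ((mat_adjoint Q *\<^sub>v v) $ i))\<^sup>2" if "i < r" for i
        using sorted_desc_nth[OF sN(1), of i l] sN(2) that l
        by (cases "l < i") (auto intro!: mult_right_mono)
      then show ?thesis
        unfolding hform_diagonalised[OF Q(1,3,4) v(1)] sum_distrib_left by (intro sum_mono) auto
    qed
    ultimately show ?thesis using Mle v by blast
  qed
  show "\<exists>v \<in> carrier_vec r. v \<noteq> 0\<^sub>v r \<and> hform N v \<le> ?N (r - 1 - l) * nsq v
      \<and> hform M (S *\<^sub>v v) \<le> ?M l * nsq (S *\<^sub>v v)"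
  proof -
    define g where "g i = (if i < l then row (mat_adjoint P * S) i else row (mat_adjoint Q) (i - l))" for i
    obtain v where v: "v \<in> carrier_vec r" "v \<noteq> 0\<^sub>v r" and gv: "\<And>i. i < r - 1 \<Longrightarrow> g i \<bullet> v = 0"
      by (rule underdetermined_functionals[of "r - 1" r g])
        (use rows l in \<open>auto simp: g_def\<close>)
    have "row (mat_adjoint P * S) i \<bullet> v = 0" if "i < l" for i
      using gv[of i] that l by (simp add: g_def)
    moreover have "hform N v \<le> ?N (r - 1 - l) * nsq v"
    proof -
      have "(mat_adjoint Q *\<^sub>v v) $ i = 0" if "i < r - 1 - l" for i
        using gv[of "i + l"] that l row_Q[of i v] unfolding g_def by simp
      then have "?N i * (cmod ((mat_adjoint Q *\<^sub>v v) $ i))\<^sup>2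
          \<le> ?N (r - 1 - l) * (cmod ((mat_adjoint Q *\<^sub>v v) $ i))\<^sup>2" if "i < r" for i
        using sorted_desc_nth[OF sN(1), of "r - 1 - l" i] sN(2) that l
        by (cases "i < r - 1 - l") (auto intro!: mult_right_mono)
      then show ?thesis
        unfolding hform_diagonalised[OF Q(1,3,4) v(1)] sum_distrib_left by (intro sum_mono) auto
    qed
    ultimately show ?thesis using Mle v by blast
  qed
qed

lemma eigenvalue_le_shift:
  assumes M: "M \<in> carrier_mat m m" "hermitian M" and N: "N \<in> carrier_mat m m" "hermitian N"
    and le: "\<And>v. v \<in> carrier_vec m \<Longrightarrow> hform N v \<le> hform M v + c * nsq v" and l: "l < m"
  shows "hermitian_eigenvalues N ! l \<le> hermitian_eigenvalues M ! l + c"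
proof -
  obtain v where v: "v \<in> carrier_vec m" "v \<noteq> 0\<^sub>v m"
      "hermitian_eigenvalues N ! l * nsq v \<le> hform N v"
      "hform M v \<le> hermitian_eigenvalues M ! l * nsq v"
    using eigen_test_vector_high[OF M N one_carrier_mat l l] by auto
  have "hermitian_eigenvalues N ! l * nsq v \<le> (hermitian_eigenvalues M ! l + c) * nsq v"
    using v(3,4) le[OF v(1)] by (simp add: distrib_right)
  then show ?thesis using nsq_pos[OF v(1,2)] by simp
qed

lemma eigenvalue_mono:
  assumes "M \<in> carrier_mat m m" "hermitian M" and "N \<in> carrier_mat m m" "hermitian N"
    and "\<And>v. v \<in> carrier_vec m \<Longrightarrow> hform N v \<le> hform M v" and "l < m"
  shows "hermitian_eigenvalues N ! l \<le> hermitian_eigenvalues M ! l"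
  using eigenvalue_le_shift[OF assms(1-4), of 0] assms(5,6) by simp

lemma eigenvalue_ge:
  assumes M: "M \<in> carrier_mat m m" "hermitian M"
    and le: "\<And>v. v \<in> carrier_vec m \<Longrightarrow> c * nsq v \<le> hform M v" and l: "l < m"
  shows "c \<le> hermitian_eigenvalues M ! l"
proof -
  obtain v where v: "v \<in> carrier_vec m" "v \<noteq> 0\<^sub>v m"
      "hform M v \<le> hermitian_eigenvalues M ! l * nsq v"
    using eigen_test_vector_high[OF M M one_carrier_mat l l] by auto
  have "c * nsq v \<le> hermitian_eigenvalues M ! l * nsq v"
    using v(3) le[OF v(1)] by simp
  then show ?thesis using nsq_pos[OF v(1,2)] by simp
qed

lemma eigenvalue_pos:
  assumes M: "M \<in> carrier_mat m m" "hermitian M"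
    and le: "\<And>v. v \<in> carrier_vec m \<Longrightarrow> v \<noteq> 0\<^sub>v m \<Longrightarrow> 0 < hform M v" and l: "l < m"
  shows "0 < hermitian_eigenvalues M ! l"
proof -
  obtain v where v: "v \<in> carrier_vec m" "v \<noteq> 0\<^sub>v m"
      "hform M v \<le> hermitian_eigenvalues M ! l * nsq v"
    using eigen_test_vector_high[OF M M one_carrier_mat l l] by auto
  then have "0 < hermitian_eigenvalues M ! l * nsq v"
    using le by fastforce
  then show ?thesis using nsq_pos[OF v(1,2)] by (simp add: zero_less_mult_iff)
qed

lemma hermitian_diag: "hermitian (mat_diag m (\<lambda>i. complex_of_real (d i)))"
  unfolding hermitian_def mat_adjoint_diag by simp

lemma eigenvalues_diag:
  assumes "\<And>i j. i \<le> j \<Longrightarrow> j < m \<Longrightarrow> d j \<le> d i"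
  shows "hermitian_eigenvalues (mat_diag m (\<lambda>i. complex_of_real (d i))) = map d [0..<m]"
  by (rule hermitian_eigenvalues_unique[of "1\<^sub>m m"])
    (use assms in \<open>simp_all add: left_mult_one_mat[OF mat_diag_dim] right_mult_one_mat[OF mat_diag_dim]\<close>)

lemma det_diag: "det (mat_diag m f :: complex mat) = (\<Prod>i<m. f i)"
proof -
  have "det (mat_diag m f) = prod_list (diag_mat (mat_diag m f))"
    by (rule det_upper_triangular[OF _ mat_diag_dim]) (auto simp: mat_diag_def)
  also have "diag_mat (mat_diag m f) = map f [0..<m]"
    by (auto simp: diag_mat_def mat_diag_def)
  finally show ?thesis
    by (simp add: prod.distinct_set_conv_list[symmetric] atLeast0LessThan)
qed

lemma det_diagonalised:
  assumes Q: "Q \<in> carrier_mat m m" "Q * mat_adjoint Q = 1\<^sub>m m"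
    and A: "A = Q * mat_diag m (\<lambda>i. complex_of_real (d i)) * mat_adjoint Q"
  shows "det A = complex_of_real (\<Prod>i<m. d i)"
proof -
  have aQ: "mat_adjoint Q \<in> carrier_mat m m" using Q(1) by simp
  have "det Q * det (mat_adjoint Q) = 1"
    using det_mult[OF Q(1) aQ] Q(2) by simp
  then show ?thesis
    unfolding A det_mult[OF mult_carrier_mat[OF Q(1) mat_diag_dim] aQ] det_mult[OF Q(1) mat_diag_dim] det_diag
    by (simp add: mult.commute mult.left_commute)
qed

lemma det_eq_prod_eigenvalues:
  assumes "A \<in> carrier_mat m m" "hermitian A"
  shows "det A = complex_of_real (\<Prod>i<m. hermitian_eigenvalues A ! i)"
  by (rule hermitian_diagonalisation[OF assms]) (rule det_diagonalised)

abbreviation real_diag :: "nat \<Rightarrow> (nat \<Rightarrow> real) \<Rightarrow> complex mat" where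
  "real_diag m s \<equiv> mat_diag m (\<lambda>i. complex_of_real (s i))"

lemma adjoint_real_diag: "mat_adjoint (real_diag m s) = real_diag m s"
  using hermitian_diag unfolding hermitian_def .

lemma real_diag_congruence:
  assumes R: "R \<in> carrier_mat m m" "hermitian R"
  shows "real_diag m s * R * real_diag m s \<in> carrier_mat m m"
    and "hermitian (real_diag m s * R * real_diag m s)"
    and "v \<in> carrier_vec m \<Longrightarrow> hform (real_diag m s * R * real_diag m s) v = hform R (real_diag m s *\<^sub>v v)"
  using hermitian_congruence[OF mat_diag_dim R, of "\<lambda>i. complex_of_real (s i)"]
    hform_congruence[OF mat_diag_dim R(1), of v "\<lambda>i. complex_of_real (s i)"]
    mult_carrier_mat[OF mult_carrier_mat[OF mat_diag_dim R(1)] mat_diag_dim]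
  unfolding adjoint_real_diag by auto

lemma nsq_real_diag:
  assumes "v \<in> carrier_vec m"
  shows "nsq (real_diag m s *\<^sub>v v) = (\<Sum>i<m. (s i)\<^sup>2 * (cmod (v $ i))\<^sup>2)"
proof -
  have "nsq (real_diag m s *\<^sub>v v) = hform (real_diag m (\<lambda>i. s i * s i)) v"
    using hform_gram[OF mat_diag_dim assms, of "\<lambda>i. complex_of_real (s i)"]
    unfolding adjoint_real_diag by simp
  also have "\<dots> = (\<Sum>i<m. (s i)\<^sup>2 * (cmod (v $ i))\<^sup>2)"
    unfolding hform_diag[OF assms] power2_eq_square ..
  finally show ?thesis .
qed

text \<open>The argument of Li and Mathias. Let \<open>h\<close> be the smallest of the \<open>k = |J|\<close> largest eigenvalues of
  \<open>R\<close> and replace \<open>R\<close> by \<open>R'\<close>, in which every eigenvalue below \<open>h\<close> is raised to \<open>h\<close>. This only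
  increases the eigenvalues on the left. Since \<open>R' \<ge> h\<close>, every ratio
  \<open>\<rho> j\<close> of an eigenvalue of \<open>S R' S\<close>, with \<open>S = diag s\<close>, to the one of \<open>h S\<^sup>2\<close> is at least \<open>1\<close>, so
  the product over \<open>J\<close> is at most the product over all indices, and that one is a quotient of determinants.\<close>

proposition multiplicative_lidskii:
  assumes R: "R \<in> carrier_mat m m" "hermitian R"
    and pos: "\<And>l. l < m \<Longrightarrow> 0 < hermitian_eigenvalues R ! l"
    and s: "\<And>i. i < m \<Longrightarrow> 0 < s i" "\<And>i j. i \<le> j \<Longrightarrow> j < m \<Longrightarrow> s j \<le> s i"
    and J: "J \<subseteq> {..<m}"
  defines "N \<equiv> real_diag m s * R * real_diag m s"
  shows "(\<Prod>j\<in>J. hermitian_eigenvalues N ! j)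
    \<le> (\<Prod>j\<in>J. (s j)\<^sup>2) * (\<Prod>l<card J. hermitian_eigenvalues R ! l)"
proof (cases "J = {}")
  case False
  define e where "e l = hermitian_eigenvalues R ! l" for l
  have fin: "finite J" using J finite_subset by blast
  define k where "k = card J"
  have k: "0 < k" "k \<le> m"
    using False fin J card_mono[OF _ J] by (auto simp: k_def card_gt_0_iff)
  define h where "h = e (k - 1)"
  obtain Q where Q: "Q \<in> carrier_mat m m" "mat_adjoint Q * Q = 1\<^sub>m m" "Q * mat_adjoint Q = 1\<^sub>m m"
    "R = Q * real_diag m e * mat_adjoint Q"
    and sR: "sorted (rev (hermitian_eigenvalues R))" "length (hermitian_eigenvalues R) = m"
    using hermitian_diagonalisation[OF R] unfolding e_def by metis
  have e: "e j \<le> e i" if "i \<le> j" "j < m" for i j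
    using sorted_desc_nth[OF sR(1) that(1)] that sR(2) by (simp add: e_def)
  have h: "h > 0" using pos k by (simp add: h_def e_def)
  \<comment> \<open>\<open>R'\<close> raises the eigenvalues of \<open>R\<close> below the level \<open>h\<close> to \<open>h\<close>, so \<open>R \<le> R'\<close> and \<open>h \<le> R'\<close>.\<close>
  define R' where "R' = Q * real_diag m (\<lambda>i. max (e i) h) * mat_adjoint Q"
  have aQ: "mat_adjoint Q \<in> carrier_mat m m" using Q(1) by simp
  have R': "R' \<in> carrier_mat m m" "hermitian R'"
    using hermitian_congruence[OF aQ mat_diag_dim hermitian_diag, of "\<lambda>i. max (e i) h"]
      mult_carrier_mat[OF mult_carrier_mat[OF Q(1) mat_diag_dim] aQ]
    by (auto simp: R'_def)
  have form_R: "hform R v \<le> hform R' v" "h * nsq v \<le> hform R' v" if v: "v \<in> carrier_vec m" for v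
    unfolding hform_diagonalised[OF Q(1,3,4) v] hform_diagonalised[OF Q(1,3) R'_def v] sum_distrib_left
    by (intro sum_mono mult_right_mono; simp)+
  define N' where "N' = real_diag m s * R' * real_diag m s"
  note cN = real_diag_congruence[OF R, where s = s, folded N_def]
  note cN' = real_diag_congruence[OF R', where s = s, folded N'_def]
  define a where "a j = hermitian_eigenvalues N ! j" for j
  define b where "b j = hermitian_eigenvalues N' ! j" for j
  have Sv: "real_diag m s *\<^sub>v v \<in> carrier_vec m" if "v \<in> carrier_vec m" for v
    using mult_mat_vec_carrier[OF mat_diag_dim that] .
  have ab: "a j \<le> b j" if "j < m" for j
    unfolding a_def b_def
    by (rule eigenvalue_mono[OF cN'(1,2) cN(1,2) _ that]) (simp add: cN(3) cN'(3) form_R(1) Sv)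
  have R0: "0 \<le> hform R v" if v: "v \<in> carrier_vec m" for v
    unfolding hform_diagonalised[OF Q(1,3,4) v]
    by (intro sum_nonneg mult_nonneg_nonneg) (use pos in \<open>auto simp: e_def less_imp_le\<close>)
  have a0: "0 \<le> a j" if "j < m" for j
    unfolding a_def by (rule eigenvalue_ge[OF cN(1,2) _ that]) (simp add: cN(3) R0 Sv)
  have bh: "h * (s j)\<^sup>2 \<le> b j" if "j < m" for j
  proof -
    have "hermitian_eigenvalues (real_diag m (\<lambda>i. h * (s i)\<^sup>2)) = map (\<lambda>i. h * (s i)\<^sup>2) [0..<m]"
      by (rule eigenvalues_diag) (use s h in \<open>auto intro!: power_mono simp: less_imp_le\<close>)
    moreover have "hermitian_eigenvalues (real_diag m (\<lambda>i. h * (s i)\<^sup>2)) ! j \<le> b j"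
      unfolding b_def
    proof (rule eigenvalue_mono[OF cN'(1,2) mat_diag_dim hermitian_diag _ that])
      fix v :: "complex vec" assume v: "v \<in> carrier_vec m"
      have "hform (real_diag m (\<lambda>i. h * (s i)\<^sup>2)) v = h * nsq (real_diag m s *\<^sub>v v)"
        unfolding hform_diag[OF v] nsq_real_diag[OF v] by (simp add: sum_distrib_left mult.assoc)
      then show "hform (real_diag m (\<lambda>i. h * (s i)\<^sup>2)) v \<le> hform N' v"
        using form_R(2)[OF Sv[OF v]] cN'(3)[OF v] by simp
    qed
    ultimately show ?thesis using that by simp
  qed
  have hs: "0 < h * (s j)\<^sup>2" if "j < m" for j using h s(1)[OF that] by simp
  define \<rho> where "\<rho> j = b j / (h * (s j)\<^sup>2)" for j
  have \<rho>1: "1 \<le> \<rho> j" if "j < m" for j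
    unfolding \<rho>_def using bh[OF that] hs[OF that] by simp
  have b\<rho>: "b j = h * (s j)\<^sup>2 * \<rho> j" if "j < m" for j
    unfolding \<rho>_def using h s(1)[OF that] by simp
  have "complex_of_real (\<Prod>j<m. b j) = det N'"
    unfolding b_def by (rule det_eq_prod_eigenvalues[OF cN'(1,2), symmetric])
  also have "\<dots> = complex_of_real ((\<Prod>j<m. (s j)\<^sup>2) * (\<Prod>l<m. max (e l) h))"
    unfolding N'_def det_mult[OF mult_carrier_mat[OF mat_diag_dim R'(1)] mat_diag_dim]
      det_mult[OF mat_diag_dim R'(1)] det_diag det_diagonalised[OF Q(1,3) R'_def]
    by (simp add: power2_eq_square prod.distrib)
  finally have det: "(\<Prod>j<m. b j) = (\<Prod>j<m. (s j)\<^sup>2) * (\<Prod>l<m. max (e l) h)"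
    unfolding of_real_eq_iff .
  have s0: "(\<Prod>j<m. (s j)\<^sup>2) > 0" by (intro prod_pos) (use s(1) in force)
  have "(\<Prod>j<m. b j) = (\<Prod>j<m. (s j)\<^sup>2) * (h ^ m * (\<Prod>j<m. \<rho> j))"
    using b\<rho> by (simp add: prod.distrib)
  then have "(\<Prod>j<m. (s j)\<^sup>2) * (h ^ m * (\<Prod>j<m. \<rho> j)) = (\<Prod>j<m. (s j)\<^sup>2) * (\<Prod>l<m. max (e l) h)"
    using det by (rule trans[OF sym])
  then have "h ^ m * (\<Prod>j<m. \<rho> j) = (\<Prod>l<m. max (e l) h)"
    using s0 by (metis less_irrefl mult_left_cancel)
  also have "\<dots> = (\<Prod>l<k. max (e l) h) * (\<Prod>l=k..<m. max (e l) h)"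
    using prod.atLeastLessThan_concat[of 0 k m "\<lambda>l. max (e l) h"] k by (simp add: atLeast0LessThan)
  also have "(\<Prod>l<k. max (e l) h) = (\<Prod>l<k. e l)"
    using e k by (intro prod.cong) (auto simp: h_def max_def intro!: antisym)
  also have "(\<Prod>l=k..<m. max (e l) h) = (\<Prod>l=k..<m. h)"
    using e k by (intro prod.cong) (auto simp: h_def max_def intro: antisym)
  also have "(\<Prod>l=k..<m. h) = h ^ (m - k)" by simp
  finally have "h ^ (m - k) * (h ^ k * (\<Prod>j<m. \<rho> j)) = h ^ (m - k) * (\<Prod>l<k. e l)"
    using k by (simp add: power_add[symmetric] mult.assoc[symmetric] mult.commute)
  then have \<rho>_all: "h ^ k * (\<Prod>j<m. \<rho> j) = (\<Prod>l<k. e l)" using h by simp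
  have \<rho>_J: "(\<Prod>j\<in>J. \<rho> j) \<le> (\<Prod>j<m. \<rho> j)"
  proof (rule prod_mono2)
    show "1 \<le> \<rho> j" if "j \<in> {..<m} - J" for j using \<rho>1 that by auto
    show "0 \<le> \<rho> j" if "j \<in> J" for j using \<rho>1[of j] that J by force
  qed (use J in auto)
  have "(\<Prod>j\<in>J. a j) \<le> (\<Prod>j\<in>J. b j)"
    using a0 ab J by (intro prod_mono) auto
  also have "\<dots> = (\<Prod>j\<in>J. h * (s j)\<^sup>2 * \<rho> j)"
    using b\<rho> J by (intro prod.cong) auto
  also have "\<dots> = (\<Prod>j\<in>J. (s j)\<^sup>2) * (h ^ k * (\<Prod>j\<in>J. \<rho> j))"
    by (simp add: prod.distrib k_def mult_ac)
  also have "\<dots> \<le> (\<Prod>j\<in>J. (s j)\<^sup>2) * (h ^ k * (\<Prod>j<m. \<rho> j))"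
    using \<rho>_J h by (intro mult_left_mono prod_nonneg) auto
  finally have "(\<Prod>j\<in>J. a j) \<le> (\<Prod>j\<in>J. (s j)\<^sup>2) * (\<Prod>l<k. e l)"
    unfolding \<rho>_all .
  then show ?thesis unfolding k_def a_def e_def .
qed simp

section \<open>From products to sums and weak majorization\<close>

lemma abel_partial_sums:
  fixes a x :: "nat \<Rightarrow> real"
  assumes a: "\<And>i j. i \<le> j \<Longrightarrow> j \<le> k \<Longrightarrow> a j \<le> a i"
    and x: "\<And>i. i \<le> k \<Longrightarrow> 0 \<le> (\<Sum>l<i. x l)"
  shows "a k * (\<Sum>l<Suc k. x l) \<le> (\<Sum>l<Suc k. a l * x l)"
  using assms
proof (induction k)
  case (Suc k)
  have "a (Suc k) * (\<Sum>l<Suc k. x l) \<le> a k * (\<Sum>l<Suc k. x l)"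
    using Suc.prems(1)[of k "Suc k"] Suc.prems(2)[of "Suc k"] by (intro mult_right_mono) auto
  also have "\<dots> \<le> (\<Sum>l<Suc k. a l * x l)"
    by (rule Suc.IH) (use Suc.prems in auto)
  finally show ?case by (simp add: distrib_left)
qed simp

text \<open>With \<open>x = ln (b / a)\<close> the hypothesis says that the partial sums of \<open>x\<close> are nonnegative, and
  \<open>b - a \<ge> a * x\<close> because \<open>ln u \<le> u - 1\<close>; summation by parts with the decreasing weights \<open>a\<close>
  gives the rest.\<close>

lemma log_majorization_sum:
  fixes a b :: "nat \<Rightarrow> real"
  assumes pos: "\<And>l. l < k \<Longrightarrow> 0 < a l" "\<And>l. l < k \<Longrightarrow> 0 < b l"
    and dec: "\<And>i j. i \<le> j \<Longrightarrow> j < k \<Longrightarrow> a j \<le> a i"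
    and prod: "\<And>i. i \<le> k \<Longrightarrow> (\<Prod>l<i. a l) \<le> (\<Prod>l<i. b l)"
  shows "(\<Sum>l<k. a l) \<le> (\<Sum>l<k. b l)"
proof (cases k)
  case (Suc k')
  define x where "x l = ln (b l / a l)" for l
  have part: "0 \<le> (\<Sum>l<i. x l)" if "i \<le> k" for i
  proof -
    have "0 < b l / a l" if "l < i" for l
      using pos[of l] that \<open>i \<le> k\<close> by simp
    then have "(\<Sum>l<i. x l) = ln (\<Prod>l<i. b l / a l)"
      unfolding x_def by (subst ln_prod) force+
    also have "(\<Prod>l<i. b l / a l) = (\<Prod>l<i. b l) / (\<Prod>l<i. a l)"
      by (simp add: prod_dividef)
    also have "1 \<le> (\<Prod>l<i. b l) / (\<Prod>l<i. a l)"
      using prod[OF that] prod_pos[of "{..<i}" a] pos(1) that by simp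
    then have "0 \<le> ln ((\<Prod>l<i. b l) / (\<Prod>l<i. a l))" by simp
    finally show ?thesis .
  qed
  have "0 \<le> a k' * (\<Sum>l<Suc k'. x l)"
    using pos(1)[of k'] part[of k] Suc by simp
  also have "\<dots> \<le> (\<Sum>l<k. a l * x l)"
    unfolding Suc by (rule abel_partial_sums) (use dec part Suc in auto)
  also have "\<dots> \<le> (\<Sum>l<k. b l - a l)"
  proof (rule sum_mono)
    fix l assume "l \<in> {..<k}"
    then have p: "0 < a l" "0 < b l" using pos by auto
    then have "x l \<le> b l / a l - 1"
      unfolding x_def by (intro ln_le_minus_one) simp
    then have "a l * x l \<le> a l * (b l / a l - 1)" using p by simp
    also have "\<dots> = b l - a l" using p by (simp add: field_simps)
    finally show "a l * x l \<le> b l - a l" .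
  qed
  finally show ?thesis by (simp add: sum_subtractf)
qed simp

lemma decreasing_enumeration:
  fixes x :: "nat \<Rightarrow> real"
  assumes "finite J"
  shows "\<exists>f. bij_betw f {..<card J} J \<and> (\<forall>i j. i \<le> j \<longrightarrow> j < card J \<longrightarrow> x (f j) \<le> x (f i))"
proof -
  define xs where "xs = rev (sort_key x (sorted_list_of_set J))"
  have xs: "distinct xs" "set xs = J" "length xs = card J"
    using assms by (auto simp: xs_def)
  have "sorted (map x (rev xs))"
    unfolding xs_def by simp
  then have "sorted (rev (map x xs))" by (simp add: rev_map)
  then have "x (xs ! j) \<le> x (xs ! i)" if "i \<le> j" "j < card J" for i j
    using sorted_desc_nth[of "map x xs" i j] that xs(3) by simp
  moreover have "bij_betw (\<lambda>i. xs ! i) {..<card J} J"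
    using bij_betw_nth[OF xs(1)] xs by auto
  ultimately show ?thesis by blast
qed

text \<open>Enumerating \<open>J\<close> so that \<open>x\<close> decreases reduces this to \<open>log_majorization_sum\<close>; the initial
  segments of such an enumeration are arbitrary sets, hence the hypothesis for every subset.\<close>

lemma subset_log_majorization_sum:
  fixes x r :: "nat \<Rightarrow> real"
  assumes pos: "\<And>j. j < m \<Longrightarrow> 0 < x j" "\<And>l. l < m \<Longrightarrow> 0 < r l"
    and prod: "\<And>J. J \<subseteq> {..<m} \<Longrightarrow> (\<Prod>j\<in>J. x j) \<le> (\<Prod>l<card J. r l)"
    and J: "J \<subseteq> {..<m}"
  shows "(\<Sum>j\<in>J. x j) \<le> (\<Sum>l<card J. r l)"
proof -
  have fin: "finite J" and cJ: "card J \<le> m"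
    using J finite_subset[OF J] card_mono[OF _ J] by auto
  obtain f where f: "bij_betw f {..<card J} J" "\<forall>i j. i \<le> j \<longrightarrow> j < card J \<longrightarrow> x (f j) \<le> x (f i)"
    using decreasing_enumeration[OF fin, of x] by blast
  have fJ: "f l \<in> J" if "l < card J" for l using bij_betwE[OF f(1)] that by auto
  have "(\<Sum>j\<in>J. x j) = (\<Sum>l<card J. x (f l))"
    using sum.reindex_bij_betw[OF f(1), of x] by simp
  also have "\<dots> \<le> (\<Sum>l<card J. r l)"
  proof (rule log_majorization_sum)
    fix i assume i: "i \<le> card J"
    have inj: "inj_on f {..<i}"
      using f(1) i by (auto simp: bij_betw_def intro: inj_on_subset)
    have "(\<Prod>l<i. x (f l)) = (\<Prod>j\<in>f ` {..<i}. x j)"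
      by (simp add: prod.reindex[OF inj])
    also have "\<dots> \<le> (\<Prod>l<card (f ` {..<i}). r l)"
    proof (rule prod, rule image_subsetI)
      show "f l \<in> {..<m}" if "l \<in> {..<i}" for l
        using fJ[of l] J i that by auto
    qed
    finally show "(\<Prod>l<i. x (f l)) \<le> (\<Prod>l<i. r l)"
      by (simp add: card_image[OF inj])
  next
    show "0 < x (f l)" "0 < r l" if "l < card J" for l
      using pos fJ[OF that] J that cJ by auto
  qed (use f(2) in blast)
  finally show ?thesis .
qed

text \<open>The \<open>k\<close> largest entries of \<open>a\<close> are the entries at some \<open>k\<close>-element index set, which need
  not be an initial segment.\<close>

lemma weakly_majorizedI:
  assumes len: "length a = length b" and b: "sorted (rev b)"
    and J: "\<And>J. J \<subseteq> {..<length a} \<Longrightarrow> (\<Sum>j\<in>J. a ! j) \<le> (\<Sum>l<card J. b ! l)"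
  shows "a \<prec>\<^sub>w b"
  unfolding weakly_majorized_def
proof (intro conjI ballI len)
  fix k assume "k \<in> {1..length a}"
  then have k: "k \<le> length a" by simp
  have "sort b = rev b"
    by (rule properties_for_sort) (use b in auto)
  then have rsb: "rev (sort b) = b" by simp
  obtain f where f: "bij_betw f {..<length a} {..<length a}"
      "\<forall>i<length a. rev (sort a) ! i = a ! f i"
    using permutation_Ex_bij[of "rev (sort a)" a] by auto
  have inj: "inj_on f {..<k}"
    using f(1) k by (auto simp: bij_betw_def intro: inj_on_subset)
  have "sum_list (take k (rev (sort a))) = (\<Sum>i<k. rev (sort a) ! i)"
    using k by (simp add: sum_list_sum_nth atLeast0LessThan)
  also have "\<dots> = (\<Sum>i<k. a ! f i)"
    using f(2) k by (intro sum.cong) auto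
  also have "\<dots> = (\<Sum>j\<in>f ` {..<k}. a ! j)"
    by (simp add: sum.reindex[OF inj])
  also have "\<dots> \<le> (\<Sum>l<card (f ` {..<k}). b ! l)"
    by (rule J) (use bij_betwE[OF f(1)] k in force)
  also have "\<dots> = (\<Sum>i<k. rev (sort b) ! i)"
    by (simp add: card_image[OF inj] rsb)
  also have "\<dots> = sum_list (take k (rev (sort b)))"
    using k len by (simp add: sum_list_sum_nth atLeast0LessThan)
  finally show "sum_list (take k (rev (sort a))) \<le> sum_list (take k (rev (sort b)))" .
qed

text \<open>The matrix \<open>P + c\<close>, described by its form and its spectrum. It serves twice: to make a semidefinite
  matrix definite, and to split the identity off a Gram matrix.\<close>

lemma hermitian_add_multiple_of_identity:
  assumes P: "P \<in> carrier_mat m m" "hermitian P"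
  obtains R where "R \<in> carrier_mat m m" "hermitian R"
    "\<And>v. v \<in> carrier_vec m \<Longrightarrow> hform R v = hform P v + c * nsq v"
    "\<And>l. l < m \<Longrightarrow> hermitian_eigenvalues R ! l = hermitian_eigenvalues P ! l + c"
proof -
  define e where "e l = hermitian_eigenvalues P ! l" for l
  obtain Q where Q: "Q \<in> carrier_mat m m" "mat_adjoint Q * Q = 1\<^sub>m m" "Q * mat_adjoint Q = 1\<^sub>m m"
    "P = Q * real_diag m e * mat_adjoint Q"
    and sP: "sorted (rev (hermitian_eigenvalues P))" "length (hermitian_eigenvalues P) = m"
    using hermitian_diagonalisation[OF P] unfolding e_def by metis
  define R where "R = Q * real_diag m (\<lambda>i. e i + c) * mat_adjoint Q"
  have aQ: "mat_adjoint Q \<in> carrier_mat m m" using Q(1) by simp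
  show thesis
  proof
    show "R \<in> carrier_mat m m" "hermitian R"
      using hermitian_congruence[OF aQ mat_diag_dim hermitian_diag, of "\<lambda>i. e i + c"]
        mult_carrier_mat[OF mult_carrier_mat[OF Q(1) mat_diag_dim] aQ]
      by (auto simp: R_def)
    show "hform R v = hform P v + c * nsq v" if v: "v \<in> carrier_vec m" for v
      unfolding hform_diagonalised[OF Q(1,3,4) v] hform_diagonalised[OF Q(1,3) R_def v]
      by (simp add: sum_distrib_left sum.distrib distrib_right)
    have "hermitian_eigenvalues R = map (\<lambda>i. e i + c) [0..<m]"
      by (rule hermitian_eigenvalues_unique[OF Q(1-3) R_def])
        (use sorted_desc_nth[OF sP(1)] sP(2) in \<open>simp add: e_def\<close>)
    then show "hermitian_eigenvalues R ! l = hermitian_eigenvalues P ! l + c" if "l < m" for l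
      using that by (simp add: e_def)
  qed
qed

text \<open>Lidskii's inequality for initial segments, turned into sums. It requires a definite matrix, so it is
  applied to \<open>P + \<epsilon>\<close>, and \<open>\<epsilon>\<close> tends to \<open>0\<close> in the resulting sums.\<close>

proposition scaled_eigenvalue_sums:
  assumes P: "P \<in> carrier_mat m m" "hermitian P"
    and psd: "\<And>v. v \<in> carrier_vec m \<Longrightarrow> 0 \<le> hform P v"
    and s: "\<And>i. i < m \<Longrightarrow> 0 < s i" "\<And>i j. i \<le> j \<Longrightarrow> j < m \<Longrightarrow> s j \<le> s i"
    and k: "k \<le> m"
  defines "N \<equiv> real_diag m s * P * real_diag m s"
  shows "(\<Sum>l<k. sqrt (hermitian_eigenvalues N ! l)) \<le> (\<Sum>l<k. s l * sqrt (hermitian_eigenvalues P ! l))"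
    and "(\<Sum>l<k. hermitian_eigenvalues N ! l) \<le> (\<Sum>l<k. (s l)\<^sup>2 * hermitian_eigenvalues P ! l)"
proof -
  let ?e = "\<lambda>l. hermitian_eigenvalues P ! l" and ?n = "\<lambda>l. hermitian_eigenvalues N ! l"
  have e0: "0 \<le> ?e l" if "l < m" for l
    by (rule eigenvalue_ge[OF P _ that]) (simp add: psd)
  have eps: "(\<Sum>l<k. sqrt (?n l)) \<le> (\<Sum>l<k. s l * sqrt (?e l + \<epsilon>))
      \<and> (\<Sum>l<k. ?n l) \<le> (\<Sum>l<k. (s l)\<^sup>2 * (?e l + \<epsilon>))" if \<epsilon>: "\<epsilon> > 0" for \<epsilon>
  proof -
    obtain R where R: "R \<in> carrier_mat m m" "hermitian R"
      "\<And>v. v \<in> carrier_vec m \<Longrightarrow> hform R v = hform P v + \<epsilon> * nsq v"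
      "\<And>l. l < m \<Longrightarrow> hermitian_eigenvalues R ! l = ?e l + \<epsilon>"
      using hermitian_add_multiple_of_identity[OF P, of \<epsilon>] by blast
    define N' where "N' = real_diag m s * R * real_diag m s"
    define a where "a l = hermitian_eigenvalues N' ! l" for l
    note cN = real_diag_congruence[OF P, where s = s, folded N_def]
    note cN' = real_diag_congruence[OF R(1,2), where s = s, folded N'_def]
    have Sv: "real_diag m s *\<^sub>v v \<in> carrier_vec m" if "v \<in> carrier_vec m" for v
      using mult_mat_vec_carrier[OF mat_diag_dim that] .
    have le: "?n l \<le> a l" if "l < m" for l
      unfolding a_def
      by (rule eigenvalue_mono[OF cN'(1,2) cN(1,2) _ that]) (simp add: cN(3) cN'(3) R(3) Sv less_imp_le[OF \<epsilon>])
    have apos: "0 < a l" if "l < m" for l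
      unfolding a_def
    proof (rule eigenvalue_pos[OF cN'(1,2) _ that])
      fix v :: "complex vec" assume v: "v \<in> carrier_vec m" "v \<noteq> 0\<^sub>v m"
      have "0 < nsq (real_diag m s *\<^sub>v v)"
      proof (rule nsq_pos[OF Sv[OF v(1)]])
        obtain i where i: "i < m" "v $ i \<noteq> 0"
          using v by (metis eq_vecI carrier_vecD index_zero_vec)
        have "(real_diag m s *\<^sub>v v) $ i \<noteq> 0"
          unfolding diag_vec_index[OF v(1) i(1)] using i s(1)[of i] by simp
        then show "real_diag m s *\<^sub>v v \<noteq> 0\<^sub>v m" using i by auto
      qed
      then have "0 < \<epsilon> * nsq (real_diag m s *\<^sub>v v)" using \<epsilon> by simp
      then show "0 < hform N' v"
        using psd[OF Sv[OF v(1)]] unfolding cN'(3)[OF v(1)] R(3)[OF Sv[OF v(1)]] by linarith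
    qed
    obtain Q where sN: "sorted (rev (hermitian_eigenvalues N'))" "length (hermitian_eigenvalues N') = m"
      using hermitian_diagonalisation[OF cN'(1,2)] .
    have adec: "a j \<le> a i" if "i \<le> j" "j < m" for i j
      using sorted_desc_nth[OF sN(1) that(1)] that sN(2) by (simp add: a_def)
    have prod: "(\<Prod>l<i. a l) \<le> (\<Prod>l<i. (s l)\<^sup>2 * (?e l + \<epsilon>))" if "i \<le> m" for i
    proof -
      have "(\<Prod>l\<in>{..<i}. a l) \<le> (\<Prod>l\<in>{..<i}. (s l)\<^sup>2) * (\<Prod>l<card {..<i}. hermitian_eigenvalues R ! l)"
        unfolding a_def N'_def
        by (rule multiplicative_lidskii[OF R(1,2) _ s]) (use that R(4) e0 \<epsilon> in \<open>auto simp: add_nonneg_pos\<close>)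
      also have "\<dots> = (\<Prod>l<i. (s l)\<^sup>2 * (?e l + \<epsilon>))"
        using that R(4) by (simp add: prod.distrib)
      finally show ?thesis .
    qed
    have bpos: "0 < (s l)\<^sup>2 * (?e l + \<epsilon>)" if "l < m" for l
      using s(1)[OF that] e0[OF that] \<epsilon> by (simp add: add_nonneg_pos)
    have "(\<Sum>l<k. ?n l) \<le> (\<Sum>l<k. a l)"
      using le k by (intro sum_mono) auto
    also have "\<dots> \<le> (\<Sum>l<k. (s l)\<^sup>2 * (?e l + \<epsilon>))"
      by (rule log_majorization_sum) (use apos bpos adec prod k in auto)
    finally have 1: "(\<Sum>l<k. ?n l) \<le> (\<Sum>l<k. (s l)\<^sup>2 * (?e l + \<epsilon>))" .
    have "(\<Sum>l<k. sqrt (?n l)) \<le> (\<Sum>l<k. sqrt (a l))"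
      using le k by (intro sum_mono) auto
    also have "\<dots> \<le> (\<Sum>l<k. sqrt ((s l)\<^sup>2 * (?e l + \<epsilon>)))"
    proof (rule log_majorization_sum)
      show "(\<Prod>l<i. sqrt (a l)) \<le> (\<Prod>l<i. sqrt ((s l)\<^sup>2 * (?e l + \<epsilon>)))" if "i \<le> k" for i
      proof -
        have sq: "(\<Prod>l<i. sqrt (f l)) = sqrt (\<Prod>l<i. f l)" for f :: "nat \<Rightarrow> real"
          by (induction i) (simp_all add: real_sqrt_mult)
        show ?thesis unfolding sq using prod[of i] that k by simp
      qed
    qed (use apos bpos adec k in auto)
    also have "\<dots> = (\<Sum>l<k. s l * sqrt (?e l + \<epsilon>))"
      using s(1) k by (intro sum.cong) (auto simp: real_sqrt_mult less_imp_le)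
    finally show ?thesis using 1 by simp
  qed
  have "((\<lambda>\<epsilon>. \<Sum>l<k. s l * sqrt (?e l + \<epsilon>)) \<longlongrightarrow> (\<Sum>l<k. s l * sqrt (?e l + 0))) (at_right 0)"
    by (intro tendsto_intros)
  then show "(\<Sum>l<k. sqrt (?n l)) \<le> (\<Sum>l<k. s l * sqrt (?e l))"
    using eps by (intro tendsto_lowerbound[where F = "at_right (0::real)"])
      (auto intro: eventually_at_rightI[of 0 1])
  have "((\<lambda>\<epsilon>. \<Sum>l<k. (s l)\<^sup>2 * (?e l + \<epsilon>)) \<longlongrightarrow> (\<Sum>l<k. (s l)\<^sup>2 * (?e l + 0))) (at_right 0)"
    by (intro tendsto_intros)
  then show "(\<Sum>l<k. ?n l) \<le> (\<Sum>l<k. (s l)\<^sup>2 * ?e l)"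
    using eps by (intro tendsto_lowerbound[where F = "at_right (0::real)"])
      (auto intro: eventually_at_rightI[of 0 1])
qed

section \<open>Principal angles through Gram matrices\<close>

lemma adjoint_mult_carrier:
  fixes U V :: "complex mat"
  shows "U \<in> carrier_mat n a \<Longrightarrow> V \<in> carrier_mat n b \<Longrightarrow> mat_adjoint U * V \<in> carrier_mat a b"
  by (rule mult_carrier_mat[OF mat_adjoint_carrier])

lemma eigenvalue_le:
  assumes M: "M \<in> carrier_mat m m" "hermitian M"
    and le: "\<And>v. v \<in> carrier_vec m \<Longrightarrow> hform M v \<le> c * nsq v" and l: "l < m"
  shows "hermitian_eigenvalues M ! l \<le> c"
proof -
  obtain v where v: "v \<in> carrier_vec m" "v \<noteq> 0\<^sub>v m"
      "hermitian_eigenvalues M ! l * nsq v \<le> hform M v"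
    using eigen_test_vector_high[OF M M one_carrier_mat l l] by auto
  have "hermitian_eigenvalues M ! l * nsq v \<le> c * nsq v"
    using v(3) le[OF v(1)] by simp
  then show ?thesis using nsq_pos[OF v(1,2)] by simp
qed

lemma eigenvalue_compression:
  assumes M: "M \<in> carrier_mat m m" "hermitian M" and N: "N \<in> carrier_mat r r" "hermitian N"
    and S: "S \<in> carrier_mat m r" "mat_adjoint S * S = 1\<^sub>m r"
    and le: "\<And>v. v \<in> carrier_vec r \<Longrightarrow> hform N v \<le> hform M (S *\<^sub>v v)" and l: "l < m" "l < r"
  shows "hermitian_eigenvalues N ! l \<le> hermitian_eigenvalues M ! l"
proof -
  obtain v where v: "v \<in> carrier_vec r" "v \<noteq> 0\<^sub>v r"
      "hermitian_eigenvalues N ! l * nsq v \<le> hform N v"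
      "hform M (S *\<^sub>v v) \<le> hermitian_eigenvalues M ! l * nsq (S *\<^sub>v v)"
    using eigen_test_vector_high[OF M N S(1) l] by auto
  have "hermitian_eigenvalues N ! l * nsq v \<le> hermitian_eigenvalues M ! l * nsq v"
    using v(3,4) le[OF v(1)] nsq_isometry[OF S v(1)] by simp
  then show ?thesis using nsq_pos[OF v(1,2)] by simp
qed

lemma nsq_diff_scaled:
  assumes "u \<in> carrier_vec n" "w \<in> carrier_vec n"
  shows "nsq (u - complex_of_real s \<cdot>\<^sub>v w) = nsq u - 2 * s * Re (u \<bullet>c w) + s\<^sup>2 * nsq w"
proof -
  have *: "(cmod (a - complex_of_real s * b))\<^sup>2 = (cmod a)\<^sup>2 - 2 * s * Re (a * cnj b) + s\<^sup>2 * (cmod b)\<^sup>2" for a b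
    unfolding cmod_power2 by (simp add: power2_eq_square algebra_simps)
  have "nsq (u - complex_of_real s \<cdot>\<^sub>v w)
      = (\<Sum>i<n. (cmod (u $ i))\<^sup>2 - 2 * s * Re (u $ i * cnj (w $ i)) + s\<^sup>2 * (cmod (w $ i))\<^sup>2)"
    unfolding nsq_def *[symmetric] using assms by (intro sum.cong) auto
  also have "\<dots> = nsq u - 2 * s * Re (u \<bullet>c w) + s\<^sup>2 * nsq w"
    unfolding inner_sum[OF assms] nsq_def carrier_vecD[OF assms(1)] carrier_vecD[OF assms(2)]
    by (simp only: sum.distrib sum_subtractf sum_distrib_left Re_sum)
  finally show ?thesis .
qed

text \<open>Bessel's inequality: \<open>0 \<le> |w - U U\<^sup>H w|\<^sup>2 = |w|\<^sup>2 - |U\<^sup>H w|\<^sup>2\<close>.\<close>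

lemma bessel:
  assumes U: "U \<in> carrier_mat n t" "mat_adjoint U * U = 1\<^sub>m t" and w: "w \<in> carrier_vec n"
  shows "nsq (mat_adjoint U *\<^sub>v w) \<le> nsq w"
proof -
  have aU: "mat_adjoint U \<in> carrier_mat t n" using U(1) by simp
  define a where "a = mat_adjoint U *\<^sub>v w"
  have a: "a \<in> carrier_vec t" unfolding a_def using mult_mat_vec_carrier[OF aU w] .
  have Ua: "U *\<^sub>v a \<in> carrier_vec n" using mult_mat_vec_carrier[OF U(1) a] .
  have "w \<bullet>c (U *\<^sub>v a) = complex_of_real (nsq a)"
    using inner_adjoint[OF aU w a] by (simp add: a_def[symmetric] inner_self)
  then have "0 \<le> nsq w - 2 * nsq a + nsq (U *\<^sub>v a)"
    using nsq_diff_scaled[OF w Ua, of 1] nsq_nonneg[of "w - complex_of_real 1 \<cdot>\<^sub>v (U *\<^sub>v a)"] by simp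
  then show ?thesis using nsq_isometry[OF U a] by (simp add: a_def)
qed

lemma tan_arccos_sqrt:
  assumes "0 < c" "c \<le> 1"
  shows "tan (arccos (sqrt c)) = sqrt (1 / c - 1)"
proof -
  have "tan (arccos (sqrt c)) = sqrt (1 - c) / sqrt c"
    using assms order_trans[of "-1" 0 "sqrt c"] by (simp add: tan_def sin_arccos cos_arccos)
  also have "\<dots> = sqrt ((1 - c) / c)" by (simp add: real_sqrt_divide)
  also have "(1 - c) / c = 1 / c - 1" using assms by (simp add: field_simps)
  finally show ?thesis .
qed

lemma hermitian_eigenvalues_length_sorted:
  assumes "M \<in> carrier_mat m m" "hermitian M"
  shows "length (hermitian_eigenvalues M) = m" "sorted (rev (hermitian_eigenvalues M))"
    "\<And>i j. i \<le> j \<Longrightarrow> j < m \<Longrightarrow> hermitian_eigenvalues M ! j \<le> hermitian_eigenvalues M ! i"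
proof -
  obtain Q where "sorted (rev (hermitian_eigenvalues M))" "length (hermitian_eigenvalues M) = m"
    by (rule hermitian_diagonalisation[OF assms])
  then show "length (hermitian_eigenvalues M) = m" "sorted (rev (hermitian_eigenvalues M))"
    "\<And>i j. i \<le> j \<Longrightarrow> j < m \<Longrightarrow> hermitian_eigenvalues M ! j \<le> hermitian_eigenvalues M ! i"
    using sorted_desc_nth by auto
qed

lemma principal_angles_gram:
  assumes U: "orthonormal_basis_mat n S U" "U \<in> carrier_mat n t"
    and V: "orthonormal_basis_mat n T V" "V \<in> carrier_mat n r" and "t \<le> r"
  defines "G \<equiv> mat_adjoint (mat_adjoint V * U) * (mat_adjoint V * U)"
  shows "principal_angles n S T
    = map (\<lambda>l. arccos (sqrt (hermitian_eigenvalues G ! (t - 1 - l)))) [0..<t]"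
proof -
  have VU: "mat_adjoint V * U \<in> carrier_mat r t" by (rule adjoint_mult_carrier[OF V(2) U(2)])
  have G: "G \<in> carrier_mat t t" "hermitian G"
    using adjoint_mult_carrier[OF VU VU] hermitian_gram[OF VU] by (auto simp: G_def)
  note len = hermitian_eigenvalues_length_sorted(1)[OF G]
  have "singular_values (mat_adjoint V * U) = map sqrt (hermitian_eigenvalues G)"
    unfolding singular_values_def G_def[symmetric] using U(2) V(2) len \<open>t \<le> r\<close> by simp
  then have "principal_angles n S T = rev (map arccos (map sqrt (hermitian_eigenvalues G)))"
    using principal_angles_eq[OF U(1) V(1)] by simp
  also have "\<dots> = map (\<lambda>l. arccos (sqrt (hermitian_eigenvalues G ! (t - 1 - l)))) [0..<t]"
    by (rule nth_equalityI) (auto simp: len rev_nth)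
  finally show ?thesis .
qed

text \<open>The situation for the next lemmas: \<open>W\<close> is dual to the orthonormal columns of \<open>U\<close>, so that \<open>W a\<close> is
  \<open>U a\<close> plus a vector orthogonal to the span of \<open>U\<close>.\<close>

context
  fixes n t :: nat and U W :: "complex mat"
  assumes U: "U \<in> carrier_mat n t" "mat_adjoint U * U = 1\<^sub>m t"
    and W: "W \<in> carrier_mat n t" and UW: "mat_adjoint U * W = 1\<^sub>m t"
begin

lemma gram_carrier: "mat_adjoint W * W \<in> carrier_mat t t"
  by (rule adjoint_mult_carrier[OF W W])

lemma nsq_le_dual: "v \<in> carrier_vec t \<Longrightarrow> nsq v \<le> nsq (W *\<^sub>v v)"
proof -
  assume v: "v \<in> carrier_vec t"
  have aU: "mat_adjoint U \<in> carrier_mat t n" using U(1) by simp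
  have "mat_adjoint U *\<^sub>v (W *\<^sub>v v) = v"
    using assoc_mult_mat_vec[OF aU W v] UW v by simp
  then show "nsq v \<le> nsq (W *\<^sub>v v)"
    using bessel[OF U mult_mat_vec_carrier[OF W v]] by simp
qed

lemma dual_gram_eigenvalue_ge_1:
  "l < t \<Longrightarrow> 1 \<le> hermitian_eigenvalues (mat_adjoint W * W) ! l"
  by (rule eigenvalue_ge[OF gram_carrier hermitian_gram[OF W]]) (simp_all add: hform_gram[OF W] nsq_le_dual)

lemma U_onb: "orthonormal_basis_mat n (cspan n (set (cols U))) U"
  unfolding orthonormal_basis_mat_def using U by simp

lemma adjoint_UW: "mat_adjoint W * U = 1\<^sub>m t"
  using mat_adjoint_mult[of "mat_adjoint U" t n W t] U(1) W UW by simp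

text \<open>If \<open>R = Q diag(r) Q\<^sup>H\<close>, then \<open>V = W Q diag(r\<^bsup>-1/2\<^esup>)\<close> is an orthonormal basis of the span of \<open>W\<close>,
  and \<open>V\<^sup>H U = diag(r\<^bsup>-1/2\<^esup>) Q\<^sup>H\<close>. So the squared cosines are the numbers \<open>1 / r\<close>.\<close>

lemma tan_principal_angles_dual:
  "map tan (principal_angles n (cspan n (set (cols U))) (cspan n (set (cols W))))
    = map (\<lambda>l. sqrt (hermitian_eigenvalues (mat_adjoint W * W) ! l - 1)) [0..<t]"
proof -
  define R where "R = mat_adjoint W * W"
  have R: "R \<in> carrier_mat t t" "hermitian R"
    using gram_carrier hermitian_gram[OF W] by (auto simp: R_def)
  define r where "r l = hermitian_eigenvalues R ! l" for l
  have r1: "1 \<le> r l" if "l < t" for l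
    using dual_gram_eigenvalue_ge_1[OF that] by (simp add: r_def R_def)
  have rdec: "r j \<le> r i" if "i \<le> j" "j < t" for i j
    using hermitian_eigenvalues_length_sorted(3)[OF R that] by (simp add: r_def)
  obtain Q where Q: "Q \<in> carrier_mat t t" "mat_adjoint Q * Q = 1\<^sub>m t" "Q * mat_adjoint Q = 1\<^sub>m t"
    "R = Q * real_diag t r * mat_adjoint Q"
    using hermitian_diagonalisation[OF R] unfolding r_def by metis
  have aQ: "mat_adjoint Q \<in> carrier_mat t t" and aW: "mat_adjoint W \<in> carrier_mat t n"
    using Q(1) W by auto
  define D where "D = real_diag t (\<lambda>i. 1 / sqrt (r i))"
  define E where "E = real_diag t (\<lambda>i. sqrt (r i))"
  have D: "D \<in> carrier_mat t t" "mat_adjoint D = D" and E: "E \<in> carrier_mat t t"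
    unfolding D_def E_def by (rule mat_diag_dim adjoint_real_diag)+
  have diag_cong: "mat_diag t f = mat_diag t g" if "\<And>i. i < t \<Longrightarrow> f i = g i" for f g :: "nat \<Rightarrow> complex"
    using that by (intro eq_matI) (auto simp: mat_diag_def)
  have DE: "D * E = 1\<^sub>m t"
    unfolding D_def E_def mat_diag_diag mat_diag_one[symmetric]
  proof (rule diag_cong)
    fix i assume "i < t"
    then have "0 < r i" using r1 by force
    then have "1 / sqrt (r i) * sqrt (r i) = 1" by simp
    then show "complex_of_real (1 / sqrt (r i)) * complex_of_real (sqrt (r i)) = 1"
      by (simp only: of_real_mult[symmetric] of_real_1)
  qed
  have DrD: "D * real_diag t r * D = 1\<^sub>m t"
    unfolding D_def mat_diag_diag mat_diag_one[symmetric]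
  proof (rule diag_cong)
    fix i assume "i < t"
    then have "0 < r i" using r1 by force
    then have "1 / sqrt (r i) * r i * (1 / sqrt (r i)) = 1"
      by (simp add: field_simps)
    then show "complex_of_real (1 / sqrt (r i)) * complex_of_real (r i) * complex_of_real (1 / sqrt (r i)) = 1"
      by (simp only: of_real_mult[symmetric] of_real_1)
  qed
  define V where "V = W * (Q * D)"
  have QD: "Q * D \<in> carrier_mat t t" using Q(1) D(1) by simp
  have aQD: "mat_adjoint (Q * D) = D * mat_adjoint Q"
    using mat_adjoint_mult[OF Q(1) D(1)] D(2) by simp
  have V: "V \<in> carrier_mat n t" unfolding V_def using mult_carrier_mat[OF W QD] .
  have aV: "mat_adjoint V = D * mat_adjoint Q * mat_adjoint W"
    unfolding V_def using mat_adjoint_mult[OF W QD] aQD by simp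
  have DaQ: "D * mat_adjoint Q \<in> carrier_mat t t" using D(1) aQ by simp
  have QR: "mat_adjoint Q * R * Q = real_diag t r"
  proof -
    have "mat_adjoint Q * R = mat_adjoint Q * Q * real_diag t r * mat_adjoint Q"
      unfolding Q(4)
      by (simp add: assoc_mult_mat[OF aQ Q(1) mat_diag_dim]
          assoc_mult_mat[OF aQ mult_carrier_mat[OF Q(1) mat_diag_dim] aQ, symmetric])
    then have "mat_adjoint Q * R = real_diag t r * mat_adjoint Q"
      using Q(2) left_mult_one_mat[OF mat_diag_dim[of t "\<lambda>i. complex_of_real (r i)"]] by simp
    then show ?thesis
      using assoc_mult_mat[OF mat_diag_dim aQ Q(1)] Q(2) right_mult_one_mat[OF mat_diag_dim[of t "\<lambda>i. complex_of_real (r i)"]] by simp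
  qed
  have VV: "mat_adjoint V * V = 1\<^sub>m t"
  proof -
    have "mat_adjoint V * V = D * mat_adjoint Q * (R * (Q * D))"
      unfolding aV unfolding V_def R_def
      using assoc_mult_mat[OF DaQ aW mult_carrier_mat[OF W QD]] assoc_mult_mat[OF aW W QD] by simp
    also have "\<dots> = D * (mat_adjoint Q * R * Q * D)"
      using assoc_mult_mat[OF D(1) aQ mult_carrier_mat[OF R(1) QD]]
        assoc_mult_mat[OF aQ R(1) QD] assoc_mult_mat[OF mult_carrier_mat[OF aQ R(1)] Q(1) D(1)] by simp
    also have "\<dots> = 1\<^sub>m t"
      unfolding QR using DrD assoc_mult_mat[OF D(1) mat_diag_dim D(1)] by simp
    finally show ?thesis .
  qed
  have span: "cspan n (set (cols V)) = cspan n (set (cols W))"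
  proof -
    have "W = V * (E * mat_adjoint Q)"
    proof -
      have EaQ: "E * mat_adjoint Q \<in> carrier_mat t t" using E aQ by simp
      have "Q * D * (E * mat_adjoint Q) = 1\<^sub>m t"
        using assoc_mult_mat[OF Q(1) D(1) EaQ] assoc_mult_mat[OF D(1) E aQ] DE
          left_mult_one_mat[OF aQ] Q(3) by simp
      then show ?thesis
        unfolding V_def using assoc_mult_mat[OF W QD EaQ] right_mult_one_mat[OF W] by simp
    qed
    then have W_V: "W *\<^sub>v v = V *\<^sub>v ((E * mat_adjoint Q) *\<^sub>v v)" if "v \<in> carrier_vec t" for v
      using assoc_mult_mat_vec[OF V mult_carrier_mat[OF E aQ] that] by metis
    have V_W: "V *\<^sub>v v = W *\<^sub>v ((Q * D) *\<^sub>v v)" if "v \<in> carrier_vec t" for v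
      unfolding V_def using assoc_mult_mat_vec[OF W QD that] .
    show ?thesis
      unfolding cspan_cols_eq[OF V] cspan_cols_eq[OF W]
      using W_V V_W mult_mat_vec_carrier[OF QD] mult_mat_vec_carrier[OF mult_carrier_mat[OF E aQ]]
      by blast
  qed
  have V_onb: "orthonormal_basis_mat n (cspan n (set (cols W))) V"
    unfolding orthonormal_basis_mat_def using V VV span by simp
  define G where "G = mat_adjoint (mat_adjoint V * U) * (mat_adjoint V * U)"
  have "mat_adjoint V * U = D * mat_adjoint Q"
    unfolding aV using assoc_mult_mat[OF DaQ aW U(1)] adjoint_UW right_mult_one_mat[OF DaQ] by simp
  then have "G = Q * D * (D * mat_adjoint Q)"
    unfolding G_def using mat_adjoint_mult[OF D(1) aQ] D(2) by simp
  also have "\<dots> = Q * (D * D) * mat_adjoint Q"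
    using assoc_mult_mat[OF QD D(1) aQ] assoc_mult_mat[OF Q(1) D(1) D(1)] by simp
  also have "D * D = real_diag t (\<lambda>i. 1 / r i)"
    unfolding D_def mat_diag_diag
  proof (rule diag_cong)
    fix i assume "i < t"
    then have "0 < r i" using r1 by force
    then have "1 / sqrt (r i) * (1 / sqrt (r i)) = 1 / r i" by (simp add: field_simps)
    then show "complex_of_real (1 / sqrt (r i)) * complex_of_real (1 / sqrt (r i)) = complex_of_real (1 / r i)"
      by (simp only: of_real_mult[symmetric])
  qed
  finally have G: "G = Q * real_diag t (\<lambda>i. 1 / r i) * mat_adjoint Q" .
  note eG = hermitian_eigenvalues_diag[OF Q(1-3) G]
  have "sorted (map (\<lambda>i. 1 / r i) [0..<t])"
    using rdec r1 by (force simp: sorted_iff_nth_mono intro!: divide_left_mono mult_pos_pos)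
  then have "rev (hermitian_eigenvalues G) = map (\<lambda>i. 1 / r i) [0..<t]"
    using eG(1,2) by (metis mset_rev properties_for_sort)
  then have G_nth: "hermitian_eigenvalues G ! (t - 1 - l) = 1 / r l" if "l < t" for l
    using that eG(3) rev_nth[of l "hermitian_eigenvalues G"] by simp
  have "map tan (principal_angles n (cspan n (set (cols U))) (cspan n (set (cols W))))
    = map (\<lambda>l. tan (arccos (sqrt (hermitian_eigenvalues G ! (t - 1 - l))))) [0..<t]"
    unfolding principal_angles_gram[OF U_onb U(1) V_onb V order.refl] G_def by simp
  also have "\<dots> = map (\<lambda>l. sqrt (r l - 1)) [0..<t]"
  proof (rule map_cong[OF refl])
    fix l assume "l \<in> set [0..<t]"
    then have l: "l < t" by simp
    show "tan (arccos (sqrt (hermitian_eigenvalues G ! (t - 1 - l)))) = sqrt (r l - 1)"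
      unfolding G_nth[OF l] using r1[OF l] by (subst tan_arccos_sqrt) auto
  qed
  finally show ?thesis unfolding r_def R_def .
qed

text \<open>For an orthonormal basis \<open>V\<close> of \<open>T\<close>, duality and the Cauchy-Schwarz inequality give
  \<open>|a|\<^sup>4 \<le> |V\<^sup>H U a|\<^sup>2 * |W a|\<^sup>2\<close>. Min-max then bounds the squared cosine from below by \<open>1 / r\<close> for the
  corresponding eigenvalue \<open>r\<close> of \<open>W\<^sup>H W\<close>.\<close>

lemma tan_principal_angles_le:
  assumes T: "csubspace n T" and sub: "cspan n (set (cols W)) \<subseteq> T"
  shows "length (principal_angles n (cspan n (set (cols U))) T) = t"
    and "\<And>l. l < t \<Longrightarrow> tan (principal_angles n (cspan n (set (cols U))) T ! l)
      \<le> sqrt (hermitian_eigenvalues (mat_adjoint W * W) ! l - 1)"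
proof -
  define R where "R = mat_adjoint W * W"
  have R: "R \<in> carrier_mat t t" "hermitian R"
    using gram_carrier hermitian_gram[OF W] by (auto simp: R_def)
  obtain V where V_onb: "orthonormal_basis_mat n T V"
    using orthonormal_basis_mat_exists[OF T] by blast
  define r where "r = dim_col V"
  have V: "V \<in> carrier_mat n r" "mat_adjoint V * V = 1\<^sub>m r" "cspan n (set (cols V)) = T"
    using V_onb unfolding orthonormal_basis_mat_def r_def by auto
  obtain Z where Z: "Z \<in> carrier_mat r t" "W = V * Z"
    using cspan_cols_factor[OF V(1) W] sub V(3) by auto
  have aV: "mat_adjoint V \<in> carrier_mat r n" and aU: "mat_adjoint U \<in> carrier_mat t n" using V(1) U(1) by auto
  have VU: "mat_adjoint V * U \<in> carrier_mat r t" using aV U(1) by simp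
  define G where "G = mat_adjoint (mat_adjoint V * U) * (mat_adjoint V * U)"
  have G: "G \<in> carrier_mat t t" "hermitian G"
    using adjoint_mult_carrier[OF VU VU] hermitian_gram[OF VU] by (auto simp: G_def)
  have hG: "hform G a = nsq (mat_adjoint V *\<^sub>v (U *\<^sub>v a))" if "a \<in> carrier_vec t" for a
    unfolding G_def hform_gram[OF VU that] using assoc_mult_mat_vec[OF aV U(1) that] by simp
  have hR: "hform R a = nsq (W *\<^sub>v a)" if "a \<in> carrier_vec t" for a
    unfolding R_def by (rule hform_gram[OF W that])
  have key: "(nsq a)\<^sup>2 \<le> hform G a * hform R a" if a: "a \<in> carrier_vec t" for a
  proof (cases "a = 0\<^sub>v t")
    case False
    have Ua: "U *\<^sub>v a \<in> carrier_vec n" and Za: "Z *\<^sub>v a \<in> carrier_vec r" and Wa: "W *\<^sub>v a \<in> carrier_vec n"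
      using mult_mat_vec_carrier U(1) Z(1) W a by auto
    have VZ: "V *\<^sub>v (Z *\<^sub>v a) = W *\<^sub>v a"
      unfolding Z(2) using assoc_mult_mat_vec[OF V(1) Z(1) a] by simp
    have vu: "mat_adjoint V *\<^sub>v (U *\<^sub>v a) \<in> carrier_vec r" using mult_mat_vec_carrier[OF aV Ua] .
    have nZ: "nsq (Z *\<^sub>v a) = nsq (W *\<^sub>v a)"
      using nsq_isometry[OF V(1,2) Za] VZ by simp
    have "(mat_adjoint V *\<^sub>v (U *\<^sub>v a)) \<bullet>c (Z *\<^sub>v a) = (U *\<^sub>v a) \<bullet>c (W *\<^sub>v a)"
      using inner_adjoint[OF aV Ua Za] VZ by simp
    also have "\<dots> = a \<bullet>c (mat_adjoint U *\<^sub>v (W *\<^sub>v a))"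
      by (rule inner_adjoint[OF U(1) a Wa])
    also have "mat_adjoint U *\<^sub>v (W *\<^sub>v a) = a"
      using assoc_mult_mat_vec[OF aU W a] UW a by simp
    finally have ip: "(mat_adjoint V *\<^sub>v (U *\<^sub>v a)) \<bullet>c (Z *\<^sub>v a) = complex_of_real (nsq a)"
      by (simp add: inner_self)
    have w: "0 < nsq (W *\<^sub>v a)"
      using nsq_pos[OF a False] nsq_le_dual[OF a] by simp
    \<comment> \<open>the value of \<open>s\<close> that minimises the distance of \<open>V\<^sup>H U a\<close> from the multiples of \<open>Z a\<close>\<close>
    define s where "s = nsq a / nsq (W *\<^sub>v a)"
    have "0 \<le> hform G a - 2 * s * nsq a + s\<^sup>2 * nsq (W *\<^sub>v a)"
      using nsq_diff_scaled[OF vu Za, of s]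
        nsq_nonneg[of "mat_adjoint V *\<^sub>v (U *\<^sub>v a) - complex_of_real s \<cdot>\<^sub>v (Z *\<^sub>v a)"]
      by (simp add: ip nZ hG[OF a])
    also have "\<dots> = hform G a - (nsq a)\<^sup>2 / nsq (W *\<^sub>v a)"
      using w by (simp add: s_def field_simps power2_eq_square)
    finally show ?thesis using w by (simp add: hR[OF a] field_simps)
  next
    case True
    have "0 \<le> hform G a * hform R a" unfolding hG[OF a] hR[OF a] by simp
    then show ?thesis using True by simp
  qed
  have tr: "t \<le> r"
  proof (rule ccontr)
    assume "\<not> t \<le> r"
    then obtain a where a: "a \<in> carrier_vec t" "a \<noteq> 0\<^sub>v t" "(mat_adjoint V * U) *\<^sub>v a = 0\<^sub>v r"
      using underdetermined_kernel[OF VU] by auto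
    have "hform G a = 0"
      unfolding G_def hform_gram[OF VU a(1)] a(3) by simp
    then show False using key[OF a(1)] nsq_pos[OF a(1,2)] by simp
  qed
  note pa = principal_angles_gram[OF U_onb U(1) V_onb V(1) tr, folded G_def]
  show "length (principal_angles n (cspan n (set (cols U))) T) = t"
    unfolding pa by simp
  fix l assume l: "l < t"
  define c where "c = hermitian_eigenvalues G ! (t - 1 - l)"
  define e where "e = hermitian_eigenvalues R ! l"
  have e1: "1 \<le> e" unfolding e_def R_def by (rule dual_gram_eigenvalue_ge_1[OF l])
  have l': "t - 1 - l < t" "t - 1 - (t - 1 - l) = l" using l by auto
  obtain v where v: "v \<in> carrier_vec t" "v \<noteq> 0\<^sub>v t" "hform R v \<le> e * nsq v" "hform G v \<le> c * nsq v"
    using eigen_test_vector_low[OF G R one_carrier_mat l'(1) l'(1)] unfolding l'(2) c_def e_def by auto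
  have nv: "0 < nsq v" by (rule nsq_pos[OF v(1,2)])
  have G0: "0 \<le> hform G v" using hG[OF v(1)] by simp
  have "(nsq v)\<^sup>2 \<le> hform G v * hform R v" by (rule key[OF v(1)])
  also have "\<dots> \<le> (c * nsq v) * (e * nsq v)"
    by (rule mult_mono[OF v(4,3)]) (use v(4) G0 hR[OF v(1)] in auto)
  finally have "(nsq v)\<^sup>2 * 1 \<le> (nsq v)\<^sup>2 * (c * e)" by (simp add: power2_eq_square mult_ac)
  then have ce: "1 \<le> c * e" using nv by (subst (asm) mult_le_cancel_left_pos) auto
  then have c0: "0 < c" using e1 by (cases "0 < c") (auto simp: not_less dest: mult_nonpos_nonneg[of c e])
  have c1: "c \<le> 1" unfolding c_def
  proof (rule eigenvalue_le[OF G _ l'(1)])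
    fix a :: "complex vec" assume a: "a \<in> carrier_vec t"
    have "nsq (mat_adjoint V *\<^sub>v (U *\<^sub>v a)) \<le> nsq (U *\<^sub>v a)"
      by (rule bessel[OF V(1,2) mult_mat_vec_carrier[OF U(1) a]])
    then show "hform G a \<le> 1 * nsq a" using hG[OF a] nsq_isometry[OF U a] by simp
  qed
  have "principal_angles n (cspan n (set (cols U))) T ! l = arccos (sqrt c)"
    unfolding pa c_def using l by simp
  then have "tan (principal_angles n (cspan n (set (cols U))) T ! l) = sqrt (1 / c - 1)"
    using tan_arccos_sqrt[OF c0 c1] by simp
  also have "\<dots> \<le> sqrt (e - 1)"
    using ce c0 by (simp add: field_simps)
  finally show "tan (principal_angles n (cspan n (set (cols U))) T ! l)
      \<le> sqrt (hermitian_eigenvalues (mat_adjoint W * W) ! l - 1)"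
    unfolding e_def R_def .
qed

end

text \<open>The cosine of the largest angle is positive, so the Gram matrix of \<open>V\<^sup>H U\<close> has only positive
  eigenvalues and a nonzero determinant.\<close>

lemma max_angle_imp_invertible:
  assumes U: "orthonormal_basis_mat n S U" "U \<in> carrier_mat n p"
    and V: "orthonormal_basis_mat n T V" "V \<in> carrier_mat n p"
    and p: "1 \<le> p" and angle: "max_angle n S T < pi / 2"
  obtains C where "C \<in> carrier_mat p p" "mat_adjoint U * V * C = 1\<^sub>m p" "C * (mat_adjoint U * V) = 1\<^sub>m p"
proof -
  define B where "B = mat_adjoint V * U"
  define G where "G = mat_adjoint B * B"
  have B: "B \<in> carrier_mat p p" 
    unfolding B_def by (rule adjoint_mult_carrier[OF V(2) U(2)])
  have aB: "mat_adjoint B \<in> carrier_mat p p" using B by simp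
  have G: "G \<in> carrier_mat p p" "hermitian G"
    using B hermitian_gram[OF B] by (auto simp: G_def)
  let ?c = "\<lambda>l. hermitian_eigenvalues G ! l"
  have "max_angle n S T = arccos (sqrt (?c (p - 1)))"
    unfolding max_angle_def principal_angles_gram[OF U V order.refl] G_def B_def
    using p by (simp add: upt_conv_Cons)
  then have "?c (p - 1) \<noteq> 0" using angle by auto
  moreover have "0 \<le> ?c (p - 1)"
    by (rule eigenvalue_ge[OF G]) (use p in \<open>auto simp: G_def hform_gram[OF B]\<close>)
  ultimately have "0 < ?c (p - 1)" by simp
  then have pos: "0 < ?c l" if "l < p" for l
    using hermitian_eigenvalues_length_sorted(3)[OF G, of l "p - 1"] that by force
  have "(\<Prod>l<p. ?c l) > 0" using pos by (intro prod_pos) auto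
  then have "det G \<noteq> 0"
    unfolding det_eq_prod_eigenvalues[OF G] by (metis less_irrefl of_real_eq_0_iff)
  then have "det (mat_adjoint B) \<noteq> 0" unfolding G_def det_mult[OF aB B] by simp
  then have "mat_adjoint B \<in> Units (ring_mat TYPE(complex) p ())"
    by (rule det_non_zero_imp_unit[OF aB])
  moreover have "mat_adjoint B = mat_adjoint U * V"
    unfolding B_def using mat_adjoint_mult[OF mat_adjoint_carrier[OF V(2)] U(2)] by simp
  ultimately show thesis
    using that unfolding Units_def ring_mat_def by auto
qed

section \<open>Chebyshev polynomials and the block Krylov space\<close>

lemma cheb_poly_cosh: "poly (cheb_poly m) (cosh t) = cosh (real m * t)"
proof (induction m rule: cheb_poly.induct)
  case (3 m)
  have "cosh (real (Suc (Suc m)) * t) = cosh (real (Suc m) * t + t)"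
    and "cosh (real m * t) = cosh (real (Suc m) * t - t)"
    by (simp_all add: algebra_simps)
  then have "cosh (real (Suc (Suc m)) * t) = 2 * cosh t * cosh (real (Suc m) * t) - cosh (real m * t)"
    by (simp add: cosh_add cosh_diff)
  with 3 show ?case by simp
qed simp_all

text \<open>On the half-line from \<open>1\<close> the polynomial is \<open>cosh (m * arcosh x)\<close>.\<close>

lemma cheb_poly_mono_ge_1:
  assumes "1 \<le> x" "x \<le> y"
  shows "poly (cheb_poly m) x \<le> poly (cheb_poly m) y"
proof -
  have nonneg: "0 \<le> arcosh x" "0 \<le> arcosh y" and cosh: "cosh (arcosh x) = x" "cosh (arcosh y) = y"
    using assms by auto
  then have "arcosh x \<le> arcosh y"
    using cosh_real_nonneg_le_iff[OF nonneg] assms by simp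
  then have "cosh (real m * arcosh x) \<le> cosh (real m * arcosh y)"
    using nonneg by (subst cosh_real_nonneg_le_iff) (auto intro: mult_left_mono)
  then show ?thesis
    using cheb_poly_cosh[of m "arcosh x"] cheb_poly_cosh[of m "arcosh y"] cosh by simp
qed

lemma cheb_poly_ge_1:
  assumes "1 \<le> x"
  shows "1 \<le> poly (cheb_poly m) x"
  using cheb_poly_mono_ge_1[of 1 x m] assms cheb_poly_cosh[of m 0] by simp

lemma cheb_poly_abs_le_1:
  assumes "\<bar>x\<bar> \<le> 1"
  shows "\<bar>poly (cheb_poly m) x\<bar> \<le> 1"
  using cheb_poly_cos[of m "arccos x"] assms by (simp add: cos_arccos abs_le_iff)

lemma degree_cheb_poly: "degree (cheb_poly m) \<le> m"
proof (induction m rule: cheb_poly.induct)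
  case (3 m)
  have "degree ([:0, 2:] * cheb_poly (Suc m)) \<le> degree [:0, 2 :: real:] + degree (cheb_poly (Suc m))"
    by (rule degree_mult_le)
  also have "\<dots> \<le> Suc (Suc m)" using 3 by simp
  finally show ?case using 3 by (auto intro!: degree_diff_le simp del: mult_pCons_left)
qed simp_all

lemma csubspaceD:
  assumes "csubspace n S"
  shows "S \<subseteq> carrier_vec n" "0\<^sub>v n \<in> S"
    and "\<And>v w. v \<in> S \<Longrightarrow> w \<in> S \<Longrightarrow> v + w \<in> S" "\<And>c v. v \<in> S \<Longrightarrow> c \<cdot>\<^sub>v v \<in> S"
proof -
  interpret vec_space "TYPE(complex)" n .
  show "S \<subseteq> carrier_vec n" "0\<^sub>v n \<in> S"
    and "\<And>v w. v \<in> S \<Longrightarrow> w \<in> S \<Longrightarrow> v + w \<in> S" "\<And>c v. v \<in> S \<Longrightarrow> c \<cdot>\<^sub>v v \<in> S"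
    using assms unfolding subspace_def submodule_def by (auto simp: class_field_def)
qed

lemma cspan_subset:
  fixes W :: "complex mat"
  assumes S: "csubspace n S" and W: "W \<in> carrier_mat n t" and cols: "\<And>j. j < t \<Longrightarrow> col W j \<in> S"
  shows "cspan n (set (cols W)) \<subseteq> S"
proof -
  interpret vec_space "TYPE(complex)" n .
  have "set (cols W) \<subseteq> S" using cols W by (auto simp: cols_def)
  moreover have "submodule class_ring S V"
    using S unfolding subspace_def by auto
  ultimately show ?thesis by (rule span_is_subset)
qed

lemma pow_mat_vec_Suc:
  fixes A :: "complex mat"
  assumes A: "A \<in> carrier_mat n n" and v: "v \<in> carrier_vec n"
  shows "(A ^\<^sub>m Suc j) *\<^sub>v v = (A ^\<^sub>m j) *\<^sub>v (A *\<^sub>v v)"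
  using assoc_mult_mat_vec[OF pow_carrier_mat[OF A] A v, of j] by simp

lemma inner_pow_eigenvector:
  fixes A :: "complex mat"
  assumes A: "A \<in> carrier_mat n n" "hermitian A"
    and x: "x \<in> carrier_vec n" "A *\<^sub>v x = complex_of_real l \<cdot>\<^sub>v x"
    and v: "v \<in> carrier_vec n"
  shows "((A ^\<^sub>m j) *\<^sub>v v) \<bullet>c x = complex_of_real (l ^ j) * (v \<bullet>c x)"
  using v
proof (induction j arbitrary: v)
  case 0
  then show ?case using A by simp
next
  case (Suc j)
  have Av: "A *\<^sub>v v \<in> carrier_vec n" using mult_mat_vec_carrier[OF A(1) Suc.prems] .
  have "((A ^\<^sub>m Suc j) *\<^sub>v v) \<bullet>c x = complex_of_real (l ^ j) * ((A *\<^sub>v v) \<bullet>c x)"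
    unfolding pow_mat_vec_Suc[OF A(1) Suc.prems] by (rule Suc.IH[OF Av])
  also have "(A *\<^sub>v v) \<bullet>c x = v \<bullet>c (complex_of_real l \<cdot>\<^sub>v x)"
    using inner_adjoint[OF A(1) Suc.prems x(1)] A(2) x(2) unfolding hermitian_def by simp
  also have "\<dots> = complex_of_real l * (v \<bullet>c x)"
    using inner_smult(2)[OF Suc.prems x(1)] by simp
  finally show ?case by (simp add: mult_ac)
qed

context
  fixes n k :: nat and A :: "complex mat" and S :: "complex vec set"
  assumes A: "A \<in> carrier_mat n n" and S: "csubspace n S"
begin

lemma krylov_term_carrier:
  assumes "\<forall>j<k. v j \<in> S"
  shows "(\<lambda>j. (A ^\<^sub>m j) *\<^sub>v v j) \<in> {..<k} \<rightarrow> carrier_vec n"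
proof (rule Pi_I)
  fix j assume "j \<in> {..<k}"
  then have "v j \<in> S" using assms by simp
  then have vj: "v j \<in> carrier_vec n" using subsetD[OF csubspaceD(1)[OF S]] by simp
  show "(A ^\<^sub>m j) *\<^sub>v v j \<in> carrier_vec n"
    by (rule mult_mat_vec_carrier[OF pow_carrier_mat[OF A] vj])
qed

lemma krylov_sum_index:
  assumes "\<forall>j<k. v j \<in> S" "i < n"
  shows "finsum_vec TYPE(complex) n (\<lambda>j. (A ^\<^sub>m j) *\<^sub>v v j) {..<k} $ i = (\<Sum>j<k. ((A ^\<^sub>m j) *\<^sub>v v j) $ i)"
  by (rule index_finsum_vec[OF _ assms(2) krylov_term_carrier[OF assms(1)]]) simp

lemma krylov_sum_carrier:
  assumes "\<forall>j<k. v j \<in> S"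
  shows "finsum_vec TYPE(complex) n (\<lambda>j. (A ^\<^sub>m j) *\<^sub>v v j) {..<k} \<in> carrier_vec n"
  by (rule finsum_vec_closed[OF krylov_term_carrier[OF assms]])

lemma csubspace_block_krylov: "csubspace n (block_krylov n A S k)"
proof (rule csubspaceI)
  let ?f = "\<lambda>v. finsum_vec TYPE(complex) n (\<lambda>j. (A ^\<^sub>m j) *\<^sub>v v j) {..<k}"
  have Sc: "S \<subseteq> carrier_vec n" by (rule csubspaceD(1)[OF S])
  have pow: "A ^\<^sub>m j \<in> carrier_mat n n" for j by (rule pow_carrier_mat[OF A])
  have memI: "?f v \<in> block_krylov n A S k" if "\<forall>j<k. v j \<in> S" for v
    unfolding block_krylov_def using that by blast
  show "block_krylov n A S k \<subseteq> carrier_vec n"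
    unfolding block_krylov_def using krylov_sum_carrier by blast
  have "?f (\<lambda>j. 0\<^sub>v n) = 0\<^sub>v n"
  proof (rule eq_vecI)
    fix i assume "i < dim_vec (0\<^sub>v n :: complex vec)"
    then have i: "i < n" by simp
    show "?f (\<lambda>j. 0\<^sub>v n) $ i = 0\<^sub>v n $ i"
    proof -
      have "((A ^\<^sub>m j) *\<^sub>v 0\<^sub>v n) $ i = 0" for j
        unfolding mat_vec_sum[OF pow zero_carrier_vec i] by simp
      then show ?thesis
        using krylov_sum_index[OF _ i, of "\<lambda>j. 0\<^sub>v n"] csubspaceD(2)[OF S] i
        by (simp del: index_mult_mat_vec)
    qed
  qed (use krylov_sum_carrier[of "\<lambda>j. 0\<^sub>v n"] csubspaceD(2)[OF S] in simp)
  then show "0\<^sub>v n \<in> block_krylov n A S k"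
    using memI[of "\<lambda>j. 0\<^sub>v n"] csubspaceD(2)[OF S] by simp
  fix a assume "a \<in> block_krylov n A S k"
  then obtain v where v: "\<forall>j<k. v j \<in> S" "a = ?f v" unfolding block_krylov_def by blast
  have vc: "v j \<in> carrier_vec n" if "j < k" for j using v(1) that Sc by blast
  {
    fix b assume "b \<in> block_krylov n A S k"
    then obtain w where w: "\<forall>j<k. w j \<in> S" "b = ?f w" unfolding block_krylov_def by blast
    have wc: "w j \<in> carrier_vec n" if "j < k" for j using w(1) that Sc by blast
    have vw: "\<forall>j<k. v j + w j \<in> S" using v(1) w(1) csubspaceD(3)[OF S] by blast
    have "a + b = ?f (\<lambda>j. v j + w j)"
    proof (rule eq_vecI)
      fix i assume "i < dim_vec (?f (\<lambda>j. v j + w j))"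
      then have i: "i < n" using krylov_sum_carrier[OF vw] by simp
      have "((A ^\<^sub>m j) *\<^sub>v (v j + w j)) $ i = ((A ^\<^sub>m j) *\<^sub>v v j) $ i + ((A ^\<^sub>m j) *\<^sub>v w j) $ i" if "j < k" for j
        unfolding mult_add_distrib_mat_vec[OF pow vc[OF that] wc[OF that]]
        by (rule index_add_vec(1)) (simp add: carrier_matD(1)[OF A] i)
      then have "(\<Sum>j<k. ((A ^\<^sub>m j) *\<^sub>v (v j + w j)) $ i)
          = (\<Sum>j<k. ((A ^\<^sub>m j) *\<^sub>v v j) $ i) + (\<Sum>j<k. ((A ^\<^sub>m j) *\<^sub>v w j) $ i)"
        unfolding sum.distrib[symmetric] by (intro sum.cong refl) simp_all
      moreover have "(a + b) $ i = a $ i + b $ i"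
        by (rule index_add_vec(1)) (use krylov_sum_carrier[OF w(1)] w(2) i in simp)
      ultimately show "(a + b) $ i = ?f (\<lambda>j. v j + w j) $ i"
        unfolding krylov_sum_index[OF vw i] v(2) w(2) krylov_sum_index[OF v(1) i] krylov_sum_index[OF w(1) i]
        by simp
    qed (use krylov_sum_carrier[OF vw] krylov_sum_carrier[OF w(1)] w(2) in simp)
    then show "a + b \<in> block_krylov n A S k" using memI[OF vw] by simp
  }
  fix c :: complex
  have cv: "\<forall>j<k. c \<cdot>\<^sub>v v j \<in> S" using v(1) csubspaceD(4)[OF S] by blast
  have "c \<cdot>\<^sub>v a = ?f (\<lambda>j. c \<cdot>\<^sub>v v j)"
  proof (rule eq_vecI)
    fix i assume "i < dim_vec (?f (\<lambda>j. c \<cdot>\<^sub>v v j))"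
    then have i: "i < n" using krylov_sum_carrier[OF cv] by simp
    have "((A ^\<^sub>m j) *\<^sub>v (c \<cdot>\<^sub>v v j)) $ i = c * ((A ^\<^sub>m j) *\<^sub>v v j) $ i" if "j < k" for j
      unfolding mult_mat_vec[OF pow vc[OF that]]
      by (rule index_smult_vec(1)) (simp add: carrier_matD(1)[OF A] i)
    then have "(\<Sum>j<k. ((A ^\<^sub>m j) *\<^sub>v (c \<cdot>\<^sub>v v j)) $ i) = c * (\<Sum>j<k. ((A ^\<^sub>m j) *\<^sub>v v j) $ i)"
      unfolding sum_distrib_left by (intro sum.cong refl) simp_all
    moreover have "(c \<cdot>\<^sub>v a) $ i = c * a $ i"
      by (rule index_smult_vec(1)) (use krylov_sum_carrier[OF v(1)] v(2) i in simp)
    ultimately show "(c \<cdot>\<^sub>v a) $ i = ?f (\<lambda>j. c \<cdot>\<^sub>v v j) $ i"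
      unfolding krylov_sum_index[OF cv i] v(2) krylov_sum_index[OF v(1) i] by simp
  qed (use krylov_sum_carrier[OF cv] krylov_sum_carrier[OF v(1)] v(2) in simp)
  then show "c \<cdot>\<^sub>v a \<in> block_krylov n A S k" using memI[OF cv] by simp
qed

text \<open>The vector is \<open>f(A) y\<close>. For Hermitian \<open>A\<close>, an eigenvector with eigenvalue \<open>l\<close> turns \<open>f(A)\<close>
  into the factor \<open>f(l)\<close>.\<close>

lemma polynomial_in_block_krylov:
  fixes f :: "real poly"
  assumes h: "hermitian A" and f: "degree f < k" and y: "y \<in> S"
  obtains w where "w \<in> block_krylov n A S k"
    "\<And>x l. x \<in> carrier_vec n \<Longrightarrow> A *\<^sub>v x = complex_of_real l \<cdot>\<^sub>v x
      \<Longrightarrow> w \<bullet>c x = complex_of_real (poly f l) * (y \<bullet>c x)"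
proof
  define v where "v j = complex_of_real (coeff f j) \<cdot>\<^sub>v y" for j
  have v: "\<forall>j<k. v j \<in> S" using y csubspaceD(4)[OF S] by (simp add: v_def)
  define w where "w = finsum_vec TYPE(complex) n (\<lambda>j. (A ^\<^sub>m j) *\<^sub>v v j) {..<k}"
  have yc: "y \<in> carrier_vec n" using y csubspaceD(1)[OF S] by blast
  have wc: "w \<in> carrier_vec n" unfolding w_def by (rule krylov_sum_carrier[OF v])
  show "w \<in> block_krylov n A S k" unfolding block_krylov_def w_def using v by blast
  fix x :: "complex vec" and l
  assume x: "x \<in> carrier_vec n" "A *\<^sub>v x = complex_of_real l \<cdot>\<^sub>v x"
  have vc: "v j \<in> carrier_vec n" for j using yc by (simp add: v_def)
  have pc: "(A ^\<^sub>m j) *\<^sub>v v j \<in> carrier_vec n" for j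
    using mult_mat_vec_carrier[OF pow_carrier_mat[OF A] vc] .
  have "w \<bullet>c x = (\<Sum>i<n. (\<Sum>j<k. ((A ^\<^sub>m j) *\<^sub>v v j) $ i) * cnj (x $ i))"
    unfolding inner_sum[OF wc x(1)] using krylov_sum_index[OF v] by (simp add: w_def del: index_mult_mat_vec)
  also have "\<dots> = (\<Sum>j<k. \<Sum>i<n. ((A ^\<^sub>m j) *\<^sub>v v j) $ i * cnj (x $ i))"
    by (subst sum.swap) (simp add: sum_distrib_right del: index_mult_mat_vec)
  also have "\<dots> = (\<Sum>j<k. ((A ^\<^sub>m j) *\<^sub>v v j) \<bullet>c x)"
    unfolding inner_sum[OF pc x(1)] ..
  also have "\<dots> = (\<Sum>j<k. complex_of_real (coeff f j * l ^ j) * (y \<bullet>c x))"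
    unfolding inner_pow_eigenvector[OF A h x vc]
    by (simp add: v_def inner_smult[OF yc x(1)] mult_ac)
  also have "\<dots> = complex_of_real (\<Sum>j<k. coeff f j * l ^ j) * (y \<bullet>c x)"
    by (simp add: sum_distrib_right)
  also have "(\<Sum>j<k. coeff f j * l ^ j) = (\<Sum>j\<le>degree f. coeff f j * l ^ j)"
    by (rule sum.mono_neutral_right) (use f in \<open>auto simp: coeff_eq_0\<close>)
  also have "\<dots> = poly f l" by (simp add: poly_altdef)
  finally show "w \<bullet>c x = complex_of_real (poly f l) * (y \<bullet>c x)" .
qed

end

section \<open>Dual bases with a damped tail\<close>

text \<open>The list fixes the order of the columns, and with it the order of the entries of the diagonal scalings below.\<close>

definition columns_at :: "nat \<Rightarrow> (nat \<Rightarrow> complex vec) \<Rightarrow> nat list \<Rightarrow> complex mat" where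
  "columns_at n q js = mat_of_cols n (map q js)"

lemma columns_at_carrier [simp]: "columns_at n q js \<in> carrier_mat n (length js)"
  unfolding columns_at_def by (rule mat_of_cols_map)

lemma col_columns_at:
  "j < length js \<Longrightarrow> q (js ! j) \<in> carrier_vec n \<Longrightarrow> col (columns_at n q js) j = q (js ! j)"
  unfolding columns_at_def by (rule col_mat_of_cols_map)

lemma set_cols_columns_at:
  assumes "\<And>i. i \<in> set js \<Longrightarrow> q i \<in> carrier_vec n"
  shows "set (cols (columns_at n q js)) = q ` set js"
  unfolding columns_at_def using assms by (subst cols_mat_of_cols) auto

lemma mult_vec_inner:
  fixes M :: "complex mat"
  assumes M: "M \<in> carrier_mat n t" and v: "v \<in> carrier_vec t" and x: "x \<in> carrier_vec n"
  shows "(M *\<^sub>v v) \<bullet>c x = (\<Sum>j<t. v $ j * (col M j \<bullet>c x))"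
proof -
  have cM: "col M j \<in> carrier_vec n" for j using M by (simp add: carrier_vecI)
  have "(M *\<^sub>v v) \<bullet>c x = (\<Sum>i<n. \<Sum>j<t. v $ j * (M $$ (i, j) * cnj (x $ i)))"
    unfolding inner_sum[OF mult_mat_vec_carrier[OF M v] x]
  proof (rule sum.cong[OF refl])
    fix i assume "i \<in> {..<n}"
    then have "i < n" by simp
    then show "(M *\<^sub>v v) $ i * cnj (x $ i) = (\<Sum>j<t. v $ j * (M $$ (i, j) * cnj (x $ i)))"
      unfolding mat_vec_sum[OF M v \<open>i < n\<close>] sum_distrib_right
      by (intro sum.cong refl) (simp add: mult_ac)
  qed
  also have "\<dots> = (\<Sum>j<t. v $ j * (\<Sum>i<n. M $$ (i, j) * cnj (x $ i)))"
    by (subst sum.swap) (simp add: sum_distrib_left)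
  also have "\<dots> = (\<Sum>j<t. v $ j * (col M j \<bullet>c x))"
    unfolding inner_sum[OF cM x] using M by (intro sum.cong refl) simp
  finally show ?thesis .
qed

text \<open>Exchanging the indices of \<open>J\<close> outside the first \<open>|J|\<close> positions for the missing ones inside only
  increases the terms; the value of \<open>f\<close> at the last of these positions separates the two groups.\<close>

lemma sum_le_sum_first:
  fixes f :: "nat \<Rightarrow> real"
  assumes dec: "\<And>i j. i \<le> j \<Longrightarrow> j < m \<Longrightarrow> f j \<le> f i" and J: "J \<subseteq> {..<m}"
  shows "(\<Sum>j\<in>J. f j) \<le> (\<Sum>l<card J. f l)"
proof -
  let ?k = "card J"
  have fin: "finite J" using J finite_subset by blast
  have k: "?k \<le> m" using card_mono[OF _ J] by simp
  have c: "card (J - {..<?k}) = card ({..<?k} - J)"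
    using card_Diff_subset_Int[of J "{..<?k}"] card_Diff_subset_Int[of "{..<?k}" J] fin
    by (simp add: Int_commute)
  have "(\<Sum>j\<in>J - {..<?k}. f j) \<le> of_nat (card (J - {..<?k})) * f (?k - 1)"
  proof (rule sum_bounded_above)
    fix j assume "j \<in> J - {..<?k}"
    then show "f j \<le> f (?k - 1)" using J by (intro dec) auto
  qed
  also have "\<dots> \<le> (\<Sum>j\<in>{..<?k} - J. f j)"
    unfolding c
  proof (rule sum_bounded_below)
    fix j assume "j \<in> {..<?k} - J"
    then show "f (?k - 1) \<le> f j" using k by (intro dec) auto
  qed
  finally have "(\<Sum>j\<in>J - {..<?k}. f j) + (\<Sum>j\<in>J \<inter> {..<?k}. f j)
      \<le> (\<Sum>j\<in>{..<?k} - J. f j) + (\<Sum>j\<in>J \<inter> {..<?k}. f j)" by simp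
  moreover have "(\<Sum>j\<in>J. f j) = (\<Sum>j\<in>J - {..<?k}. f j) + (\<Sum>j\<in>J \<inter> {..<?k}. f j)"
    using sum.Int_Diff[OF fin, of f "{..<?k}"] by simp
  moreover have "(\<Sum>j<?k. f j) = (\<Sum>j\<in>{..<?k} - J. f j) + (\<Sum>j\<in>J \<inter> {..<?k}. f j)"
    using sum.Int_Diff[of "{..<?k}" f J] by (simp add: Int_commute)
  ultimately show ?thesis by simp
qed

text \<open>What the proof uses of the Krylov space: it contains vectors \<open>w i\<close> that are dual to the \<open>x i\<close>, like
  the \<open>y i\<close>, and whose components along \<open>x l\<close>, \<open>l > p\<close>, arise from those of \<open>y i\<close> by factors
  \<open>\<phi> l * sig i\<close> with \<open>|\<phi> l| \<le> 1\<close>.\<close>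

locale filtered_dual_bases =
  fixes A :: "complex mat" and n p :: nat and lam sig \<phi> :: "nat \<Rightarrow> real"
    and x y w :: "nat \<Rightarrow> complex vec" and K :: "complex vec set"
  assumes A: "A \<in> carrier_mat n n" "hermitian A"
    and lam_antimono: "\<And>i j. 1 \<le> i \<Longrightarrow> i \<le> j \<Longrightarrow> j \<le> n \<Longrightarrow> lam j \<le> lam i"
    and x_carrier: "\<And>i. i \<in> {1..n} \<Longrightarrow> x i \<in> carrier_vec n"
    and x_eigen: "\<And>i. i \<in> {1..n} \<Longrightarrow> A *\<^sub>v x i = complex_of_real (lam i) \<cdot>\<^sub>v x i"
    and x_orthonormal: "\<And>i j. i \<in> {1..n} \<Longrightarrow> j \<in> {1..n} \<Longrightarrow> x j \<bullet>c x i = (if i = j then 1 else 0)"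
    and p: "p < n" and gap: "lam n < lam p"
    and y_carrier: "\<And>i. i \<in> {1..p} \<Longrightarrow> y i \<in> carrier_vec n"
    and y_dual: "\<And>i l. i \<in> {1..p} \<Longrightarrow> l \<in> {1..p} \<Longrightarrow> y i \<bullet>c x l = (if i = l then 1 else 0)"
    and w_in_K: "\<And>i. i \<in> {1..p} \<Longrightarrow> w i \<in> K"
    and w_dual: "\<And>i l. i \<in> {1..p} \<Longrightarrow> l \<in> {1..p} \<Longrightarrow> w i \<bullet>c x l = (if i = l then 1 else 0)"
    and w_tail: "\<And>i l. i \<in> {1..p} \<Longrightarrow> l \<in> {p+1..n}
      \<Longrightarrow> w i \<bullet>c x l = complex_of_real (\<phi> l * sig i) * (y i \<bullet>c x l)"
    and filter_le_1: "\<And>l. l \<in> {p+1..n} \<Longrightarrow> \<bar>\<phi> l\<bar> \<le> 1"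
    and sig_pos: "\<And>i. i \<in> {1..p} \<Longrightarrow> 0 < sig i"
    and sig_mono: "\<And>i j. i \<in> {1..p} \<Longrightarrow> j \<in> {1..p} \<Longrightarrow> i \<le> j \<Longrightarrow> sig i \<le> sig j"
    and K: "csubspace n K"
begin

lemma w_carrier: "i \<in> {1..p} \<Longrightarrow> w i \<in> carrier_vec n"
  using w_in_K csubspaceD(1)[OF K] by blast

lemma parseval:
  assumes u: "u \<in> carrier_vec n" and v: "v \<in> carrier_vec n"
  shows "u \<bullet>c v = (\<Sum>l\<in>{1..n}. (u \<bullet>c x l) * cnj (v \<bullet>c x l))"
proof -
  define B where "B = columns_at n x [1..<n+1]"
  have B: "B \<in> carrier_mat n n" using columns_at_carrier[of n x "[1..<n+1]"] by (simp add: B_def del: upt_Suc)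
  have aB: "mat_adjoint B \<in> carrier_mat n n" using B by simp
  have col: "col B j = x (j + 1)" if "j < n" for j
    using col_columns_at[of j "[1..<n+1]" x n] x_carrier[of "j + 1"] that by (simp add: B_def nth_upt del: upt_Suc)
  have "mat_adjoint B * B = 1\<^sub>m n"
  proof (rule eq_matI)
    fix i j assume "i < dim_row (1\<^sub>m n :: complex mat)" "j < dim_col (1\<^sub>m n :: complex mat)"
    then have ij: "i < n" "j < n" by auto
    show "(mat_adjoint B * B) $$ (i, j) = 1\<^sub>m n $$ (i, j)"
      unfolding adjoint_mult_index[OF B B ij] col[OF ij(1)] col[OF ij(2)]
      using x_orthonormal[of "i + 1" "j + 1"] ij by simp
  qed (use B in auto)
  then have BB: "B * mat_adjoint B = 1\<^sub>m n"
    by (rule mat_mult_left_right_inverse[OF aB B])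
  have au: "mat_adjoint B *\<^sub>v u \<in> carrier_vec n" and av: "mat_adjoint B *\<^sub>v v \<in> carrier_vec n"
    using mult_mat_vec_carrier[OF aB] u v by auto
  have "u \<bullet>c v = u \<bullet>c (B *\<^sub>v (mat_adjoint B *\<^sub>v v))"
    using assoc_mult_mat_vec[OF B aB v] BB v by simp
  also have "\<dots> = (mat_adjoint B *\<^sub>v u) \<bullet>c (mat_adjoint B *\<^sub>v v)"
    using inner_adjoint[OF aB u av] by simp
  also have "\<dots> = (\<Sum>i<n. (u \<bullet>c x (i + 1)) * cnj (v \<bullet>c x (i + 1)))"
    unfolding inner_sum[OF au av]
    by (intro sum.cong refl) (simp add: adjoint_vec_index[OF B u] adjoint_vec_index[OF B v] col del: index_mult_mat_vec)
  also have "\<dots> = (\<Sum>l\<in>{1..n}. (u \<bullet>c x l) * cnj (v \<bullet>c x l))"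
    by (rule sum.reindex_bij_witness[of _ "\<lambda>l. l - 1" "\<lambda>i. i + 1"]) auto
  finally show ?thesis .
qed

lemma nsq_coordinates:
  assumes v: "v \<in> carrier_vec n"
  shows "nsq v = (\<Sum>l\<in>{1..n}. (cmod (v \<bullet>c x l))\<^sup>2)"
proof -
  have "complex_of_real (nsq v) = complex_of_real (\<Sum>l\<in>{1..n}. (cmod (v \<bullet>c x l))\<^sup>2)"
    unfolding inner_self[symmetric] parseval[OF v v] of_real_sum complex_norm_square ..
  then show ?thesis unfolding of_real_eq_iff .
qed

lemma hform_coordinates:
  assumes v: "v \<in> carrier_vec n"
  shows "hform A v = (\<Sum>l\<in>{1..n}. lam l * (cmod (v \<bullet>c x l))\<^sup>2)"
proof -
  have Av: "A *\<^sub>v v \<in> carrier_vec n" using mult_mat_vec_carrier[OF A(1) v] .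
  have e: "(A *\<^sub>v v) \<bullet>c x l = complex_of_real (lam l) * (v \<bullet>c x l)" if l: "l \<in> {1..n}" for l
  proof -
    have "(A *\<^sub>v v) \<bullet>c x l = v \<bullet>c (complex_of_real (lam l) \<cdot>\<^sub>v x l)"
      using inner_adjoint[OF A(1) v x_carrier[OF l]] A(2) x_eigen[OF l] unfolding hermitian_def by simp
    then show ?thesis using inner_smult(2)[OF v x_carrier[OF l]] by simp
  qed
  have "(A *\<^sub>v v) \<bullet>c v = (\<Sum>l\<in>{1..n}. complex_of_real (lam l * (cmod (v \<bullet>c x l))\<^sup>2))"
    unfolding parseval[OF Av v] of_real_mult complex_norm_square
    by (intro sum.cong refl) (simp only: e mult.assoc)
  then show ?thesis unfolding hform_def by (simp add: of_real_sum[symmetric] del: of_real_sum of_real_mult)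
qed

lemma split_sum: "(\<Sum>l\<in>{1..n}. f l) = (\<Sum>l\<in>{1..p}. f l) + (\<Sum>l\<in>{p+1..n}. f l :: real)"
proof -
  have "{1..n} = {1..p} \<union> {p+1..n}" using p by auto
  then show ?thesis by (simp add: sum.union_disjoint)
qed

context
  fixes js :: "nat list"
  assumes js: "set js \<subseteq> {1..p}" "sorted_wrt (>) js"
begin

lemma js_mem:
  assumes "j < length js"
  shows "js ! j \<in> {1..p}" "js ! j \<in> {1..n}"
proof -
  show "js ! j \<in> {1..p}" by (rule subsetD[OF js(1) nth_mem[OF assms]])
  then show "js ! j \<in> {1..n}" using p by simp
qed

lemma js_anti: "i \<le> j \<Longrightarrow> j < length js \<Longrightarrow> js ! j \<le> js ! i"
  using sorted_wrt_nth_less[OF js(2), of i j] by (cases "i = j") auto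

lemma js_inj: "i < length js \<Longrightarrow> j < length js \<Longrightarrow> js ! i = js ! j \<longleftrightarrow> i = j"
  using sorted_wrt_nth_less[OF js(2), of i j] sorted_wrt_nth_less[OF js(2), of j i]
  by (metis less_irrefl linorder_neqE_nat)

lemma distinct_js: "distinct js"
  unfolding distinct_conv_nth using js_inj by blast

lemma length_js_le: "length js \<le> p"
  using card_mono[OF _ js(1)] distinct_card[OF distinct_js] by simp

abbreviation "U \<equiv> columns_at n x js"
abbreviation "Wy \<equiv> columns_at n y js"
abbreviation "Ww \<equiv> columns_at n w js"
abbreviation "t \<equiv> length js"

lemma col_U: "j < t \<Longrightarrow> col U j = x (js ! j)"
  by (rule col_columns_at, assumption, rule x_carrier, rule js_mem(2))

lemma col_Wy: "j < t \<Longrightarrow> col Wy j = y (js ! j)"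
  by (rule col_columns_at, assumption, rule y_carrier, rule js_mem(1))

lemma col_Ww: "j < t \<Longrightarrow> col Ww j = w (js ! j)"
  by (rule col_columns_at, assumption, rule w_carrier, rule js_mem(1))

lemma adjoint_U_mult:
  assumes M: "M \<in> carrier_mat n t"
    and d: "\<And>i j. i < t \<Longrightarrow> j < t \<Longrightarrow> col M j \<bullet>c x (js ! i) = (if js ! j = js ! i then 1 else 0)"
  shows "mat_adjoint U * M = 1\<^sub>m t"
proof (rule eq_matI)
  fix i j assume "i < dim_row (1\<^sub>m t :: complex mat)" "j < dim_col (1\<^sub>m t :: complex mat)"
  then have ij: "i < t" "j < t" by auto
  show "(mat_adjoint U * M) $$ (i, j) = 1\<^sub>m t $$ (i, j)"
    unfolding adjoint_mult_index[OF columns_at_carrier M ij] col_U[OF ij(1)] d[OF ij]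
    using ij js_inj[OF ij] by auto
qed (use M carrier_matD[OF columns_at_carrier[of n x js]] in auto)

lemma Wy_dual: "j < t \<Longrightarrow> l \<in> {1..p} \<Longrightarrow> col Wy j \<bullet>c x l = (if js ! j = l then 1 else 0)"
  unfolding col_Wy by (rule y_dual[OF js_mem(1)])

lemma Ww_dual: "j < t \<Longrightarrow> l \<in> {1..p} \<Longrightarrow> col Ww j \<bullet>c x l = (if js ! j = l then 1 else 0)"
  unfolding col_Ww by (rule w_dual[OF js_mem(1)])

lemma UU: "mat_adjoint U * U = 1\<^sub>m t"
proof (rule adjoint_U_mult[OF columns_at_carrier])
  fix i j assume i: "i < t" and j: "j < t"
  show "col U j \<bullet>c x (js ! i) = (if js ! j = js ! i then 1 else 0)"
    unfolding col_U[OF j] x_orthonormal[OF js_mem(2)[OF i] js_mem(2)[OF j]]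
    by (cases "js ! i = js ! j") simp_all
qed

lemma UWy: "mat_adjoint U * Wy = 1\<^sub>m t"
  by (rule adjoint_U_mult[OF columns_at_carrier]) (rule Wy_dual[OF _ js_mem(1)])

lemma UWw: "mat_adjoint U * Ww = 1\<^sub>m t"
  by (rule adjoint_U_mult[OF columns_at_carrier]) (rule Ww_dual[OF _ js_mem(1)])

text \<open>The first \<open>p\<close> coordinates of \<open>M v\<close> are the entries of \<open>v\<close>, placed at the positions in \<open>js\<close>, and
  zeros. The weights \<open>c\<close> are \<open>1\<close> for norms and \<open>lam l - lam n\<close> for the form of \<open>A\<close>.\<close>

lemma low_coordinates:
  fixes c :: "nat \<Rightarrow> real"
  assumes M: "M \<in> carrier_mat n t"
    and d: "\<And>j l. j < t \<Longrightarrow> l \<in> {1..p} \<Longrightarrow> col M j \<bullet>c x l = (if js ! j = l then 1 else 0)"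
    and v: "v \<in> carrier_vec t"
  shows "(\<Sum>l\<in>{1..p}. c l * (cmod ((M *\<^sub>v v) \<bullet>c x l))\<^sup>2) = (\<Sum>j<t. c (js ! j) * (cmod (v $ j))\<^sup>2)"
proof -
  have ip: "(M *\<^sub>v v) \<bullet>c x l = (\<Sum>j<t. if js ! j = l then v $ j else 0)" if l: "l \<in> {1..p}" for l
  proof -
    have "x l \<in> carrier_vec n" using l p by (intro x_carrier) auto
    then show ?thesis
      unfolding mult_vec_inner[OF M v \<open>x l \<in> carrier_vec n\<close>] by (intro sum.cong refl) (simp add: d[OF _ l])
  qed
  have ip_js: "(M *\<^sub>v v) \<bullet>c x (js ! i) = v $ i" if "i < t" for i
  proof -
    have "(M *\<^sub>v v) \<bullet>c x (js ! i) = (\<Sum>j<t. if j = i then v $ j else 0)"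
      unfolding ip[OF js_mem(1)[OF that]] by (intro sum.cong refl) (simp add: js_inj that)
    then show ?thesis using that by simp
  qed
  have ip0: "(M *\<^sub>v v) \<bullet>c x l = 0" if "l \<in> {1..p} - set js" for l
    using that ip[of l] by (auto intro!: sum.neutral)
  have "(\<Sum>l\<in>{1..p}. c l * (cmod ((M *\<^sub>v v) \<bullet>c x l))\<^sup>2)
      = (\<Sum>l\<in>set js. c l * (cmod ((M *\<^sub>v v) \<bullet>c x l))\<^sup>2)"
    using js(1) ip0 by (intro sum.mono_neutral_right) auto
  also have "\<dots> = (\<Sum>j<t. c (js ! j) * (cmod (v $ j))\<^sup>2)"
  proof (rule sum.reindex_cong[of "\<lambda>j. js ! j"])
    show "inj_on (\<lambda>j. js ! j) {..<t}" using js_inj by (auto intro: inj_onI)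
    show "set js = (\<lambda>j. js ! j) ` {..<t}" by (auto simp: set_conv_nth)
  qed (simp add: ip_js)
  finally show ?thesis .
qed

lemma nsq_dual_split:
  assumes M: "M \<in> carrier_mat n t"
    and d: "\<And>j l. j < t \<Longrightarrow> l \<in> {1..p} \<Longrightarrow> col M j \<bullet>c x l = (if js ! j = l then 1 else 0)"
    and v: "v \<in> carrier_vec t"
  shows "nsq (M *\<^sub>v v) = nsq v + (\<Sum>l\<in>{p+1..n}. (cmod ((M *\<^sub>v v) \<bullet>c x l))\<^sup>2)"
  unfolding nsq_coordinates[OF mult_mat_vec_carrier[OF M v]] split_sum
  using low_coordinates[OF M d v, of "\<lambda>_. 1"] v by (simp add: nsq_def)

lemma nsq_Wy: "v \<in> carrier_vec t
    \<Longrightarrow> nsq (Wy *\<^sub>v v) = nsq v + (\<Sum>l\<in>{p+1..n}. (cmod ((Wy *\<^sub>v v) \<bullet>c x l))\<^sup>2)"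
  by (rule nsq_dual_split[OF columns_at_carrier]) (rule Wy_dual)

lemma nsq_Ww: "v \<in> carrier_vec t
    \<Longrightarrow> nsq (Ww *\<^sub>v v) = nsq v + (\<Sum>l\<in>{p+1..n}. (cmod ((Ww *\<^sub>v v) \<bullet>c x l))\<^sup>2)"
  by (rule nsq_dual_split[OF columns_at_carrier]) (rule Ww_dual)

abbreviation "s \<equiv> \<lambda>l. sig (js ! l)"

lemma s_pos: "l < t \<Longrightarrow> 0 < s l" and s_anti: "i \<le> j \<Longrightarrow> j < t \<Longrightarrow> s j \<le> s i"
  by (rule sig_pos[OF js_mem(1)], assumption)
    (rule sig_mono[OF js_mem(1) js_mem(1) js_anti], simp_all)

lemma filtered_tail:
  assumes v: "v \<in> carrier_vec t"
  shows "(\<Sum>l\<in>{p+1..n}. (cmod ((Ww *\<^sub>v v) \<bullet>c x l))\<^sup>2)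
    \<le> (\<Sum>l\<in>{p+1..n}. (cmod ((Wy *\<^sub>v (real_diag t s *\<^sub>v v)) \<bullet>c x l))\<^sup>2)"
proof (rule sum_mono)
  fix l assume l: "l \<in> {p+1..n}"
  have xl: "x l \<in> carrier_vec n" using l by (intro x_carrier) auto
  have sv: "real_diag t s *\<^sub>v v \<in> carrier_vec t" using mult_mat_vec_carrier[OF mat_diag_dim v] .
  have "(Ww *\<^sub>v v) \<bullet>c x l
      = complex_of_real (\<phi> l) * ((Wy *\<^sub>v (real_diag t s *\<^sub>v v)) \<bullet>c x l)"
    unfolding mult_vec_inner[OF columns_at_carrier v xl] mult_vec_inner[OF columns_at_carrier sv xl] sum_distrib_left
  proof (rule sum.cong[OF refl])
    fix j assume "j \<in> {..<t}"
    then have j: "j < t" by simp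
    show "v $ j * (col Ww j \<bullet>c x l)
        = complex_of_real (\<phi> l) * ((real_diag t s *\<^sub>v v) $ j * (col Wy j \<bullet>c x l))"
      unfolding col_Wy[OF j] col_Ww[OF j] diag_vec_index[OF v j] w_tail[OF js_mem(1)[OF j] l]
      by simp
  qed
  then have "cmod ((Ww *\<^sub>v v) \<bullet>c x l) = \<bar>\<phi> l\<bar> * cmod ((Wy *\<^sub>v (real_diag t s *\<^sub>v v)) \<bullet>c x l)"
    by (simp add: norm_mult)
  also have "\<dots> \<le> cmod ((Wy *\<^sub>v (real_diag t s *\<^sub>v v)) \<bullet>c x l)"
    using filter_le_1[OF l] by (intro mult_left_le_one_le) auto
  finally show "(cmod ((Ww *\<^sub>v v) \<bullet>c x l))\<^sup>2 \<le> (cmod ((Wy *\<^sub>v (real_diag t s *\<^sub>v v)) \<bullet>c x l))\<^sup>2"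
    by (intro power_mono) auto
qed

abbreviation "Ry \<equiv> mat_adjoint Wy * Wy"
abbreviation "Rw \<equiv> mat_adjoint Ww * Ww"

lemma Ry: "Ry \<in> carrier_mat t t" "hermitian Ry" and Rw: "Rw \<in> carrier_mat t t" "hermitian Rw"
  by (rule adjoint_mult_carrier[OF columns_at_carrier columns_at_carrier] hermitian_gram[OF columns_at_carrier])+

text \<open>\<open>N\<close> is \<open>\<Sigma> P \<Sigma>\<close> for the Gram matrix \<open>P\<close> of the tails of the \<open>y\<close>-vectors, whose eigenvalues are
  those of \<open>Ry\<close> minus \<open>1\<close>.\<close>

lemma filtered_gram_bound:
  obtains N where "N \<in> carrier_mat t t" "hermitian N"
    "\<And>l. l < t \<Longrightarrow> hermitian_eigenvalues Rw ! l - 1 \<le> hermitian_eigenvalues N ! l"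
    "\<And>k. k \<le> t \<Longrightarrow> (\<Sum>l<k. sqrt (hermitian_eigenvalues N ! l))
       \<le> (\<Sum>l<k. s l * sqrt (hermitian_eigenvalues Ry ! l - 1))"
    "\<And>k. k \<le> t \<Longrightarrow> (\<Sum>l<k. hermitian_eigenvalues N ! l)
       \<le> (\<Sum>l<k. (s l)\<^sup>2 * (hermitian_eigenvalues Ry ! l - 1))"
proof -
  obtain P where P: "P \<in> carrier_mat t t" "hermitian P"
    "\<And>v. v \<in> carrier_vec t \<Longrightarrow> hform P v = hform Ry v + (- 1) * nsq v"
    "\<And>l. l < t \<Longrightarrow> hermitian_eigenvalues P ! l = hermitian_eigenvalues Ry ! l + (- 1)"
    using hermitian_add_multiple_of_identity[OF Ry, of "- 1"] by blast
  have hP: "hform P v = (\<Sum>l\<in>{p+1..n}. (cmod ((Wy *\<^sub>v v) \<bullet>c x l))\<^sup>2)" if v: "v \<in> carrier_vec t" for v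
    unfolding P(3)[OF v] hform_gram[OF columns_at_carrier v] nsq_Wy[OF v] by simp
  define N where "N = real_diag t s * P * real_diag t s"
  note N = real_diag_congruence[OF P(1,2), where s = s, folded N_def]
  have psd: "0 \<le> hform P v" if "v \<in> carrier_vec t" for v
    unfolding hP[OF that] by (simp add: sum_nonneg)
  have sums: "(\<Sum>l<k. sqrt (hermitian_eigenvalues N ! l)) \<le> (\<Sum>l<k. s l * sqrt (hermitian_eigenvalues P ! l))"
      "(\<Sum>l<k. hermitian_eigenvalues N ! l) \<le> (\<Sum>l<k. (s l)\<^sup>2 * hermitian_eigenvalues P ! l)"
    if "k \<le> t" for k
    unfolding N_def using that
    by - (rule scaled_eigenvalue_sums[OF P(1,2)], erule psd, erule s_pos, erule (1) s_anti, assumption)+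
  show thesis
  proof (rule that[of N])
    fix l assume l: "l < t"
    have "hermitian_eigenvalues Rw ! l \<le> hermitian_eigenvalues N ! l + 1"
    proof (rule eigenvalue_le_shift[OF N(1,2) Rw _ l])
      fix v :: "complex vec" assume v: "v \<in> carrier_vec t"
      have "hform N v = (\<Sum>l\<in>{p+1..n}. (cmod ((Wy *\<^sub>v (real_diag t s *\<^sub>v v)) \<bullet>c x l))\<^sup>2)"
        unfolding N(3)[OF v] by (rule hP[OF mult_mat_vec_carrier[OF mat_diag_dim v]])
      then show "hform Rw v \<le> hform N v + 1 * nsq v"
        using filtered_tail[OF v]
        unfolding hform_gram[OF columns_at_carrier v] nsq_Ww[OF v] by simp
    qed
    then show "hermitian_eigenvalues Rw ! l - 1 \<le> hermitian_eigenvalues N ! l" by simp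
  next
    fix k assume k: "k \<le> t"
    have e: "(\<Sum>l<k. g l (hermitian_eigenvalues P ! l)) = (\<Sum>l<k. g l (hermitian_eigenvalues Ry ! l - 1))"
      for g :: "nat \<Rightarrow> real \<Rightarrow> real"
      using P(4) k by (intro sum.cong refl) simp
    show "(\<Sum>l<k. sqrt (hermitian_eigenvalues N ! l)) \<le> (\<Sum>l<k. s l * sqrt (hermitian_eigenvalues Ry ! l - 1))"
      using sums(1)[OF k] unfolding e[of "\<lambda>l z. s l * sqrt z"] by simp
    show "(\<Sum>l<k. hermitian_eigenvalues N ! l) \<le> (\<Sum>l<k. (s l)\<^sup>2 * (hermitian_eigenvalues Ry ! l - 1))"
      using sums(2)[OF k] unfolding e[of "\<lambda>l z. (s l)\<^sup>2 * z"] by simp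
  qed (use N in auto)
qed

lemma cspan_U: "cspan n (set (cols U)) = cspan n (x ` set js)"
proof -
  have "set (cols U) = x ` set js"
    by (rule set_cols_columns_at, rule x_carrier) (use js(1) p in auto)
  then show ?thesis by simp
qed

lemma cspan_Wy: "cspan n (set (cols Wy)) = cspan n (y ` set js)"
proof -
  have "set (cols Wy) = y ` set js"
    by (rule set_cols_columns_at, rule y_carrier) (use js(1) in auto)
  then show ?thesis by simp
qed

lemma Ww_in_K: "cspan n (set (cols Ww)) \<subseteq> K"
  by (rule cspan_subset[OF K columns_at_carrier]) (simp only: col_Ww w_in_K[OF js_mem(1)])

lemma tan_angles_dual_bases:
  "map tan (principal_angles n (cspan n (x ` set js)) (cspan n (y ` set js)))
    = map (\<lambda>l. sqrt (hermitian_eigenvalues Ry ! l - 1)) [0..<t]"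
  using tan_principal_angles_dual[OF columns_at_carrier UU columns_at_carrier UWy]
  unfolding cspan_U cspan_Wy .

lemma Ry_ge_1: "l < t \<Longrightarrow> 1 \<le> hermitian_eigenvalues Ry ! l"
  by (rule dual_gram_eigenvalue_ge_1[OF columns_at_carrier UU columns_at_carrier UWy])

lemma Rw_ge_1: "l < t \<Longrightarrow> 1 \<le> hermitian_eigenvalues Rw ! l"
  by (rule dual_gram_eigenvalue_ge_1[OF columns_at_carrier UU columns_at_carrier UWw])

lemma sorted_weighted:
  assumes g: "\<And>i j. i \<le> j \<Longrightarrow> j < t \<Longrightarrow> g j \<le> g i" "\<And>l. l < t \<Longrightarrow> 0 \<le> g l"
    and c: "\<And>i j. i \<le> j \<Longrightarrow> j < t \<Longrightarrow> c j \<le> c i" "\<And>l. l < t \<Longrightarrow> 0 \<le> c l"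
  shows "sorted (rev (map (\<lambda>l. c l * g l :: real) [0..<t]))"
proof -
  have "c j * g j \<le> c i * g i" if "i \<le> j" "j < t" for i j
    by (rule mult_mono) (use g c that in auto)
  then show ?thesis by (auto simp: sorted_iff_nth_mono rev_nth)
qed

text \<open>The angles to \<open>K\<close> are bounded by those to the span of the \<open>w\<close>-vectors, and these through
  \<open>filtered_gram_bound\<close>.\<close>

proposition tan_krylov_majorized:
  "map tan (principal_angles n (cspan n (x ` set js)) K)
    \<prec>\<^sub>w map sig js *\<^sub>t map tan (principal_angles n (cspan n (x ` set js)) (cspan n (y ` set js)))"
proof -
  obtain N where N: "N \<in> carrier_mat t t" "hermitian N"
    and Nl: "\<And>l. l < t \<Longrightarrow> hermitian_eigenvalues Rw ! l - 1 \<le> hermitian_eigenvalues N ! l"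
    and Nsum: "\<And>k. k \<le> t \<Longrightarrow> (\<Sum>l<k. sqrt (hermitian_eigenvalues N ! l))
       \<le> (\<Sum>l<k. s l * sqrt (hermitian_eigenvalues Ry ! l - 1))"
    by (rule filtered_gram_bound) blast
  note angles = tan_principal_angles_le[OF columns_at_carrier UU columns_at_carrier UWw K Ww_in_K, unfolded cspan_U]
  have b: "map sig js *\<^sub>t map tan (principal_angles n (cspan n (x ` set js)) (cspan n (y ` set js)))
      = map (\<lambda>l. s l * sqrt (hermitian_eigenvalues Ry ! l - 1)) [0..<t]"
    unfolding tan_angles_dual_bases by (rule nth_equalityI) auto
  show ?thesis
    unfolding b
  proof (rule weakly_majorizedI)
    show "sorted (rev (map (\<lambda>l. s l * sqrt (hermitian_eigenvalues Ry ! l - 1)) [0..<t]))"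
    proof (rule sorted_weighted)
      show "sqrt (hermitian_eigenvalues Ry ! j - 1) \<le> sqrt (hermitian_eigenvalues Ry ! i - 1)"
        if "i \<le> j" "j < t" for i j
        using hermitian_eigenvalues_length_sorted(3)[OF Ry that] by simp
      show "0 \<le> sqrt (hermitian_eigenvalues Ry ! l - 1)" if "l < t" for l
        using Ry_ge_1[OF that] by simp
      show "0 \<le> s l" if "l < t" for l using s_pos[OF that] by simp
    qed (rule s_anti)
  next
    fix J assume "J \<subseteq> {..<length (map tan (principal_angles n (cspan n (x ` set js)) K))}"
    then have J: "J \<subseteq> {..<t}" unfolding length_map angles(1) .
    have k: "card J \<le> t" using card_mono[OF _ J] by simp
    have "(\<Sum>j\<in>J. map tan (principal_angles n (cspan n (x ` set js)) K) ! j)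
        \<le> (\<Sum>j\<in>J. sqrt (hermitian_eigenvalues N ! j))"
    proof (rule sum_mono)
      fix j assume "j \<in> J"
      then have j: "j < t" using J by auto
      have "map tan (principal_angles n (cspan n (x ` set js)) K) ! j
          = tan (principal_angles n (cspan n (x ` set js)) K ! j)"
        using j angles(1) by simp
      also have "\<dots> \<le> sqrt (hermitian_eigenvalues Rw ! j - 1)" by (rule angles(2)[OF j])
      also have "\<dots> \<le> sqrt (hermitian_eigenvalues N ! j)" using Nl[OF j] by simp
      finally show "map tan (principal_angles n (cspan n (x ` set js)) K) ! j \<le> sqrt (hermitian_eigenvalues N ! j)" .
    qed
    also have "\<dots> \<le> (\<Sum>l<card J. sqrt (hermitian_eigenvalues N ! l))"
      by (rule sum_le_sum_first[OF _ J]) (simp add: hermitian_eigenvalues_length_sorted(3)[OF N])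
    also have "\<dots> \<le> (\<Sum>l<card J. s l * sqrt (hermitian_eigenvalues Ry ! l - 1))"
      by (rule Nsum[OF k])
    also have "\<dots> = (\<Sum>l<card J. map (\<lambda>l. s l * sqrt (hermitian_eigenvalues Ry ! l - 1)) [0..<t] ! l)"
      using k by (intro sum.cong refl) simp
    finally show "(\<Sum>j\<in>J. map tan (principal_angles n (cspan n (x ` set js)) K) ! j)
        \<le> (\<Sum>l<card J. map (\<lambda>l. s l * sqrt (hermitian_eigenvalues Ry ! l - 1)) [0..<t] ! l)" .
  qed (simp add: angles(1))
qed

text \<open>The scaling \<open>d\<close> is chosen so that the weights \<open>lam (js ! l) - lam n\<close> become \<open>1\<close>.\<close>

abbreviation "gap_to_min \<equiv> \<lambda>l. lam (js ! l) - lam n"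
abbreviation "d \<equiv> \<lambda>l. 1 / sqrt (gap_to_min l)"

lemma gap_pos: "l < t \<Longrightarrow> 0 < gap_to_min l"
  using lam_antimono[of "js ! l" p] js_mem(1)[of l] gap p by force

lemma gap_mono: "i \<le> j \<Longrightarrow> j < t \<Longrightarrow> gap_to_min i \<le> gap_to_min j"
  using lam_antimono[of "js ! j" "js ! i"] js_mem(1)[of j] js_mem(2)[of i] js_anti[of i j] by simp

abbreviation "Rd \<equiv> real_diag t d * Rw * real_diag t d"

text \<open>The test vectors are \<open>a = Ww (diag d v)\<close>. The duality of the \<open>w\<close>-vectors and the choice of \<open>d\<close> give
  \<open>a\<^sup>H (A - lam n) a \<ge> |v|\<^sup>2\<close>, while \<open>|a|\<^sup>2\<close> is the value at \<open>v\<close> of the form of \<open>Rd\<close>. The index is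
  reversed since large Ritz values belong to small eigenvalues of \<open>Rd\<close>.\<close>

lemma ritz_value_bound:
  assumes q: "q < t"
  shows "lam n < ritz_values n A K ! q"
    and "1 \<le> (ritz_values n A K ! q - lam n) * hermitian_eigenvalues Rd ! (t - 1 - q)"
proof -
  obtain V where V_onb: "orthonormal_basis_mat n K V"
    using orthonormal_basis_mat_exists[OF K] by blast
  define r where "r = dim_col V"
  have V: "V \<in> carrier_mat n r" "mat_adjoint V * V = 1\<^sub>m r" "cspan n (set (cols V)) = K"
    using V_onb unfolding orthonormal_basis_mat_def r_def by auto
  obtain Z where Z: "Z \<in> carrier_mat r t" "Ww = V * Z"
    using cspan_cols_factor[OF V(1) columns_at_carrier Ww_in_K[folded V(3)]] by blast
  have VZ: "V *\<^sub>v (Z *\<^sub>v a) = Ww *\<^sub>v a" if "a \<in> carrier_vec t" for a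
    unfolding Z(2) using assoc_mult_mat_vec[OF V(1) Z(1) that] by simp
  have tr: "t \<le> r"
  proof (rule ccontr)
    assume "\<not> t \<le> r"
    then obtain a where a: "a \<in> carrier_vec t" "a \<noteq> 0\<^sub>v t" "Z *\<^sub>v a = 0\<^sub>v r"
      using underdetermined_kernel[OF Z(1)] by auto
    have "nsq (Ww *\<^sub>v a) = 0"
      unfolding VZ[OF a(1), symmetric] a(3) using nsq_isometry[OF V(1,2), of "0\<^sub>v r"] by simp
    moreover have "nsq a \<le> nsq (Ww *\<^sub>v a)"
      unfolding nsq_Ww[OF a(1)] by (simp add: sum_nonneg)
    ultimately show False using nsq_pos[OF a(1,2)] by simp
  qed
  define M where "M = mat_adjoint V * A * V"
  have aV: "mat_adjoint V \<in> carrier_mat r n" using V(1) by simp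
  have M: "M \<in> carrier_mat r r" "hermitian M"
    unfolding M_def by (rule mult_carrier_mat[OF mult_carrier_mat[OF aV A(1)] V(1)])
      (rule hermitian_congruence[OF V(1) A])
  have ritz: "ritz_values n A K = hermitian_eigenvalues M"
    unfolding M_def by (rule ritz_values_eq[OF A(1) V_onb])
  note Rd = real_diag_congruence[OF Rw, where s = d]
  define S where "S = Z * real_diag t d"
  have S: "S \<in> carrier_mat r t" unfolding S_def by (rule mult_carrier_mat[OF Z(1) mat_diag_dim])
  define e where "e = ritz_values n A K ! q"
  define \<nu> where "\<nu> = hermitian_eigenvalues Rd ! (t - 1 - q)"
  obtain v where v: "v \<in> carrier_vec t" "v \<noteq> 0\<^sub>v t" "hform Rd v \<le> \<nu> * nsq v"
      "hform M (S *\<^sub>v v) \<le> e * nsq (S *\<^sub>v v)"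
    using eigen_test_vector_low[OF M Rd(1,2) S, of q] q tr unfolding e_def \<nu>_def ritz by auto
  define u where "u = real_diag t d *\<^sub>v v"
  have u: "u \<in> carrier_vec t" unfolding u_def by (rule mult_mat_vec_carrier[OF mat_diag_dim v(1)])
  define a where "a = Ww *\<^sub>v u"
  have a: "a \<in> carrier_vec n" unfolding a_def by (rule mult_mat_vec_carrier[OF columns_at_carrier u])
  have Sv: "S *\<^sub>v v \<in> carrier_vec r" by (rule mult_mat_vec_carrier[OF S v(1)])
  have VSv: "V *\<^sub>v (S *\<^sub>v v) = a"
    unfolding S_def assoc_mult_mat_vec[OF Z(1) mat_diag_dim v(1)] u_def[symmetric] VZ[OF u] a_def ..
  have nSv: "nsq (S *\<^sub>v v) = nsq a"
    using nsq_isometry[OF V(1,2) Sv] VSv by simp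
  have MSv: "hform M (S *\<^sub>v v) = hform A a"
    unfolding M_def hform_congruence[OF V(1) A(1) Sv] VSv ..
  have Rdv: "hform Rd v = nsq a"
    unfolding Rd(3)[OF v(1)] u_def[symmetric] hform_gram[OF columns_at_carrier u] a_def ..
  have nv: "0 < nsq v" by (rule nsq_pos[OF v(1,2)])
  have weight: "(\<Sum>l\<in>{1..p}. (lam l - lam n) * (cmod (a \<bullet>c x l))\<^sup>2) = nsq v"
  proof -
    have "(\<Sum>l\<in>{1..p}. (lam l - lam n) * (cmod (a \<bullet>c x l))\<^sup>2)
        = (\<Sum>j<t. gap_to_min j * (cmod (u $ j))\<^sup>2)"
      unfolding a_def by (rule low_coordinates[OF columns_at_carrier _ u]) (rule Ww_dual)
    also have "\<dots> = (\<Sum>j<t. (cmod (v $ j))\<^sup>2)"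
    proof (rule sum.cong[OF refl])
      fix j assume "j \<in> {..<t}"
      then have j: "j < t" by simp
      have "(cmod (u $ j))\<^sup>2 = (d j)\<^sup>2 * (cmod (v $ j))\<^sup>2"
        unfolding u_def diag_vec_index[OF v(1) j] norm_mult norm_of_real power_mult_distrib power2_abs ..
      then show "gap_to_min j * (cmod (u $ j))\<^sup>2 = (cmod (v $ j))\<^sup>2"
        using gap_pos[OF j] by (simp add: power_divide)
    qed
    also have "\<dots> = nsq v" using v(1) by (simp add: nsq_def)
    finally show ?thesis .
  qed
  have "nsq v \<le> (\<Sum>l\<in>{1..n}. (lam l - lam n) * (cmod (a \<bullet>c x l))\<^sup>2)"
    unfolding weight[symmetric] using p lam_antimono
    by (intro sum_mono2) auto
  also have "\<dots> = hform A a - lam n * nsq a"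
    unfolding hform_coordinates[OF a] nsq_coordinates[OF a]
    by (simp add: left_diff_distrib sum_subtractf sum_distrib_left)
  also have "\<dots> \<le> (e - lam n) * nsq a"
    using v(4) unfolding MSv nSv by (simp add: left_diff_distrib)
  finally have 1: "nsq v \<le> (e - lam n) * nsq a" .
  have na: "0 < nsq a"
  proof -
    have "nsq a \<noteq> 0" using 1 nv by auto
    then show ?thesis using nsq_nonneg[of a] by linarith
  qed
  have e: "0 < e - lam n"
    using 1 nv na by (metis less_le_trans mult_pos_pos not_less zero_less_mult_pos2)
  then show "lam n < ritz_values n A K ! q" unfolding e_def by simp
  have "nsq v * 1 \<le> (e - lam n) * (\<nu> * nsq v)"
    using order_trans[OF 1 mult_left_mono[OF v(3)[unfolded Rdv] less_imp_le[OF e]]] by simp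
  then have "nsq v * 1 \<le> nsq v * ((e - lam n) * \<nu>)" by (simp only: mult_ac)
  then have "1 \<le> (e - lam n) * \<nu>" using nv by simp
  then show "1 \<le> (ritz_values n A K ! q - lam n) * hermitian_eigenvalues Rd ! (t - 1 - q)"
    unfolding e_def \<nu>_def .
qed

text \<open>With \<open>\<psi> = ritz_values n A K ! q\<close> and \<open>g = lam (js ! (t - 1 - q)) - lam n\<close> the error is
  \<open>g / (\<psi> - lam n) - 1\<close>, at most \<open>g * \<nu> - 1\<close> by \<open>ritz_value_bound\<close>, where
  \<open>\<nu>\<close> is the eigenvalue of \<open>Rd\<close> at \<open>t - 1 - q\<close>. Lidskii's inequality for \<open>Rd\<close>
  says that the products of these \<open>g * \<nu>\<close> over any set are bounded by those of the largest
  eigenvalues of \<open>Rw\<close>.\<close>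

lemma relative_ritz_error_sums:
  assumes J: "J \<subseteq> {..<t}"
  shows "(\<Sum>q\<in>J. (lam (js ! (t - 1 - q)) - ritz_values n A K ! q) / (ritz_values n A K ! q - lam n))
    \<le> (\<Sum>l<card J. (s l)\<^sup>2 * (hermitian_eigenvalues Ry ! l - 1))"
proof -
  let ?\<psi> = "\<lambda>q. ritz_values n A K ! q"
  obtain N where N: "N \<in> carrier_mat t t" "hermitian N"
    and Nl: "\<And>l. l < t \<Longrightarrow> hermitian_eigenvalues Rw ! l - 1 \<le> hermitian_eigenvalues N ! l"
    and Nsum: "\<And>k. k \<le> t \<Longrightarrow> (\<Sum>l<k. hermitian_eigenvalues N ! l)
       \<le> (\<Sum>l<k. (s l)\<^sup>2 * (hermitian_eigenvalues Ry ! l - 1))"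
    by (rule filtered_gram_bound) blast
  define z where "z l = gap_to_min l * hermitian_eigenvalues Rd ! l" for l
  define J' where "J' = (\<lambda>q. t - 1 - q) ` J"
  have J': "J' \<subseteq> {..<t}" using J by (auto simp: J'_def)
  have inj: "inj_on (\<lambda>q. t - 1 - q) J"
  proof (rule inj_onI)
    fix a b assume "a \<in> J" "b \<in> J" and eq: "t - 1 - a = t - 1 - b"
    then have "a < t" "b < t" using J by auto
    then show "a = b" using eq by linarith
  qed
  have cJ': "card J' = card J" unfolding J'_def by (rule card_image[OF inj])
  have k: "card J \<le> t" using card_mono[OF _ J] by simp
  have d2: "(d l)\<^sup>2 = 1 / gap_to_min l" if "l < t" for l
    using gap_pos[OF that] by (simp add: power_divide)
  have Rd_pos: "0 < hermitian_eigenvalues Rd ! l" if l: "l < t" for l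
  proof -
    have l': "t - 1 - l < t" "t - 1 - (t - 1 - l) = l" using l by auto
    have "0 < (?\<psi> (t - 1 - l) - lam n) * hermitian_eigenvalues Rd ! l"
      using ritz_value_bound(2)[OF l'(1)] unfolding l'(2) by linarith
    then show ?thesis
      using ritz_value_bound(1)[OF l'(1)] by (simp add: zero_less_mult_iff)
  qed
  have lidskii: "(\<Prod>j\<in>I. z j) \<le> (\<Prod>l<card I. hermitian_eigenvalues Rw ! l)" if I: "I \<subseteq> {..<t}" for I
  proof -
    have "(\<Prod>j\<in>I. hermitian_eigenvalues Rd ! j)
        \<le> (\<Prod>j\<in>I. (d j)\<^sup>2) * (\<Prod>l<card I. hermitian_eigenvalues Rw ! l)"
    proof (rule multiplicative_lidskii[OF Rw _ _ _ I])
      show "0 < hermitian_eigenvalues Rw ! l" if "l < t" for l using Rw_ge_1[OF that] by simp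
      show "0 < d i" if "i < t" for i using gap_pos[OF that] by simp
      show "d j \<le> d i" if "i \<le> j" "j < t" for i j
        using gap_pos[of i] gap_pos[of j] gap_mono[OF that] that by (simp add: frac_le)
    qed
    then have "(\<Prod>j\<in>I. gap_to_min j) * (\<Prod>j\<in>I. hermitian_eigenvalues Rd ! j)
        \<le> (\<Prod>j\<in>I. gap_to_min j) * ((\<Prod>j\<in>I. (d j)\<^sup>2) * (\<Prod>l<card I. hermitian_eigenvalues Rw ! l))"
      by (rule mult_left_mono) (use I gap_pos in \<open>auto intro!: prod_nonneg simp: less_imp_le\<close>)
    also have "\<dots> = (\<Prod>j\<in>I. gap_to_min j * (d j)\<^sup>2) * (\<Prod>l<card I. hermitian_eigenvalues Rw ! l)"
      by (simp only: prod.distrib mult.assoc)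
    also have "(\<Prod>j\<in>I. gap_to_min j * (d j)\<^sup>2) = 1"
    proof (rule prod.neutral, rule ballI)
      fix j assume "j \<in> I"
      then have j: "j < t" using I by auto
      show "gap_to_min j * (d j)\<^sup>2 = 1" unfolding d2[OF j] using gap_pos[OF j] by simp
    qed
    finally show ?thesis by (simp add: z_def prod.distrib)
  qed
  have "(\<Sum>q\<in>J. (lam (js ! (t - 1 - q)) - ?\<psi> q) / (?\<psi> q - lam n)) \<le> (\<Sum>q\<in>J. z (t - 1 - q) - 1)"
  proof (rule sum_mono)
    fix q assume "q \<in> J"
    then have q: "q < t" and q': "t - 1 - q < t" using J by auto
    note b = ritz_value_bound[OF q]
    let ?g = "gap_to_min (t - 1 - q)" and ?\<nu> = "hermitian_eigenvalues Rd ! (t - 1 - q)"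
    have "(lam (js ! (t - 1 - q)) - ?\<psi> q) / (?\<psi> q - lam n) = ?g * (1 / (?\<psi> q - lam n)) - 1"
      using b(1) by (simp add: field_simps)
    also have "1 / (?\<psi> q - lam n) \<le> ?\<nu>"
      using b by (simp add: pos_divide_le_eq mult.commute)
    then have "?g * (1 / (?\<psi> q - lam n)) - 1 \<le> ?g * ?\<nu> - 1"
      using gap_pos[OF q'] by (intro diff_right_mono mult_left_mono) auto
    finally show "(lam (js ! (t - 1 - q)) - ?\<psi> q) / (?\<psi> q - lam n) \<le> z (t - 1 - q) - 1"
      unfolding z_def .
  qed
  also have "\<dots> = (\<Sum>l\<in>J'. z l) - real (card J)"
    unfolding J'_def sum.reindex[OF inj] by (simp add: sum_subtractf)
  also have "\<dots> \<le> (\<Sum>l<card J. hermitian_eigenvalues Rw ! l) - real (card J)"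
  proof -
    have "(\<Sum>l\<in>J'. z l) \<le> (\<Sum>l<card J'. hermitian_eigenvalues Rw ! l)"
    proof (rule subset_log_majorization_sum[OF _ _ lidskii J'])
      show "0 < z l" if "l < t" for l unfolding z_def using gap_pos[OF that] Rd_pos[OF that] by simp
      show "0 < hermitian_eigenvalues Rw ! l" if "l < t" for l using Rw_ge_1[OF that] by simp
    qed
    then show ?thesis unfolding cJ' by simp
  qed
  also have "\<dots> = (\<Sum>l<card J. hermitian_eigenvalues Rw ! l - 1)"
    by (simp add: sum_subtractf)
  also have "\<dots> \<le> (\<Sum>l<card J. hermitian_eigenvalues N ! l)"
    using Nl k by (intro sum_mono) auto
  also have "\<dots> \<le> (\<Sum>l<card J. (s l)\<^sup>2 * (hermitian_eigenvalues Ry ! l - 1))"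
    by (rule Nsum[OF k])
  finally show ?thesis .
qed

end

text \<open>The columns for \<open>js\<close> are among all the columns; selecting them is multiplication by the isometry
  \<open>S\<close>, so the smaller Gram matrix is a compression of the full one.\<close>

lemma dual_gram_eigenvalue_mono:
  assumes js: "set js \<subseteq> {1..p}" "sorted_wrt (>) js" and l: "l < length js"
  defines "fs \<equiv> rev [1..<p+1]"
  shows "hermitian_eigenvalues (mat_adjoint (columns_at n y js) * columns_at n y js) ! l
    \<le> hermitian_eigenvalues (mat_adjoint (columns_at n y fs) * columns_at n y fs) ! l"
proof -
  let ?t = "length js"
  have fs: "set fs \<subseteq> {1..p}" "sorted_wrt (>) fs" "length fs = p"
    by (auto simp: fs_def sorted_wrt_rev simp del: upt_Suc)
  have fs_nth: "fs ! (p - i) = i" if "i \<in> {1..p}" for i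
    unfolding fs_def using that by (subst rev_nth) (auto simp del: upt_Suc)
  \<comment> \<open>\<open>m j\<close> is the position of \<open>js ! j\<close> in the full list \<open>fs\<close>, which runs from \<open>p\<close> down to \<open>1\<close>\<close>
  define m where "m j = p - js ! j" for j
  have jmem: "js ! j \<in> {1..p}" if "j < ?t" for j by (rule js_mem(1)[OF js that])
  have m: "m j < p" "fs ! m j = js ! j" if "j < ?t" for j
    using jmem[OF that] fs_nth[OF jmem[OF that]] by (auto simp: m_def)
  have m_inj: "m i = m j \<longleftrightarrow> i = j" if "i < ?t" "j < ?t" for i j
    using m(2)[OF that(1)] m(2)[OF that(2)] js_inj[OF js that] by metis
  define S where "S = mat_of_cols p (map (\<lambda>j. unit_vec p (m j) :: complex vec) [0..<?t])"
  have S: "S \<in> carrier_mat p ?t"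
    unfolding S_def using mat_of_cols_map[of p _ "[0..<?t]"] by simp
  have colS: "col S j = unit_vec p (m j)" if "j < ?t" for j
    unfolding S_def using that by (subst col_mat_of_cols_map) auto
  have SS: "mat_adjoint S * S = 1\<^sub>m ?t"
  proof (rule eq_matI)
    fix i j assume "i < dim_row (1\<^sub>m ?t :: complex mat)" "j < dim_col (1\<^sub>m ?t :: complex mat)"
    then have ij: "i < ?t" "j < ?t" by auto
    have "unit_vec p (m j) \<bullet>c (unit_vec p (m i) :: complex vec)
        = (\<Sum>a<p. if a = m j then cnj (unit_vec p (m i) $ a) else 0)"
      unfolding inner_sum[OF unit_vec_carrier unit_vec_carrier]
      by (intro sum.cong refl) (use m(1)[OF ij(2)] in auto)
    also have "\<dots> = (if m j = m i then 1 else 0)"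
      using m(1)[OF ij(1)] m(1)[OF ij(2)] by simp
    finally show "(mat_adjoint S * S) $$ (i, j) = 1\<^sub>m ?t $$ (i, j)"
      unfolding adjoint_mult_index[OF S S ij] colS[OF ij(1)] colS[OF ij(2)]
      using m_inj[OF ij(2) ij(1)] ij by auto
  qed (use S in auto)
  have F: "columns_at n y fs \<in> carrier_mat n p"
    using columns_at_carrier[of n y fs] fs(3) by simp
  have FS: "columns_at n y fs * S = columns_at n y js"
  proof (rule mat_col_eqI)
    fix j assume "j < dim_col (columns_at n y js)"
    then have j: "j < ?t" using carrier_matD(2)[OF columns_at_carrier[of n y js]] by simp
    have mj: "m j < length fs" using m(1)[OF j] fs(3) by simp
    have "col (columns_at n y fs * S) j = columns_at n y fs *\<^sub>v unit_vec p (m j)"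
      unfolding col_mult2[OF F S j] colS[OF j] ..
    also have "\<dots> = col (columns_at n y fs) (m j)"
      by (rule eq_vecI) (use F m(1)[OF j] in auto)
    also have "\<dots> = col (columns_at n y js) j"
      unfolding col_Wy[OF fs(1,2) mj] col_Wy[OF js j] m(2)[OF j] ..
    finally show "col (columns_at n y fs * S) j = col (columns_at n y js) j" .
  qed (use F S carrier_matD[OF columns_at_carrier[of n y js]] in auto)
  have lp: "l < p" using l length_js_le[OF js] by simp
  show ?thesis
  proof (rule eigenvalue_compression[OF _ _ Ry[OF js] S SS _ lp l])
    show "mat_adjoint (columns_at n y fs) * columns_at n y fs \<in> carrier_mat p p"
      by (rule adjoint_mult_carrier[OF F F])
    show "hermitian (mat_adjoint (columns_at n y fs) * columns_at n y fs)"
      by (rule hermitian_gram[OF F])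
    fix v :: "complex vec" assume v: "v \<in> carrier_vec ?t"
    have "columns_at n y fs *\<^sub>v (S *\<^sub>v v) = columns_at n y js *\<^sub>v v"
      unfolding FS[symmetric] using assoc_mult_mat_vec[OF F S v] by simp
    then show "hform (mat_adjoint (columns_at n y js) * columns_at n y js) v
        \<le> hform (mat_adjoint (columns_at n y fs) * columns_at n y fs) (S *\<^sub>v v)"
      unfolding hform_gram[OF columns_at_carrier v] hform_gram[OF F mult_mat_vec_carrier[OF S v]] by simp
  qed
qed

proposition tan_dual_bases_le:
  assumes js: "set js \<subseteq> {1..p}" "sorted_wrt (>) js" and l: "l < length js"
  shows "0 \<le> map tan (principal_angles n (cspan n (x ` set js)) (cspan n (y ` set js))) ! l"
    and "map tan (principal_angles n (cspan n (x ` set js)) (cspan n (y ` set js))) ! l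
    \<le> map tan (principal_angles n (cspan n (x ` {1..p})) (cspan n (y ` {1..p}))) ! l"
    and "length (principal_angles n (cspan n (x ` {1..p})) (cspan n (y ` {1..p}))) = p"
    and "length (principal_angles n (cspan n (x ` set js)) (cspan n (y ` set js))) = length js"
proof -
  define fs where "fs = rev [1..<p+1]"
  have fs: "set fs \<subseteq> {1..p}" "sorted_wrt (>) fs" "length fs = p" "set fs = {1..p}"
    by (auto simp: fs_def sorted_wrt_rev simp del: upt_Suc)
  note full = tan_angles_dual_bases[OF fs(1,2), unfolded fs(3,4)]
  note len = length_js_le[OF js]
  show "length (principal_angles n (cspan n (x ` {1..p})) (cspan n (y ` {1..p}))) = p"
    using arg_cong[OF full, of length] by simp
  show "length (principal_angles n (cspan n (x ` set js)) (cspan n (y ` set js))) = length js"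
    using arg_cong[OF tan_angles_dual_bases[OF js], of length] by simp
  show "0 \<le> map tan (principal_angles n (cspan n (x ` set js)) (cspan n (y ` set js))) ! l"
    unfolding tan_angles_dual_bases[OF js] using l Ry_ge_1[OF js l] by simp
  show "map tan (principal_angles n (cspan n (x ` set js)) (cspan n (y ` set js))) ! l
    \<le> map tan (principal_angles n (cspan n (x ` {1..p})) (cspan n (y ` {1..p}))) ! l"
    unfolding full tan_angles_dual_bases[OF js]
    using l len dual_gram_eigenvalue_mono[OF js l, folded fs_def] by simp
qed

proposition ritz_errors_majorized:
  assumes i: "i \<in> {1..p}"
  shows "map (\<lambda>j. (lam j - ritz_values n A K ! (j - 1)) / (ritz_values n A K ! (j - 1) - lam n)) [1..<i+1]
    \<prec>\<^sub>w map (\<lambda>j. (sig j)\<^sup>2) (rev [1..<i+1])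
       *\<^sub>t map (\<lambda>\<theta>. (tan \<theta>)\<^sup>2) (principal_angles n (cspan n (x ` {1..i})) (cspan n (y ` {1..i})))"
proof -
  define js where "js = rev [1..<i+1]"
  have js: "set js \<subseteq> {1..p}" "sorted_wrt (>) js" "length js = i" "set js = {1..i}"
    using i by (auto simp: js_def sorted_wrt_rev simp del: upt_Suc)
  have js_nth: "js ! (i - 1 - q) = q + 1" if "q < i" for q
    unfolding js_def using that by (subst rev_nth) (auto simp del: upt_Suc)
  let ?R = "\<lambda>l. hermitian_eigenvalues (mat_adjoint (columns_at n y js) * columns_at n y js) ! l"
  let ?a = "map (\<lambda>j. (lam j - ritz_values n A K ! (j - 1)) / (ritz_values n A K ! (j - 1) - lam n)) [1..<i+1]"
  let ?b = "map (\<lambda>l. (sig (js ! l))\<^sup>2 * (?R l - 1)) [0..<i]"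
  have R1: "1 \<le> ?R l" if "l < i" for l using Ry_ge_1[OF js(1,2), unfolded js(3), OF that] .
  have sq: "map (\<lambda>\<theta>. (tan \<theta>)\<^sup>2) (principal_angles n (cspan n (x ` {1..i})) (cspan n (y ` {1..i})))
      = map (\<lambda>l. ?R l - 1) [0..<i]"
  proof -
    have "map (\<lambda>\<theta>. (tan \<theta>)\<^sup>2) (principal_angles n (cspan n (x ` {1..i})) (cspan n (y ` {1..i})))
      = map (\<lambda>z. z\<^sup>2) (map tan (principal_angles n (cspan n (x ` set js)) (cspan n (y ` set js))))"
      unfolding js(4) by simp
    also have "\<dots> = map (\<lambda>l. ?R l - 1) [0..<i]"
      unfolding tan_angles_dual_bases[OF js(1,2)] js(3) using R1 by simp
    finally show ?thesis .
  qed
  have b: "map (\<lambda>j. (sig j)\<^sup>2) (rev [1..<i+1])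
       *\<^sub>t map (\<lambda>\<theta>. (tan \<theta>)\<^sup>2) (principal_angles n (cspan n (x ` {1..i})) (cspan n (y ` {1..i})))
    = ?b"
    unfolding sq js_def[symmetric] by (rule nth_equalityI) (auto simp: js(3))
  show ?thesis
    unfolding b
  proof (rule weakly_majorizedI)
    show "sorted (rev ?b)"
    proof (rule sorted_weighted[OF js(1,2), unfolded js(3)])
      show "?R j - 1 \<le> ?R l - 1" if "l \<le> j" "j < i" for l j
        using hermitian_eigenvalues_length_sorted(3)[OF Ry[OF js(1,2)], unfolded js(3), OF that] by simp
      show "0 \<le> ?R l - 1" if "l < i" for l using R1[OF that] by simp
      show "(sig (js ! j))\<^sup>2 \<le> (sig (js ! l))\<^sup>2" if "l \<le> j" "j < i" for l j
        using s_anti[OF js(1,2) that(1)] s_pos[OF js(1,2), of j] that js(3) by (intro power_mono) auto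
    qed simp
  next
    fix J assume "J \<subseteq> {..<length ?a}"
    then have J: "J \<subseteq> {..<i}" by (simp del: upt_Suc)
    have k: "card J \<le> i" using card_mono[OF _ J] by simp
    have "(\<Sum>q\<in>J. ?a ! q) = (\<Sum>q\<in>J. (lam (js ! (i - 1 - q)) - ritz_values n A K ! q) / (ritz_values n A K ! q - lam n))"
    proof (rule sum.cong[OF refl])
      fix q assume "q \<in> J"
      then have q: "q < i" using J by auto
      then have "[1..<i+1] ! q = q + 1" by (simp add: nth_upt del: upt_Suc)
      then show "?a ! q = (lam (js ! (i - 1 - q)) - ritz_values n A K ! q) / (ritz_values n A K ! q - lam n)"
        using q js_nth[OF q] by (simp del: upt_Suc)
    qed
    also have "\<dots> \<le> (\<Sum>l<card J. (sig (js ! l))\<^sup>2 * (?R l - 1))"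
      using relative_ritz_error_sums[OF js(1,2), unfolded js(3), OF J] .
    also have "\<dots> = (\<Sum>l<card J. ?b ! l)"
      using k by (intro sum.cong refl) simp
    finally show "(\<Sum>q\<in>J. ?a ! q) \<le> (\<Sum>l<card J. ?b ! l)" .
  qed simp
qed

end

section \<open>Biorthogonal bases and the Chebyshev filter\<close>

text \<open>The vectors \<open>y i\<close> are the columns of \<open>W = V C\<close>, where \<open>V\<close> is an orthonormal basis of \<open>Y\<close>
  and \<open>C\<close> the inverse of \<open>U\<^sup>H V\<close>; thus \<open>U\<^sup>H W = 1\<close>.\<close>

lemma biorthogonal_basis_dual:
  assumes x_carrier: "\<And>i. i \<in> {1..p} \<Longrightarrow> x i \<in> carrier_vec n"
    and x_orthonormal: "\<And>i j. i \<in> {1..p} \<Longrightarrow> j \<in> {1..p} \<Longrightarrow> x j \<bullet>c x i = (if i = j then 1 else 0)"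
    and p: "1 \<le> p" and Y: "csubspace n Y" "cdim n Y = p"
    and angle: "max_angle n (cspan n (x ` {1..p})) Y < pi / 2"
    and y: "\<And>i. i \<in> {1..p} \<Longrightarrow> y i = biorthogonal_basis n p x Y i"
  shows "\<And>i. i \<in> {1..p} \<Longrightarrow> y i \<in> Y"
    and "\<And>i l. i \<in> {1..p} \<Longrightarrow> l \<in> {1..p} \<Longrightarrow> y i \<bullet>c x l = (if i = l then 1 else 0)"
    and "cspan n (y ` {1..p}) = Y"
proof -
  define U where "U = columns_at n x [1..<p+1]"
  have U: "U \<in> carrier_mat n p"
    using columns_at_carrier[of n x "[1..<p+1]"] by (simp add: U_def del: upt_Suc)
  have colU: "col U j = x (j + 1)" if "j < p" for j
    using col_columns_at[of j "[1..<p+1]" x n] x_carrier[of "j + 1"] that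
    by (simp add: U_def nth_upt del: upt_Suc)
  have UU: "mat_adjoint U * U = 1\<^sub>m p"
  proof (rule eq_matI)
    fix i j assume "i < dim_row (1\<^sub>m p :: complex mat)" "j < dim_col (1\<^sub>m p :: complex mat)"
    then have ij: "i < p" "j < p" by auto
    show "(mat_adjoint U * U) $$ (i, j) = 1\<^sub>m p $$ (i, j)"
      unfolding adjoint_mult_index[OF U U ij] colU[OF ij(1)] colU[OF ij(2)]
      using x_orthonormal[of "i + 1" "j + 1"] ij by simp
  qed (use U in auto)
  have "set (cols U) = x ` set [1..<p+1]"
    unfolding U_def by (rule set_cols_columns_at, rule x_carrier) auto
  moreover have "set [1..<p+1] = {1..p}" by auto
  ultimately have U_onb: "orthonormal_basis_mat n (cspan n (x ` {1..p})) U"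
    unfolding orthonormal_basis_mat_def using U UU by simp
  obtain V where V_onb: "orthonormal_basis_mat n Y V" and "dim_col V = p"
    using orthonormal_basis_mat_exists[OF Y(1)] Y(2) by blast
  then have V: "V \<in> carrier_mat n p" and span_V: "cspan n (set (cols V)) = Y"
    unfolding orthonormal_basis_mat_def by auto
  obtain C where C: "C \<in> carrier_mat p p" "mat_adjoint U * V * C = 1\<^sub>m p" "C * (mat_adjoint U * V) = 1\<^sub>m p"
    using max_angle_imp_invertible[OF U_onb U V_onb V p angle] .
  define W where "W = V * C"
  have W: "W \<in> carrier_mat n p" unfolding W_def by (rule mult_carrier_mat[OF V C(1)])
  have aU: "mat_adjoint U \<in> carrier_mat p n" using U by simp
  have UW: "mat_adjoint U * W = 1\<^sub>m p"
    unfolding W_def using assoc_mult_mat[OF aU V C(1)] C(2) by simp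
  have col_VC: "col (V * C) (i - 1) = V *\<^sub>v col C (i - 1)" if "i \<in> {1..p}" for i
    by (rule col_mult2[OF V C(1)]) (use that in auto)
  have yW: "y i = col W (i - 1)" if i: "i \<in> {1..p}" for i
  proof -
    have "y i = V *\<^sub>v col C (i - 1)"
      unfolding y[OF i]
      by (rule biorthogonal_basis_eq[OF V_onb V C(1) _ i]) (use C(2) in \<open>simp only: U_def columns_at_def\<close>)
    then show ?thesis unfolding W_def col_VC[OF i] .
  qed
  have Y_eq: "Y = {V *\<^sub>v v | v. v \<in> carrier_vec p}"
    using cspan_cols_eq[OF V] span_V by simp
  show "y i \<in> Y" if i: "i \<in> {1..p}" for i
  proof -
    have "y i = V *\<^sub>v col C (i - 1)"
      unfolding yW[OF i] W_def by (rule col_VC[OF i])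
    moreover have "col C (i - 1) \<in> carrier_vec p" using C(1) by (simp add: carrier_vecI)
    ultimately show ?thesis unfolding Y_eq by blast
  qed
  show "y i \<bullet>c x l = (if i = l then 1 else 0)" if i: "i \<in> {1..p}" and l: "l \<in> {1..p}" for i l
  proof -
    have il: "l - 1 < p" "i - 1 < p" using i l by auto
    have "y i \<bullet>c x l = (mat_adjoint U * W) $$ (l - 1, i - 1)"
      unfolding adjoint_mult_index[OF U W il] colU[OF il(1)] yW[OF i] using l by simp
    then show ?thesis unfolding UW using i l by auto
  qed
  have "set (cols W) = y ` {1..p}"
  proof -
    have "set (cols W) = col W ` {0..<p}" using W by (simp add: cols_def)
    also have "{0..<p} = (\<lambda>i. i - 1) ` {1..p}"
      by (auto simp: image_iff intro!: bexI[where x = "Suc _"])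
    also have "col W ` (\<lambda>i. i - 1) ` {1..p} = y ` {1..p}"
      unfolding image_image by (rule image_cong[OF refl]) (simp only: yW)
    finally show ?thesis .
  qed
  moreover have "cspan n (set (cols W)) = Y"
    unfolding cspan_cols_eq[OF W] Y_eq
  proof (intro equalityI subsetI)
    fix z assume "z \<in> {W *\<^sub>v v | v. v \<in> carrier_vec p}"
    then obtain v where v: "v \<in> carrier_vec p" "z = W *\<^sub>v v" by blast
    have "z = V *\<^sub>v (C *\<^sub>v v)"
      unfolding v(2) W_def by (rule assoc_mult_mat_vec[OF V C(1) v(1)])
    then show "z \<in> {V *\<^sub>v v | v. v \<in> carrier_vec p}"
      using mult_mat_vec_carrier[OF C(1) v(1)] by blast
  next
    fix z assume "z \<in> {V *\<^sub>v v | v. v \<in> carrier_vec p}"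
    then obtain v where v: "v \<in> carrier_vec p" "z = V *\<^sub>v v" by blast
    define u where "u = (mat_adjoint U * V) *\<^sub>v v"
    have UV: "mat_adjoint U * V \<in> carrier_mat p p" by (rule adjoint_mult_carrier[OF U V])
    have u: "u \<in> carrier_vec p" unfolding u_def by (rule mult_mat_vec_carrier[OF UV v(1)])
    have "C *\<^sub>v u = v"
      unfolding u_def using assoc_mult_mat_vec[OF C(1) UV v(1)] C(3) v(1) by simp
    then have "z = W *\<^sub>v u"
      unfolding v(2) W_def using assoc_mult_mat_vec[OF V C(1) u] by simp
    then show "z \<in> {W *\<^sub>v v | v. v \<in> carrier_vec p}" using u by blast
  qed
  ultimately show "cspan n (y ` {1..p}) = Y" by simp
qed

text \<open>The Chebyshev polynomial composed with the affine map taking the interval from \<open>b\<close> to \<open>c\<close> to the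
  one from \<open>-1\<close> to \<open>1\<close>.\<close>

lemma chebyshev_filter:
  fixes b c :: real
  assumes "b < c" and "1 \<le> k"
  obtains f :: "real poly" where "degree f < k"
    "\<And>l. poly f l = poly (cheb_poly (k - 1)) (1 + 2 * ((l - c) / (c - b)))"
    "\<And>l. b \<le> l \<Longrightarrow> l \<le> c \<Longrightarrow> \<bar>poly f l\<bar> \<le> 1"
proof -
  define f where "f = pcompose (cheb_poly (k - 1)) [:1 - 2 * c / (c - b), 2 / (c - b):]"
  have pf: "poly f l = poly (cheb_poly (k - 1)) (1 + 2 * ((l - c) / (c - b)))" for l
  proof -
    have "poly [:1 - 2 * c / (c - b), 2 / (c - b):] l = 1 + 2 * ((l - c) / (c - b))"
      by (simp add: diff_divide_distrib)
    then show ?thesis by (simp only: f_def poly_pcompose)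
  qed
  show thesis
  proof (rule that[OF _ pf])
    have "degree f \<le> degree (cheb_poly (k - 1)) * degree [:1 - 2 * c / (c - b), 2 / (c - b):]"
      unfolding f_def by (rule degree_pcompose_le)
    also have "\<dots> \<le> (k - 1) * 1"
      using degree_cheb_poly[of "k - 1"] by (intro mult_mono) auto
    finally show "degree f < k" using assms(2) by simp
    fix l assume l: "b \<le> l" "l \<le> c"
    have "- 1 \<le> (l - c) / (c - b)" "(l - c) / (c - b) \<le> 0"
      using l assms(1) by (auto simp: field_simps)
    then have "\<bar>1 + 2 * ((l - c) / (c - b))\<bar> \<le> 1" unfolding abs_le_iff by linarith
    then show "\<bar>poly f l\<bar> \<le> 1" unfolding pf by (rule cheb_poly_abs_le_1)
  qed
qed

theorem theorem4p2:
  fixes A :: "complex mat" and n p k :: nat and lam gam sig :: "nat \<Rightarrow> real"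
    and x y :: "nat \<Rightarrow> complex vec" and X Y K :: "complex vec set"
  assumes "A \<in> carrier_mat n n" and "hermitian A"
    and "\<forall>i\<in>{1..n}. \<forall>j\<in>{1..n}. i \<le> j \<longrightarrow> lam i \<ge> lam j"
    and "\<forall>i\<in>{1..n}. eigenvector A (x i) (complex_of_real (lam i))"
    and "\<forall>i\<in>{1..n}. \<forall>j\<in>{1..n}. x j \<bullet>c x i = (if i = j then 1 else 0)"
    and "1 \<le> p" and "p < n"
    and "lam p > lam (p + 1)" and "lam (p + 1) > lam n"
    and "X = cspan n (x ` {1..p})"
    and "csubspace n Y" and "cdim n Y = p"
    and "max_angle n X Y < pi / 2"
    and "\<forall>i\<in>{1..p}. y i = biorthogonal_basis n p x Y i"
    and "1 \<le> k" and "K = block_krylov n A Y k"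
    and "\<forall>j\<in>{1..p}. gam j = (lam j - lam (p + 1)) / (lam (p + 1) - lam n)"
    and "\<forall>j\<in>{1..p}. sig j = inverse (poly (cheb_poly (k - 1)) (1 + 2 * gam j))"
  shows
    "(\<forall>\<tau> \<subseteq> {1..p}.
        let X\<tau> = cspan n (x ` \<tau>); Y\<tau> = cspan n (y ` \<tau>);
            s = map sig (rev (sorted_list_of_set \<tau>))
        in map tan (principal_angles n X\<tau> K) \<prec>\<^sub>w s *\<^sub>t map tan (principal_angles n X\<tau> Y\<tau>) \<and>
           s *\<^sub>t map tan (principal_angles n X\<tau> Y\<tau>)
             \<le>\<^sub>t s *\<^sub>t map tan (take (card \<tau>) (principal_angles n X Y))) \<and>
     (\<forall>i\<in>{1..p}.
        let \<psi> = (\<lambda>j. ritz_values n A K ! (j - 1));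
            Xi = cspan n (x ` {1..i}); Yi = cspan n (y ` {1..i});
            s2 = map (\<lambda>j. (sig j)\<^sup>2) (rev [1..<i+1])
        in map (\<lambda>j. (lam j - \<psi> j) / (\<psi> j - lam n)) [1..<i+1]
             \<prec>\<^sub>w s2 *\<^sub>t map (\<lambda>\<theta>. (tan \<theta>)\<^sup>2) (principal_angles n Xi Yi) \<and>
           s2 *\<^sub>t map (\<lambda>\<theta>. (tan \<theta>)\<^sup>2) (principal_angles n Xi Yi)
             \<le>\<^sub>t s2 *\<^sub>t map (\<lambda>\<theta>. (tan \<theta>)\<^sup>2) (take i (principal_angles n X Y)))"
proof -
  note A = assms(1,2) and p = assms(6,7) and gap = assms(8,9) and X = assms(10) and Y = assms(11,12)
    and K = assms(16)
  have lam: "lam j \<le> lam i" if "1 \<le> i" "i \<le> j" "j \<le> n" for i j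
    using assms(3) that by simp
  have x_carrier: "x i \<in> carrier_vec n" and x_eigen: "A *\<^sub>v x i = complex_of_real (lam i) \<cdot>\<^sub>v x i"
    if "i \<in> {1..n}" for i
    using assms(4) that A(1) unfolding eigenvector_def by auto
  have x_orthonormal: "x j \<bullet>c x i = (if i = j then 1 else 0)" if "i \<in> {1..n}" "j \<in> {1..n}" for i j
    using assms(5) that by blast
  have y: "y i = biorthogonal_basis n p x Y i" if "i \<in> {1..p}" for i
    using assms(14) that by blast
  have sub: "i \<in> {1..n}" if "i \<in> {1..p}" for i using that p(2) by simp
  have xp: "x i \<in> carrier_vec n" if "i \<in> {1..p}" for i by (rule x_carrier[OF sub[OF that]])
  have xxp: "x j \<bullet>c x i = (if i = j then 1 else 0)" if "i \<in> {1..p}" "j \<in> {1..p}" for i j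
    by (rule x_orthonormal[OF sub[OF that(1)] sub[OF that(2)]])
  note angle = assms(13)[unfolded X]
  have dual: "\<And>i. i \<in> {1..p} \<Longrightarrow> y i \<in> Y"
    "\<And>i l. i \<in> {1..p} \<Longrightarrow> l \<in> {1..p} \<Longrightarrow> y i \<bullet>c x l = (if i = l then 1 else 0)"
    "cspan n (y ` {1..p}) = Y"
    by (rule biorthogonal_basis_dual[where p = p and x = x and n = n and Y = Y and y = y];
        (assumption | rule xp xxp p(1) Y angle y); assumption)+
  have Yc: "y i \<in> carrier_vec n" if "i \<in> {1..p}" for i
    using dual(1)[OF that] csubspaceD(1)[OF Y(1)] by blast
  have K_sub: "csubspace n K" unfolding K by (rule csubspace_block_krylov[OF A(1) Y(1)])
  obtain f :: "real poly" where f: "degree f < k"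
    "\<And>l. poly f l = poly (cheb_poly (k - 1)) (1 + 2 * ((l - lam (p + 1)) / (lam (p + 1) - lam n)))"
    "\<And>l. lam n \<le> l \<Longrightarrow> l \<le> lam (p + 1) \<Longrightarrow> \<bar>poly f l\<bar> \<le> 1"
    using chebyshev_filter[OF gap(2) assms(15)] by blast
  define g where "g j = (lam j - lam (p + 1)) / (lam (p + 1) - lam n)" for j
  have fg: "poly f (lam j) = poly (cheb_poly (k - 1)) (1 + 2 * g j)" for j
    unfolding g_def by (rule f(2))
  have g0: "0 \<le> g j" if "j \<in> {1..p}" for j
    unfolding g_def using lam[of j p] that gap p by (intro divide_nonneg_nonneg) auto
  have g_anti: "g j \<le> g i" if "i \<in> {1..p}" "j \<in> {1..p}" "i \<le> j" for i j
    unfolding g_def using lam[of i j] that gap p by (intro divide_right_mono) auto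
  have sig: "sig j = inverse (poly f (lam j))" if "j \<in> {1..p}" for j
    using assms(17,18) that unfolding fg g_def by simp
  have f1: "1 \<le> poly f (lam j)" if "j \<in> {1..p}" for j
    unfolding fg by (rule cheb_poly_ge_1) (use g0[OF that] in simp)
  have fmono: "poly f (lam j) \<le> poly f (lam i)" if "i \<in> {1..p}" "j \<in> {1..p}" "i \<le> j" for i j
    unfolding fg by (rule cheb_poly_mono_ge_1) (use g0[OF that(2)] g_anti[OF that] in simp_all)
  \<comment> \<open>The vector is \<open>sig i\<close> times \<open>f(A) y i\<close>: the factor \<open>sig i\<close> makes its product with \<open>x i\<close> equal to \<open>1\<close>.\<close>
  have "\<exists>w. w \<in> K \<and> (\<forall>l\<in>{1..n}. w \<bullet>c x l = complex_of_real (poly f (lam l) * sig i) * (y i \<bullet>c x l))"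
    if i: "i \<in> {1..p}" for i
  proof -
    obtain w where w: "w \<in> K" "\<And>z l. z \<in> carrier_vec n \<Longrightarrow> A *\<^sub>v z = complex_of_real l \<cdot>\<^sub>v z
      \<Longrightarrow> w \<bullet>c z = complex_of_real (poly f l) * (y i \<bullet>c z)"
      using polynomial_in_block_krylov[OF A(1) Y(1) A(2) f(1) dual(1)[OF i]] unfolding K by blast
    have wc: "w \<in> carrier_vec n" using w(1) csubspaceD(1)[OF K_sub] by blast
    have "(complex_of_real (sig i) \<cdot>\<^sub>v w) \<bullet>c x l = complex_of_real (poly f (lam l) * sig i) * (y i \<bullet>c x l)"
      if l: "l \<in> {1..n}" for l
      unfolding inner_smult(1)[OF wc x_carrier[OF l]] w(2)[OF x_carrier[OF l] x_eigen[OF l]]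
      by (simp add: mult_ac)
    then show ?thesis using csubspaceD(4)[OF K_sub w(1)] by blast
  qed
  then have "\<forall>i\<in>{1..p}. \<exists>w. w \<in> K
      \<and> (\<forall>l\<in>{1..n}. w \<bullet>c x l = complex_of_real (poly f (lam l) * sig i) * (y i \<bullet>c x l))" by blast
  then obtain w where "\<forall>i\<in>{1..p}. w i \<in> K
      \<and> (\<forall>l\<in>{1..n}. w i \<bullet>c x l = complex_of_real (poly f (lam l) * sig i) * (y i \<bullet>c x l))"
    by (rule bchoice[THEN exE])
  then have w: "\<And>i. i \<in> {1..p} \<Longrightarrow> w i \<in> K"
    "\<And>i l. i \<in> {1..p} \<Longrightarrow> l \<in> {1..n}
      \<Longrightarrow> w i \<bullet>c x l = complex_of_real (poly f (lam l) * sig i) * (y i \<bullet>c x l)"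
    by blast+
  interpret filtered_dual_bases A n p lam sig "\<lambda>l. poly f (lam l)" x y w K
  proof (rule filtered_dual_bases.intro)
    show "A \<in> carrier_mat n n" "hermitian A" by (fact A)+
    show "p < n" by (fact p)
    show "lam n < lam p" using gap by simp
    show "csubspace n K" by (fact K_sub)
    show "lam j \<le> lam i" if "1 \<le> i" "i \<le> j" "j \<le> n" for i j using that by (rule lam)
    show "x i \<in> carrier_vec n" "A *\<^sub>v x i = complex_of_real (lam i) \<cdot>\<^sub>v x i" if "i \<in> {1..n}" for i
      using that by (rule x_carrier, rule x_eigen)
    show "x j \<bullet>c x i = (if i = j then 1 else 0)" if "i \<in> {1..n}" "j \<in> {1..n}" for i j
      using that by (rule x_orthonormal)
    show "y i \<in> carrier_vec n" "w i \<in> K" if "i \<in> {1..p}" for i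
      using that by (rule Yc, rule w(1))
    show "0 < sig i" if "i \<in> {1..p}" for i
      unfolding sig[OF that] using f1[OF that] by simp
    show "y i \<bullet>c x l = (if i = l then 1 else 0)" if "i \<in> {1..p}" "l \<in> {1..p}" for i l
      using that by (rule dual(2))
    show "w i \<bullet>c x l = (if i = l then 1 else 0)" if "i \<in> {1..p}" "l \<in> {1..p}" for i l
      unfolding w(2)[OF that(1) sub[OF that(2)]] dual(2)[OF that] using sig[OF that(1)] f1[OF that(1)] by auto
    show "sig i \<le> sig j" if "i \<in> {1..p}" "j \<in> {1..p}" "i \<le> j" for i j
      unfolding sig[OF that(1)] sig[OF that(2)]
      using fmono[OF that] f1[OF that(2)] by (intro le_imp_inverse_le) auto
    show "\<bar>poly f (lam l)\<bar> \<le> 1" if "l \<in> {p+1..n}" for l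
      using that lam[of "p + 1" l] lam[of l n] by (intro f(3)) auto
    show "w i \<bullet>c x l = complex_of_real (poly f (lam l) * sig i) * (y i \<bullet>c x l)"
      if "i \<in> {1..p}" "l \<in> {p+1..n}" for i l
      using that by (intro w(2)) auto
  qed
  have part1: "map tan (principal_angles n (cspan n (x ` \<tau>)) K)
        \<prec>\<^sub>w map sig (rev (sorted_list_of_set \<tau>)) *\<^sub>t map tan (principal_angles n (cspan n (x ` \<tau>)) (cspan n (y ` \<tau>)))
      \<and> map sig (rev (sorted_list_of_set \<tau>)) *\<^sub>t map tan (principal_angles n (cspan n (x ` \<tau>)) (cspan n (y ` \<tau>)))
        \<le>\<^sub>t map sig (rev (sorted_list_of_set \<tau>)) *\<^sub>t map tan (take (card \<tau>) (principal_angles n X Y))"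
    if \<tau>: "\<tau> \<subseteq> {1..p}" for \<tau>
  proof -
    define js where "js = rev (sorted_list_of_set \<tau>)"
    have fin: "finite \<tau>" using \<tau> finite_subset by blast
    have js: "set js \<subseteq> {1..p}" "sorted_wrt (>) js" and set_js: "set js = \<tau>" and len: "length js = card \<tau>"
      using \<tau> fin by (auto simp: js_def sorted_wrt_rev)
    note le = tan_dual_bases_le[OF js, unfolded set_js dual(3) X[symmetric]]
    show ?thesis
      unfolding js_def[symmetric]
    proof
      show "map tan (principal_angles n (cspan n (x ` \<tau>)) K)
        \<prec>\<^sub>w map sig js *\<^sub>t map tan (principal_angles n (cspan n (x ` \<tau>)) (cspan n (y ` \<tau>)))"
        using tan_krylov_majorized[OF js] unfolding set_js .
      show "map sig js *\<^sub>t map tan (principal_angles n (cspan n (x ` \<tau>)) (cspan n (y ` \<tau>)))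
        \<le>\<^sub>t map sig js *\<^sub>t map tan (take (card \<tau>) (principal_angles n X Y))"
      proof (cases "js = []")
        case False
        then have "0 < length js" by simp
        then have l1: "length (principal_angles n (cspan n (x ` \<tau>)) (cspan n (y ` \<tau>))) = length js"
          and l2: "length (principal_angles n X Y) = p"
          using le(3,4) by blast+
        have lp: "length js \<le> p" by (rule length_js_le[OF js])
        show ?thesis
          unfolding list_all2_conv_all_nth
        proof (intro conjI allI impI)
          show "length (map sig js *\<^sub>t map tan (principal_angles n (cspan n (x ` \<tau>)) (cspan n (y ` \<tau>))))
            = length (map sig js *\<^sub>t map tan (take (card \<tau>) (principal_angles n X Y)))"
            using l1 l2 lp len by simp
          fix l assume "l < length (map sig js *\<^sub>t map tan (principal_angles n (cspan n (x ` \<tau>)) (cspan n (y ` \<tau>))))"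
          then have l: "l < length js" by simp
          have "0 < sig (js ! l)" by (rule s_pos[OF js l])
          then show "(map sig js *\<^sub>t map tan (principal_angles n (cspan n (x ` \<tau>)) (cspan n (y ` \<tau>)))) ! l
            \<le> (map sig js *\<^sub>t map tan (take (card \<tau>) (principal_angles n X Y))) ! l"
            using le(2)[OF l] l l1 l2 lp len by (simp add: mult_left_mono)
        qed
      qed simp
    qed
  qed
  have part2: "map (\<lambda>\<theta>. (tan \<theta>)\<^sup>2) (principal_angles n (cspan n (x ` {1..i})) (cspan n (y ` {1..i})))
      \<le>\<^sub>t map (\<lambda>\<theta>. (tan \<theta>)\<^sup>2) (take i (principal_angles n X Y))"
    if i: "i \<in> {1..p}" for i
  proof -
    define js where "js = rev [1..<i+1]"
    have js: "set js \<subseteq> {1..p}" "sorted_wrt (>) js" and set_js: "set js = {1..i}" and len: "length js = i"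
      using i by (auto simp: js_def sorted_wrt_rev simp del: upt_Suc)
    note le = tan_dual_bases_le[OF js, unfolded set_js dual(3) X[symmetric] len]
    have "0 < i" "i \<le> p" using i by auto
    note l1 = le(4)[OF \<open>0 < i\<close>] and l2 = le(3)[OF \<open>0 < i\<close>]
    show ?thesis
      unfolding list_all2_conv_all_nth
    proof (intro conjI allI impI)
      fix l assume "l < length (map (\<lambda>\<theta>. (tan \<theta>)\<^sup>2) (principal_angles n (cspan n (x ` {1..i})) (cspan n (y ` {1..i}))))"
      then have l: "l < i" using l1 by simp
      show "map (\<lambda>\<theta>. (tan \<theta>)\<^sup>2) (principal_angles n (cspan n (x ` {1..i})) (cspan n (y ` {1..i}))) ! l
        \<le> map (\<lambda>\<theta>. (tan \<theta>)\<^sup>2) (take i (principal_angles n X Y)) ! l"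
        using le(1,2)[OF l] l l1 l2 \<open>i \<le> p\<close> by (simp add: power_mono)
    qed (use l1 l2 \<open>i \<le> p\<close> in simp)
  qed
  have scaled: "map (\<lambda>j. (sig j)\<^sup>2) is *\<^sub>t a \<le>\<^sub>t map (\<lambda>j. (sig j)\<^sup>2) is *\<^sub>t b" if "a \<le>\<^sub>t b" for "is" a b
    using that by (auto simp: list_all2_conv_all_nth intro!: mult_left_mono)
  show ?thesis
    unfolding Let_def
  proof (intro conjI allI impI ballI)
    fix \<tau> assume "\<tau> \<subseteq> {1..p}"
    note part1[OF this]
    then show "map tan (principal_angles n (cspan n (x ` \<tau>)) K)
        \<prec>\<^sub>w map sig (rev (sorted_list_of_set \<tau>)) *\<^sub>t map tan (principal_angles n (cspan n (x ` \<tau>)) (cspan n (y ` \<tau>)))"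
      and "map sig (rev (sorted_list_of_set \<tau>)) *\<^sub>t map tan (principal_angles n (cspan n (x ` \<tau>)) (cspan n (y ` \<tau>)))
        \<le>\<^sub>t map sig (rev (sorted_list_of_set \<tau>)) *\<^sub>t map tan (take (card \<tau>) (principal_angles n X Y))"
      by (rule conjunct1, rule conjunct2)
  qed (rule ritz_errors_majorized, assumption, rule scaled, rule part2, assumption)
qed

end
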